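(* Let $X$ be a graph with a free action of an amenable group $\Gamma$ with finite fundamental domain, let $\sigma$ be a rational (i.e. $\sigma^n=1$ for some positive integer $n$) weakly $\Gamma$-invariant weight function on $X$ with discrete magnetic Laplacian $\Delta_\sigma$, let $\{X_m\}$ be the regular exhaustion of $X$ corresponding to a regular exhaustion $\{\Lambda_m\}$ of $\Gamma$, and let $F_m(\lambda)=E_m(\lambda)/\#\Lambda_m$, where $E_m(\lambda)$ is the number of eigenvalues (counted with multiplicity) less than or equal to $\lambda$ of the restricted operator $\Delta_\sigma^{(m)}$ (with either Dirichlet or Neumann boundary conditions). Let $\lambda_1<\lambda_2$ be real numbers. Then the interval $(\lambda_1,\lambda_2)$ is in a gap in the spectrum of $\Delta_\sigma$ if and only if $$\lim_{m\to\infty}\big(F_m(\lambda_2)-F_m(\lambda_1)\big)=0.$$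
   Context: Graphs and group action. $X$ is a combinatorial graph with vertex set $\mathrm{Vert}\,X$ and set $\mathrm{Edge}\,X$ of oriented edges; each unoriented edge gives two oriented edges $e,\overline e$, and $\mathfrak{o}(e),\mathfrak{t}(e)$ are the origin and terminus of $e$. $E^+\subset \mathrm{Edge}\,X$ contains exactly one orientation of each unoriented edge. $\mathcal{O}(v)$ is the valence of $v$. $\Gamma$ is a finitely generated amenable discrete group acting freely on $X$ by graph automorphisms, with finitely many orbits of vertices and edges. $\mathcal{F}$ is a fundamental domain: a finite set of vertices and unoriented edges containing exactly one element of each $\Gamma$-orbit. Weight function and DML. A weight function is $\sigma:\mathrm{Edge}\,X\to U(1)$ with $\sigma(\overline e)=\sigma(e)^{-1}$. It is weakly $\Gamma$-invariant if for each $\gamma\in\Gamma$ there is $s_\gamma:\mathrm{Vert}\,X\to U(1)$ with $\sigma(\gamma e)=\sigma(e)s_\gamma(\mathfrak{t}(e))\overline{s_\gamma(\mathfrak{o}(e))}$ for all $e$. The discrete magnetic Laplacian (DML) is the bounded self-adjoint operator on $\ell^2(\mathrm{Vert}\,X)$ $$(\Delta_\sigma f)(v)=\mathcal{O}(v)f(v)-\sum_{e\in E^+,\,\mathfrak{t}(e)=v}\sigma(e)f(\mathfrak{o}(e))-\sum_{e\in E^+,\,\mathfrak{o}(e)=v}\overline{\sigma(e)}f(\mathfrak{t}(e)).$$ The interval $(\lambda_1,\lambda_2)$ is in a gap in the spectrum of $\Delta_\sigma$ if it does not meet the $\ell^2$-spectrum of $\Delta_\sigma$. Regular exhaustions. A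 regular exhaustion of $\Gamma$ is an increasing sequence of nonempty finite subsets $\Lambda_m\subset\Lambda_{m+1}$ with $\bigcup_m\Lambda_m=\Gamma$ such that for every $\delta>0$, $\lim_m \#\partial_\delta\Lambda_m/\#\Lambda_m=0$, where $\partial_\delta\Lambda_m=\{\gamma\in\Gamma: d_1(\gamma,\Lambda_m)<\delta,\ d_1(\gamma,\Gamma\setminus\Lambda_m)<\delta\}$ and $d_1$ is the word metric for a finite generating set. The corresponding regular exhaustion of $X$ consists of $X_m$, the largest subgraph of $X$ contained in $\bigcup_{\gamma\in\Lambda_m}\gamma\mathcal{F}$. Restricted DML. $\Delta_\sigma^{(m)}$ is the self-adjoint operator on functions on $\mathrm{Vert}\,X_m$ given by: (Dirichlet) $P_m\Delta_\sigma P_m$, where $P_m$ is the orthogonal projection onto functions supported on $\mathrm{Vert}\,X_m$; or (Neumann) the DML of the finite graph $X_m$ itself with weight $\sigma|_{X_m}$, i.e. the formula above with sums over edges of $X_m$ only and with $\mathcal{O}(v)$ replaced by the valence of $v$ in $X_m$.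
   Formalization: The direction "gap implies limit 0" is stated only when λ₂ is not an ℓ²-eigenvalue of Δ_σ, since it fails otherwise (one edge, trivial Γ, σ=1, λ₁=1, λ₂=2: the limit is 1); the direction "limit 0 implies gap" is unrestricted. *)

theory Defs
  imports
    "HOL-Analysis.Analysis"
    "HOL-Algebra.Group_Action"
    "HOL-Algebra.Generated_Groups"
    "HOL-Library.Function_Algebras"
    "Graph_Theory.Bidirected_Digraph"
    "Graph_Theory.Digraph_Component"
begin

section \<open>Graphs with a free group action\<close>

text \<open>
  A graph is given by its oriented edges: \<^term>\<open>arcs X\<close> with origin \<^term>\<open>tail X e\<close>, terminus
  \<^term>\<open>head X e\<close> and fixed-point free reversal \<^term>\<open>arev e\<close> (locale \<^locale>\<open>bidirected_digraph\<close>).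
  Loops and multiple edges are allowed. An unoriented edge is the set \<open>{e, arev e}\<close>.
\<close>

definition uedges :: "('v, 'e) pre_digraph \<Rightarrow> ('e \<Rightarrow> 'e) \<Rightarrow> 'e set set" where
  "uedges X arev = {{e, arev e} | e. e \<in> arcs X}"

definition orientation :: "('v, 'e) pre_digraph \<Rightarrow> ('e \<Rightarrow> 'e) \<Rightarrow> 'e set \<Rightarrow> bool" where
  "orientation X arev Ep \<longleftrightarrow>
     Ep \<subseteq> arcs X \<and> (\<forall>e\<in>arcs X. (e \<in> Ep) \<noteq> (arev e \<in> Ep))"

text \<open>Freeness on unoriented edges excludes inversions, so the action on the geometric
  realization is free.\<close>

locale free_graph_action =
  bidirected_digraph X arev +
  V: group_action \<Gamma> "verts X" \<phi> +
  E: group_action \<Gamma> "arcs X" \<psi>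
  for \<Gamma> :: "('g, 'a) monoid_scheme" (structure)
    and X :: "('v, 'e) pre_digraph" and arev :: "'e \<Rightarrow> 'e"
    and \<phi> :: "'g \<Rightarrow> 'v \<Rightarrow> 'v" and \<psi> :: "'g \<Rightarrow> 'e \<Rightarrow> 'e" +
  assumes tail_act: "\<lbrakk>\<gamma> \<in> carrier \<Gamma>; e \<in> arcs X\<rbrakk> \<Longrightarrow> tail X (\<psi> \<gamma> e) = \<phi> \<gamma> (tail X e)"
    and head_act: "\<lbrakk>\<gamma> \<in> carrier \<Gamma>; e \<in> arcs X\<rbrakk> \<Longrightarrow> head X (\<psi> \<gamma> e) = \<phi> \<gamma> (head X e)"
    and arev_act: "\<lbrakk>\<gamma> \<in> carrier \<Gamma>; e \<in> arcs X\<rbrakk> \<Longrightarrow> arev (\<psi> \<gamma> e) = \<psi> \<gamma> (arev e)"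
    and free_verts: "\<lbrakk>\<gamma> \<in> carrier \<Gamma>; v \<in> verts X; \<phi> \<gamma> v = v\<rbrakk> \<Longrightarrow> \<gamma> = \<one>"
    and free_edges: "\<lbrakk>\<gamma> \<in> carrier \<Gamma>; u \<in> uedges X arev; \<psi> \<gamma> ` u = u\<rbrakk> \<Longrightarrow> \<gamma> = \<one>"

text \<open>\<open>FV\<close> and \<open>FE\<close> are the vertices and the unoriented edges of the fundamental domain.\<close>

definition fundamental_domain ::
  "('g, 'a) monoid_scheme \<Rightarrow> ('v, 'e) pre_digraph \<Rightarrow> ('e \<Rightarrow> 'e) \<Rightarrow>
   ('g \<Rightarrow> 'v \<Rightarrow> 'v) \<Rightarrow> ('g \<Rightarrow> 'e \<Rightarrow> 'e) \<Rightarrow> 'v set \<Rightarrow> 'e set set \<Rightarrow> bool" where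
  "fundamental_domain \<Gamma> X arev \<phi> \<psi> FV FE \<longleftrightarrow>
     finite FV \<and> FV \<subseteq> verts X \<and> finite FE \<and> FE \<subseteq> uedges X arev \<and>
     (\<forall>v\<in>verts X. \<exists>!v'. v' \<in> FV \<inter> Group_Action.orbit \<Gamma> \<phi> v) \<and>
     (\<forall>u\<in>uedges X arev. \<exists>!u'. u' \<in> FE \<inter> Group_Action.orbit \<Gamma> (\<lambda>\<gamma>. image (\<psi> \<gamma>)) u)"


section \<open>Amenability and regular exhaustions\<close>

text \<open>Existence of a left-invariant finitely additive probability measure on all subsets.\<close>

definition amenable :: "('g, 'a) monoid_scheme \<Rightarrow> bool" where
  "amenable \<Gamma> \<longleftrightarrow> (\<exists>\<mu> :: 'g set \<Rightarrow> real.
     \<mu> (carrier \<Gamma>) = 1 \<and>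
     (\<forall>A\<subseteq>carrier \<Gamma>. 0 \<le> \<mu> A) \<and>
     (\<forall>A\<subseteq>carrier \<Gamma>. \<forall>B\<subseteq>carrier \<Gamma>. A \<inter> B = {} \<longrightarrow> \<mu> (A \<union> B) = \<mu> A + \<mu> B) \<and>
     (\<forall>\<gamma>\<in>carrier \<Gamma>. \<forall>A\<subseteq>carrier \<Gamma>. \<mu> (\<gamma> <#\<^bsub>\<Gamma>\<^esub> A) = \<mu> A))"

definition word_length :: "('g, 'a) monoid_scheme \<Rightarrow> 'g set \<Rightarrow> 'g \<Rightarrow> nat" where
  "word_length \<Gamma> S \<gamma> = (LEAST n. \<exists>ws. length ws = n \<and> set ws \<subseteq> S \<union> m_inv \<Gamma> ` S \<and>
     \<gamma> = foldr (\<otimes>\<^bsub>\<Gamma>\<^esub>) ws \<one>\<^bsub>\<Gamma>\<^esub>)"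

text \<open>The left-invariant word metric; this is the side that fits a left action on the graph,
  for which the neighbours of a translate \<open>\<gamma> \<F>\<close> are translates \<open>\<gamma> s \<F>\<close>.\<close>

definition word_dist :: "('g, 'a) monoid_scheme \<Rightarrow> 'g set \<Rightarrow> 'g \<Rightarrow> 'g \<Rightarrow> real" where
  "word_dist \<Gamma> S \<gamma> \<eta> = real (word_length \<Gamma> S (inv\<^bsub>\<Gamma>\<^esub> \<gamma> \<otimes>\<^bsub>\<Gamma>\<^esub> \<eta>))"

text \<open>\<open>d(\<gamma>, A) < \<delta>\<close> is written as the existence of a point of \<open>A\<close> at distance less than \<open>\<delta>\<close>,
  so that the distance to the empty set is infinite (\<^const>\<open>infdist\<close> would give 0).\<close>

definition group_boundary ::
  "('g, 'a) monoid_scheme \<Rightarrow> 'g set \<Rightarrow> real \<Rightarrow> 'g set \<Rightarrow> 'g set" where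
  "group_boundary \<Gamma> S \<delta> A = {\<gamma> \<in> carrier \<Gamma>.
     (\<exists>\<eta>\<in>A. word_dist \<Gamma> S \<gamma> \<eta> < \<delta>) \<and> (\<exists>\<eta>\<in>carrier \<Gamma> - A. word_dist \<Gamma> S \<gamma> \<eta> < \<delta>)}"

definition regular_exhaustion ::
  "('g, 'a) monoid_scheme \<Rightarrow> 'g set \<Rightarrow> (nat \<Rightarrow> 'g set) \<Rightarrow> bool" where
  "regular_exhaustion \<Gamma> S \<Lambda> \<longleftrightarrow>
     (\<forall>m. finite (\<Lambda> m) \<and> \<Lambda> m \<noteq> {} \<and> \<Lambda> m \<subseteq> \<Lambda> (Suc m)) \<and>
     (\<Union>m. \<Lambda> m) = carrier \<Gamma> \<and>
     (\<forall>\<delta>>0. (\<lambda>m. real (card (group_boundary \<Gamma> S \<delta> (\<Lambda> m))) / real (card (\<Lambda> m)))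
        \<longlonglongrightarrow> 0)"

text \<open>The largest subgraph contained in the union of the translates of the fundamental domain
  by \<open>A\<close>: an edge of a translate is kept iff both its endpoints lie in the union.\<close>

definition exhausting_subgraph ::
  "('v, 'e) pre_digraph \<Rightarrow> ('g \<Rightarrow> 'v \<Rightarrow> 'v) \<Rightarrow> ('g \<Rightarrow> 'e \<Rightarrow> 'e) \<Rightarrow>
   'v set \<Rightarrow> 'e set set \<Rightarrow> 'g set \<Rightarrow> ('v, 'e) pre_digraph" where
  "exhausting_subgraph X \<phi> \<psi> FV FE A =
     (let W = (\<Union>\<gamma>\<in>A. \<phi> \<gamma> ` FV)
      in X\<lparr>verts := W,
           arcs := {e \<in> (\<Union>\<gamma>\<in>A. \<psi> \<gamma> ` \<Union>FE). tail X e \<in> W \<and> head X e \<in> W}\<rparr>)"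

lemma (in free_graph_action) exhausting_subgraph_largest:
  assumes F: "fundamental_domain \<Gamma> X arev \<phi> \<psi> FV FE" and A: "A \<subseteq> carrier \<Gamma>"
  defines "Y \<equiv> exhausting_subgraph X \<phi> \<psi> FV FE A"
  shows "subgraph Y X"
    and "e \<in> arcs Y \<Longrightarrow> arev e \<in> arcs Y"
    and "\<lbrakk>subgraph H X; verts H \<subseteq> (\<Union>\<gamma>\<in>A. \<phi> \<gamma> ` FV); arcs H \<subseteq> (\<Union>\<gamma>\<in>A. \<psi> \<gamma> ` \<Union>FE)\<rbrakk>
           \<Longrightarrow> subgraph H Y"
proof -
  have FV: "FV \<subseteq> verts X" and FE: "FE \<subseteq> uedges X arev"
    using F by (auto simp: fundamental_domain_def)
  have ae: "e \<in> arcs X \<and> arev e \<in> \<Union>FE" if e: "e \<in> \<Union>FE" for e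
  proof -
    obtain u where u: "u \<in> FE" "e \<in> u" using e by blast
    then obtain e' where e': "u = {e', arev e'}" "e' \<in> arcs X"
      using FE by (auto simp: uedges_def)
    then have "e \<in> arcs X" "arev e \<in> u" using u by auto
    then show ?thesis using u by blast
  qed
  have ac: "\<psi> \<gamma> e \<in> arcs X" if "\<gamma> \<in> A" "e \<in> \<Union>FE" for \<gamma> e
    using that A ae E.element_image by blast
  have vc: "\<phi> \<gamma> v \<in> verts X" if "\<gamma> \<in> A" "v \<in> FV" for \<gamma> v
    using that A FV V.element_image by blast
  have wfY: "wf_digraph Y"
    by unfold_locales (auto simp: Y_def exhausting_subgraph_def Let_def)
  show sub: "subgraph Y X"
    unfolding subgraph_def
    using wfY ac vc wf_digraph
    by (auto simp: Y_def exhausting_subgraph_def Let_def compatible_def)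
  show "arev e \<in> arcs Y" if e: "e \<in> arcs Y"
  proof -
    obtain \<gamma> e' where g: "\<gamma> \<in> A" "e' \<in> \<Union>FE" "e = \<psi> \<gamma> e'"
      using e by (auto simp: Y_def exhausting_subgraph_def Let_def)
    have eX: "e \<in> arcs X" using ac g by simp
    have "arev e = \<psi> \<gamma> (arev e')" using g A ae arev_act by blast
    then have "arev e \<in> (\<Union>\<gamma>\<in>A. \<psi> \<gamma> ` \<Union>FE)" using g ae by blast
    then show ?thesis using e eX
      by (auto simp: Y_def exhausting_subgraph_def Let_def)
  qed
  show "subgraph H Y" if H: "subgraph H X" "verts H \<subseteq> (\<Union>\<gamma>\<in>A. \<phi> \<gamma> ` FV)"
    "arcs H \<subseteq> (\<Union>\<gamma>\<in>A. \<psi> \<gamma> ` \<Union>FE)"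
  proof -
    have c: "tail X = tail H" "head X = head H" and wH: "wf_digraph H"
      using H(1) by (auto simp: subgraph_def compatible_def)
    have "arcs H \<subseteq> arcs Y"
    proof
      fix e assume "e \<in> arcs H"
      then show "e \<in> arcs Y"
        using H(2,3) c wf_digraph.tail_in_verts[OF wH] wf_digraph.head_in_verts[OF wH]
        by (fastforce simp: Y_def exhausting_subgraph_def Let_def)
    qed
    then show ?thesis
      unfolding subgraph_def using wfY wH H(2) c
      by (auto simp: Y_def exhausting_subgraph_def Let_def compatible_def)
  qed
qed


section \<open>Operators on \<open>\<ell>\<^sup>2\<close>\<close>

text \<open>Functions on \<open>V\<close> are extended by 0 to the whole type. For finite \<open>V\<close>, \<open>ell2 V\<close> consists
  of all functions on \<open>V\<close>.\<close>

definition ell2 :: "'v set \<Rightarrow> ('v \<Rightarrow> complex) set" where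
  "ell2 V = {f. (\<forall>v. v \<notin> V \<longrightarrow> f v = 0) \<and> (\<lambda>v. (cmod (f v))\<^sup>2) summable_on V}"

definition ell2_norm :: "'v set \<Rightarrow> ('v \<Rightarrow> complex) \<Rightarrow> real" where
  "ell2_norm V f = sqrt (\<Sum>\<^sub>\<infinity>v\<in>V. (cmod (f v))\<^sup>2)"

definition bounded_operator :: "'v set \<Rightarrow> (('v \<Rightarrow> complex) \<Rightarrow> 'v \<Rightarrow> complex) \<Rightarrow> bool" where
  "bounded_operator V A \<longleftrightarrow>
     (\<forall>f\<in>ell2 V. A f \<in> ell2 V) \<and>
     (\<forall>f\<in>ell2 V. \<forall>g\<in>ell2 V. A (\<lambda>v. f v + g v) = (\<lambda>v. A f v + A g v)) \<and>
     (\<forall>c. \<forall>f\<in>ell2 V. A (\<lambda>v. c * f v) = (\<lambda>v. c * A f v)) \<and>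
     (\<exists>C. \<forall>f\<in>ell2 V. ell2_norm V (A f) \<le> C * ell2_norm V f)"

definition ell2_spectrum :: "'v set \<Rightarrow> (('v \<Rightarrow> complex) \<Rightarrow> 'v \<Rightarrow> complex) \<Rightarrow> complex set" where
  "ell2_spectrum V A = {\<mu>. \<not> (\<exists>R. bounded_operator V R \<and>
     (\<forall>f\<in>ell2 V. R (\<lambda>v. A f v - \<mu> * f v) = f \<and> (\<lambda>v. A (R f) v - \<mu> * R f v) = f))}"

definition in_spectral_gap ::
  "'v set \<Rightarrow> (('v \<Rightarrow> complex) \<Rightarrow> 'v \<Rightarrow> complex) \<Rightarrow> real \<Rightarrow> real \<Rightarrow> bool" where
  "in_spectral_gap V A a b \<longleftrightarrow> complex_of_real ` {a<..<b} \<inter> ell2_spectrum V A = {}"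

definition eigenspace ::
  "'v set \<Rightarrow> (('v \<Rightarrow> complex) \<Rightarrow> 'v \<Rightarrow> complex) \<Rightarrow> complex \<Rightarrow> ('v \<Rightarrow> complex) set" where
  "eigenspace V A \<mu> = {f \<in> ell2 V. A f = (\<lambda>v. \<mu> * f v)}"

definition is_eigenvalue ::
  "'v set \<Rightarrow> (('v \<Rightarrow> complex) \<Rightarrow> 'v \<Rightarrow> complex) \<Rightarrow> complex \<Rightarrow> bool" where
  "is_eigenvalue V A \<mu> \<longleftrightarrow> (\<exists>f\<in>eigenspace V A \<mu>. f \<noteq> (\<lambda>_. 0))"

interpretation cfun: vector_space "\<lambda>(c::complex) (f::'v \<Rightarrow> complex) v. c * f v"
  by unfold_locales (auto simp: fun_eq_iff algebra_simps)

text \<open>Meant for a self-adjoint \<open>A\<close> and finite \<open>V\<close>: all eigenvalues are real and finite in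
  number, and the multiplicity is the complex dimension of the eigenspace.\<close>

definition eigenvalue_count ::
  "'v set \<Rightarrow> (('v \<Rightarrow> complex) \<Rightarrow> 'v \<Rightarrow> complex) \<Rightarrow> real \<Rightarrow> nat" where
  "eigenvalue_count V A r =
     (\<Sum>\<mu>\<in>{\<mu>::real. \<mu> \<le> r \<and> is_eigenvalue V A (complex_of_real \<mu>)}.
        cfun.dim (eigenspace V A (complex_of_real \<mu>)))"


section \<open>Discrete magnetic Laplacians\<close>

definition weight_function ::
  "('v, 'e) pre_digraph \<Rightarrow> ('e \<Rightarrow> 'e) \<Rightarrow> ('e \<Rightarrow> complex) \<Rightarrow> bool" where
  "weight_function X arev \<sigma> \<longleftrightarrow>
     (\<forall>e\<in>arcs X. cmod (\<sigma> e) = 1 \<and> \<sigma> (arev e) = inverse (\<sigma> e))"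

definition weakly_invariant ::
  "('g, 'a) monoid_scheme \<Rightarrow> ('v, 'e) pre_digraph \<Rightarrow> ('g \<Rightarrow> 'e \<Rightarrow> 'e) \<Rightarrow>
   ('e \<Rightarrow> complex) \<Rightarrow> bool" where
  "weakly_invariant \<Gamma> X \<psi> \<sigma> \<longleftrightarrow>
     (\<forall>\<gamma>\<in>carrier \<Gamma>. \<exists>s :: 'v \<Rightarrow> complex.
        (\<forall>v\<in>verts X. cmod (s v) = 1) \<and>
        (\<forall>e\<in>arcs X. \<sigma> (\<psi> \<gamma> e) = \<sigma> e * s (head X e) * cnj (s (tail X e))))"

definition rational_weight :: "('v, 'e) pre_digraph \<Rightarrow> ('e \<Rightarrow> complex) \<Rightarrow> bool" where
  "rational_weight X \<sigma> \<longleftrightarrow> (\<exists>n::nat>0. \<forall>e\<in>arcs X. \<sigma> e ^ n = 1)"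

text \<open>The valence of \<open>v\<close> is the number of oriented edges ending in \<open>v\<close>; a loop counts twice.
  Only the edges of \<open>X\<close> in \<open>Ep\<close> matter, so \<open>dml Y Ep \<sigma>\<close> is also the operator of a subgraph
  \<open>Y\<close> when \<open>Ep\<close> is an orientation of the ambient graph.\<close>

definition dml ::
  "('v, 'e) pre_digraph \<Rightarrow> 'e set \<Rightarrow> ('e \<Rightarrow> complex) \<Rightarrow> ('v \<Rightarrow> complex) \<Rightarrow> 'v \<Rightarrow> complex" where
  "dml X Ep \<sigma> f v =
     (if v \<in> verts X
      then of_nat (in_degree X v) * f v
           - (\<Sum>e\<in>Ep \<inter> in_arcs X v. \<sigma> e * f (tail X e))
           - (\<Sum>e\<in>Ep \<inter> out_arcs X v. cnj (\<sigma> e) * f (head X e))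
      else 0)"

datatype boundary_condition = Dirichlet | Neumann

definition restrict_fun :: "'v set \<Rightarrow> ('v \<Rightarrow> complex) \<Rightarrow> 'v \<Rightarrow> complex" where
  "restrict_fun W f = (\<lambda>v. if v \<in> W then f v else 0)"

fun restricted_dml ::
  "boundary_condition \<Rightarrow> ('v, 'e) pre_digraph \<Rightarrow> ('v, 'e) pre_digraph \<Rightarrow> 'e set \<Rightarrow>
   ('e \<Rightarrow> complex) \<Rightarrow> ('v \<Rightarrow> complex) \<Rightarrow> 'v \<Rightarrow> complex" where
  "restricted_dml Dirichlet X Y Ep \<sigma> f =
     restrict_fun (verts Y) (dml X Ep \<sigma> (restrict_fun (verts Y) f))"
| "restricted_dml Neumann X Y Ep \<sigma> f = dml Y Ep \<sigma> f"

text \<open>The normalized counting function \<open>F\<^sub>m(\<lambda>) = E\<^sub>m(\<lambda>) / #\<Lambda>\<^sub>m\<close> for \<open>\<lambda> = r\<close>, \<open>A = \<Lambda>\<^sub>m\<close>. It counts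
  eigenvalues \<open>\<le> \<lambda>\<close>, so \<open>F\<^sub>m(b) - F\<^sub>m(a)\<close> concerns the half-open interval \<open>(a, b]\<close> and is
  sensitive to an eigenvalue at \<open>b\<close>, whereas \<^const>\<open>in_spectral_gap\<close> concerns the open interval
  \<open>(a, b)\<close>.\<close>

definition normalized_count ::
  "boundary_condition \<Rightarrow> ('v, 'e) pre_digraph \<Rightarrow> ('g \<Rightarrow> 'v \<Rightarrow> 'v) \<Rightarrow> ('g \<Rightarrow> 'e \<Rightarrow> 'e) \<Rightarrow>
   'v set \<Rightarrow> 'e set set \<Rightarrow> 'e set \<Rightarrow> ('e \<Rightarrow> complex) \<Rightarrow> 'g set \<Rightarrow> real \<Rightarrow> real" where
  "normalized_count bc X \<phi> \<psi> FV FE Ep \<sigma> A r =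
     (let Y = exhausting_subgraph X \<phi> \<psi> FV FE A
      in real (eigenvalue_count (verts Y) (restricted_dml bc X Y Ep \<sigma>) r) / real (card A))"

end

theory Submission
  imports Defs "Jordan_Normal_Form.Char_Poly"
begin

text \<open>
  Restricting to \<open>X\<^sub>m\<close> changes the operator only near the boundary, which carries a vanishing
  proportion of the vertices, so dimension counts modulo the boundary compare \<open>\<Delta>\<^sub>\<sigma>\<close> with its
  restrictions. A finitely supported approximate eigenvector has many disjoint translates in \<open>X\<^sub>m\<close>,
  hence spectrum inside \<open>(\<lambda>\<^sub>1, \<lambda>\<^sub>2)\<close> forces a positive density of eigenvalues of the restrictions.
  Conversely, in a gap a combination of eigenvectors of the restriction with eigenvalues in a compact
  subinterval that vanishes near the boundary must be zero. Near \<open>\<lambda>\<^sub>2\<close>, a positive density of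
  eigenvalues for arbitrarily small windows would yield, by translating concentrated vectors and
  compactness, an \<open>\<ell>\<^sup>2\<close>-eigenfunction. The same applies at \<open>\<lambda>\<^sub>1\<close> unless \<open>\<lambda>\<^sub>1\<close> is an eigenvalue; then
  a dimension count shows that it is an eigenvalue of some restriction, hence, the weight being
  rational, a root of an integral polynomial \<open>p\<close>. Passing to the cover that trivializes the weight,
  \<open>p\<close> of the restrictions becomes an integral matrix; the product of its nonzero eigenvalues is at
  least 1 in absolute value, which bounds the number of eigenvalues just above \<open>\<lambda>\<^sub>1\<close>.
\<close>

section \<open>Finite-dimensional Hermitian operators\<close>

text \<open>The difficulty sits at the two ends. The counting difference sees the half-open interval
  (lam1, lam2], the gap only the open one. An l2-eigenvalue at lam2 has positive density in the
  restrictions near lam2 and may be counted, so the implication from gap to limit assumes that there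
  is none. At lam1 nothing can be assumed: eigenvalues equal to lam1 may have positive density
  without being counted, and only those strictly above it have to be rare. Compactness cannot tell
  the two kinds apart. Arithmetic can: an integral polynomial vanishing at lam1 takes small nonzero
  values just to its right, and an integral matrix admits few small nonzero eigenvalues because the
  logarithms of the large ones add up to at most a multiple of its size. The polynomial comes from
  one fixed restriction, which keeps the bounds uniform in m. Gaps are handled through lower bounds
  on finitely supported functions; only the endpoint arguments use genuine
  l2-eigenfunctions.\<close>

lemma homogeneous_system_nontrivial:
  fixes M :: "'i \<Rightarrow> 'j \<Rightarrow> complex"
  assumes "finite I" "finite J" "card I < card J"
  shows "\<exists>c. (\<exists>j\<in>J. c j \<noteq> 0) \<and> (\<forall>i\<in>I. (\<Sum>j\<in>J. M i j * c j) = 0)"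
  using assms
proof (induction I arbitrary: J M rule: finite_induct)
  case empty
  then obtain j where "j \<in> J" by fastforce
  then show ?case by (intro exI[of _ "\<lambda>_. 1"]) auto
next
  case (insert i I)
  show ?case
  proof (cases "\<forall>j\<in>J. M i j = 0")
    case True
    obtain c where c: "\<exists>j\<in>J. c j \<noteq> 0" "\<forall>i\<in>I. (\<Sum>j\<in>J. M i j * c j) = 0"
      using insert.IH[of J M] insert.prems insert.hyps by auto
    moreover have "(\<Sum>j\<in>J. M i j * c j) = 0" using True by simp
    ultimately show ?thesis by auto
  next
    case False
    then obtain j0 where j0: "j0 \<in> J" "M i j0 \<noteq> 0" by auto
    define J' where "J' = J - {j0}"
    \<comment> \<open>Elimination with the nonzero pivot \<open>M i j0\<close>; the unknown
      \<open>j0\<close> is recovered afterwards from equation \<open>i\<close>.\<close>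
    define M' where "M' k j = M k j - M k j0 * M i j / M i j0" for k j
    have "card I < card J'" "finite J'"
      using insert.prems insert.hyps j0 by (auto simp: J'_def)
    then obtain c where c: "\<exists>j\<in>J'. c j \<noteq> 0" "\<And>k. k \<in> I \<Longrightarrow> (\<Sum>j\<in>J'. M' k j * c j) = 0"
      using insert.IH[of J' M'] by auto
    define d where "d = c(j0 := - (\<Sum>j\<in>J'. M i j * c j) / M i j0)"
    have split: "(\<Sum>j\<in>J. M k j * d j) = M k j0 * d j0 + (\<Sum>j\<in>J'. M k j * c j)" for k
    proof -
      have "(\<Sum>j\<in>J. M k j * d j) = M k j0 * d j0 + (\<Sum>j\<in>J'. M k j * d j)"
        using j0 insert.prems by (simp add: J'_def sum.remove)
      moreover have "(\<Sum>j\<in>J'. M k j * d j) = (\<Sum>j\<in>J'. M k j * c j)"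
        by (intro sum.cong) (auto simp: d_def J'_def)
      ultimately show ?thesis by simp
    qed
    have "(\<Sum>j\<in>J. M k j * d j) = 0" if "k \<in> insert i I" for k
    proof (cases "k = i")
      case True
      then show ?thesis using j0 unfolding split by (simp add: d_def)
    next
      case False
      then have "k \<in> I" using that by simp
      then have "0 = (\<Sum>j\<in>J'. M' k j * c j)" using c by simp
      also have "\<dots> = (\<Sum>j\<in>J'. M k j * c j) - M k j0 / M i j0 * (\<Sum>j\<in>J'. M i j * c j)"
        unfolding M'_def sum_distrib_left sum_subtractf[symmetric]
        by (intro sum.cong) (auto simp: algebra_simps)
      finally show ?thesis unfolding split by (simp add: d_def)
    qed
    moreover have "\<exists>j\<in>J. d j \<noteq> 0"
      using c(1) by (auto simp: d_def J'_def)
    ultimately show ?thesis by blast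
  qed
qed

section \<open>Finite orthonormal families\<close>

definition funs_on :: "'v set \<Rightarrow> ('v \<Rightarrow> complex) set" where
  "funs_on S = {f. \<forall>v. v \<notin> S \<longrightarrow> f v = 0}"

definition inner_on :: "'v set \<Rightarrow> ('v \<Rightarrow> complex) \<Rightarrow> ('v \<Rightarrow> complex) \<Rightarrow> complex" where
  "inner_on S f g = (\<Sum>v\<in>S. f v * cnj (g v))"

definition normsq :: "'v set \<Rightarrow> ('v \<Rightarrow> complex) \<Rightarrow> real" where
  "normsq S f = (\<Sum>v\<in>S. (cmod (f v))\<^sup>2)"

definition orthonormal_on :: "'v set \<Rightarrow> 'i set \<Rightarrow> ('i \<Rightarrow> 'v \<Rightarrow> complex) \<Rightarrow> bool" where
  "orthonormal_on S J u \<longleftrightarrow> (\<forall>i\<in>J. \<forall>j\<in>J. inner_on S (u i) (u j) = (if i = j then 1 else 0))"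

lemma inner_on_self: "inner_on S f f = of_real (normsq S f)"
  by (simp add: inner_on_def normsq_def complex_norm_square del: of_real_power)

lemma cnj_inner_on: "cnj (inner_on S f g) = inner_on S g f"
  by (simp add: inner_on_def mult.commute)

lemma inner_on_sum_left: "inner_on S (\<lambda>v. \<Sum>j\<in>J. c j * u j v) g = (\<Sum>j\<in>J. c j * inner_on S (u j) g)"
  unfolding inner_on_def sum_distrib_left sum_distrib_right
  by (subst sum.swap) (simp add: mult.assoc)

lemma inner_on_sum_right:
  "inner_on S g (\<lambda>v. \<Sum>j\<in>J. c j * u j v) = (\<Sum>j\<in>J. cnj (c j) * inner_on S g (u j))"
  by (subst (1 2) cnj_inner_on[symmetric]) (simp add: inner_on_sum_left)

lemma inner_on_scale_left: "inner_on S (\<lambda>v. c * f v) g = c * inner_on S f g"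
  by (simp add: inner_on_def sum_distrib_left mult.assoc)

lemma inner_on_scale_right: "inner_on S f (\<lambda>v. c * g v) = cnj c * inner_on S f g"
  by (simp add: inner_on_def sum_distrib_left mult.assoc mult.left_commute)

lemma inner_on_diff_left: "inner_on S (\<lambda>v. f v - g v) h = inner_on S f h - inner_on S g h"
  by (simp add: inner_on_def left_diff_distrib sum_subtractf)

lemma inner_on_diff_right: "inner_on S h (\<lambda>v. f v - g v) = inner_on S h f - inner_on S h g"
  by (simp add: inner_on_def right_diff_distrib sum_subtractf)

lemma normsq_nonneg [simp]: "0 \<le> normsq S f"
  by (simp add: normsq_def sum_nonneg)

lemma normsq_eq_0_iff: "finite S \<Longrightarrow> normsq S f = 0 \<longleftrightarrow> (\<forall>v\<in>S. f v = 0)"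
  by (simp add: normsq_def sum_nonneg_eq_0_iff)

lemma normsq_pos: "finite S \<Longrightarrow> f \<in> funs_on S \<Longrightarrow> f v \<noteq> 0 \<Longrightarrow> normsq S f > 0"
  by (metis (mono_tags, lifting) funs_on_def less_eq_real_def mem_Collect_eq normsq_eq_0_iff normsq_nonneg)

lemma normsq_scale: "normsq S (\<lambda>v. c * f v) = (cmod c)\<^sup>2 * normsq S f"
  by (simp add: normsq_def norm_mult power_mult_distrib sum_distrib_left)

lemma cmod_le_normsq: "finite S \<Longrightarrow> v \<in> S \<Longrightarrow> (cmod (f v))\<^sup>2 \<le> normsq S f"
  unfolding normsq_def by (rule member_le_sum) auto

lemma normsq_mono: "finite T \<Longrightarrow> S \<subseteq> T \<Longrightarrow> normsq S f \<le> normsq T f"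
  unfolding normsq_def by (rule sum_mono2) auto

lemma normsq_superset: "finite T \<Longrightarrow> S \<subseteq> T \<Longrightarrow> f \<in> funs_on S \<Longrightarrow> normsq T f = normsq S f"
  unfolding normsq_def by (rule sum.mono_neutral_right) (auto simp: funs_on_def)

lemma funs_on_mono: "S \<subseteq> T \<Longrightarrow> f \<in> funs_on S \<Longrightarrow> f \<in> funs_on T"
  by (auto simp: funs_on_def)

lemma normsq_cong_supp:
  assumes "finite S" "finite T" "f \<in> funs_on S" "f \<in> funs_on T"
  shows "normsq S f = normsq T f"
  by (metis assms finite_UnI normsq_superset sup_ge1 sup_ge2)

lemma orthogonal_normsq_sum:
  assumes "finite J" "\<And>i j. i \<in> J \<Longrightarrow> j \<in> J \<Longrightarrow> i \<noteq> j \<Longrightarrow> inner_on S (u i) (u j) = 0"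
  shows "normsq S (\<lambda>v. \<Sum>j\<in>J. c j * u j v) = (\<Sum>j\<in>J. (cmod (c j))\<^sup>2 * normsq S (u j))"
proof -
  have "inner_on S (\<lambda>v. \<Sum>j\<in>J. c j * u j v) (\<lambda>v. \<Sum>j\<in>J. c j * u j v)
      = (\<Sum>i\<in>J. c i * (\<Sum>j\<in>J. cnj (c j) * inner_on S (u i) (u j)))"
    by (simp add: inner_on_sum_left inner_on_sum_right)
  also have "\<dots> = (\<Sum>i\<in>J. c i * (cnj (c i) * inner_on S (u i) (u i)))"
  proof (intro sum.cong refl, goal_cases)
    case (1 i)
    have "(\<Sum>j\<in>J. cnj (c j) * inner_on S (u i) (u j))
        = (\<Sum>j\<in>J. if j = i then cnj (c i) * inner_on S (u i) (u i) else 0)"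
      using assms(2) 1 by (intro sum.cong) auto
    then show ?case using 1 assms(1) by simp
  qed
  also have "\<dots> = of_real (\<Sum>j\<in>J. (cmod (c j))\<^sup>2 * normsq S (u j))"
    unfolding inner_on_self of_real_sum
    by (intro sum.cong refl) (simp add: complex_norm_square mult.assoc[symmetric] del: of_real_power)
  finally show ?thesis unfolding inner_on_self of_real_eq_iff .
qed

lemma orthonormal_inner_sum:
  assumes "orthonormal_on S J u" "finite J" "i \<in> J"
  shows "inner_on S (\<lambda>v. \<Sum>j\<in>J. c j * u j v) (u i) = c i"
proof -
  have "(\<Sum>j\<in>J. c j * inner_on S (u j) (u i)) = (\<Sum>j\<in>J. if j = i then c i else 0)"
    using assms by (intro sum.cong) (auto simp: orthonormal_on_def)
  then show ?thesis using assms by (simp add: inner_on_sum_left)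
qed

lemma orthonormal_normsq: "orthonormal_on S J u \<Longrightarrow> j \<in> J \<Longrightarrow> normsq S (u j) = 1"
  using inner_on_self[of S "u j"] by (simp add: orthonormal_on_def)

lemma orthonormal_normsq_sum:
  assumes "orthonormal_on S J u" "finite J"
  shows "normsq S (\<lambda>v. \<Sum>j\<in>J. c j * u j v) = (\<Sum>j\<in>J. (cmod (c j))\<^sup>2)"
  using assms orthonormal_normsq[OF assms(1)]
  by (subst orthogonal_normsq_sum) (auto simp: orthonormal_on_def)

lemma orthonormal_on_subset: "orthonormal_on S J u \<Longrightarrow> I \<subseteq> J \<Longrightarrow> orthonormal_on S I u"
  unfolding orthonormal_on_def by blast

text \<open>With more vectors than points, some nontrivial combination vanishes on \<open>S\<close>,
  although orthonormality makes its squared norm the sum of the squared coefficients.\<close>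

lemma orthonormal_card_le:
  assumes "orthonormal_on S J u" "finite S" "finite J"
  shows "card J \<le> card S"
proof (rule ccontr)
  assume "\<not> card J \<le> card S"
  then obtain c where c: "\<exists>j\<in>J. c j \<noteq> 0" "\<forall>v\<in>S. (\<Sum>j\<in>J. u j v * c j) = 0"
    using homogeneous_system_nontrivial[of S J "\<lambda>v j. u j v"] assms by auto
  have "(\<Sum>j\<in>J. (cmod (c j))\<^sup>2) = normsq S (\<lambda>v. \<Sum>j\<in>J. c j * u j v)"
    using orthonormal_normsq_sum[OF assms(1,3)] by simp
  also have "\<dots> = 0"
    using c(2) assms by (simp add: normsq_eq_0_iff mult.commute)
  finally show False using c(1) assms(3) by (auto simp: sum_nonneg_eq_0_iff)
qed

lemma orthonormal_extend:
  assumes on: "orthonormal_on S {..<k::nat} u" and "finite S" "g \<in> funs_on S" "g v \<noteq> 0"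
    and "\<And>i. i < k \<Longrightarrow> inner_on S g (u i) = 0"
  defines "w \<equiv> (\<lambda>v. of_real (1 / sqrt (normsq S g)) * g v)"
  shows "orthonormal_on S {..<Suc k} (u(k := w))"
proof -
  have pos: "normsq S g > 0" by (rule normsq_pos) fact+
  have n: "normsq S w = 1"
    unfolding w_def normsq_scale using pos by (simp add: power_divide norm_divide)
  have "inner_on S w (u i) = 0" if "i < k" for i
    unfolding w_def inner_on_scale_left using assms that by simp
  moreover from this have "inner_on S (u i) w = 0" if "i < k" for i
    using that by (metis cnj_inner_on complex_cnj_zero)
  moreover have "inner_on S w w = 1" by (simp add: inner_on_self n)
  ultimately show ?thesis
    using on by (auto simp: orthonormal_on_def less_Suc_eq)
qed

text \<open>The residual after projection is orthogonal to the family; were it nonzero, normalizing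
  it would give an orthonormal family with more than \<open>card S\<close> members.\<close>

lemma orthonormal_basis_expansion:
  assumes on: "orthonormal_on S J u" and "finite S" "finite J" "card J = card S"
    and f: "f \<in> funs_on S" and u: "\<And>j. j \<in> J \<Longrightarrow> u j \<in> funs_on S"
  shows "f = (\<lambda>v. \<Sum>j\<in>J. inner_on S f (u j) * u j v)"
proof (rule ccontr)
  define g where "g v = f v - (\<Sum>j\<in>J. inner_on S f (u j) * u j v)" for v
  assume "\<not> ?thesis"
  then obtain v where v: "g v \<noteq> 0" by (auto simp: g_def fun_eq_iff)
  have g: "g \<in> funs_on S" using f u by (auto simp: funs_on_def g_def intro!: sum.neutral)
  have orth: "inner_on S g (u i) = 0" if "i \<in> J" for i
    unfolding g_def inner_on_diff_left using orthonormal_inner_sum[OF on assms(3) that] by simp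
  obtain h where h: "bij_betw h {..<card J} J"
    using ex_bij_betw_nat_finite[OF assms(3)] by (auto simp: atLeast0LessThan)
  have "orthonormal_on S {..<card J} (u \<circ> h)"
    using on h unfolding orthonormal_on_def bij_betw_def inj_on_def
    by (metis comp_apply image_eqI)
  from orthonormal_extend[OF this assms(2) g v]
  have "orthonormal_on S {..<Suc (card J)} ((u \<circ> h)(card J := \<lambda>v. complex_of_real (1 / sqrt (normsq S g)) * g v))"
    using orth h by (auto simp: bij_betw_def)
  from orthonormal_card_le[OF this assms(2)] show False using assms by simp
qed

lemma parseval_on:
  assumes "orthonormal_on S J u" "finite S" "finite J" "card J = card S"
    and "f \<in> funs_on S" "\<And>j. j \<in> J \<Longrightarrow> u j \<in> funs_on S"
  shows "normsq S f = (\<Sum>j\<in>J. (cmod (inner_on S f (u j)))\<^sup>2)"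
  using orthonormal_normsq_sum[OF assms(1,3), of "\<lambda>j. inner_on S f (u j)"]
    orthonormal_basis_expansion[OF assms] by simp

text \<open>A subspace of dimension \<open>k\<close> has, at some point of \<open>S\<close>, a unit vector of mass at least
  \<open>k / card S\<close>, since the diagonal of the projection onto it sums to \<open>k\<close>.\<close>

lemma orthonormal_concentrated_vector:
  assumes on: "orthonormal_on S {..<k::nat} w" and S: "finite S" and k: "k > 0"
  shows "\<exists>v\<in>S. \<exists>c. normsq S (\<lambda>x. \<Sum>j<k. c j * w j x) \<le> 1 \<and>
           real k / real (card S) \<le> cmod (\<Sum>j<k. c j * w j v)"
proof -
  have ne: "S \<noteq> {}" using orthonormal_card_le[OF on S] k by auto
  have "(\<Sum>v\<in>S. \<Sum>j<k. (cmod (w j v))\<^sup>2) = (\<Sum>j<k. normsq S (w j))"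
    unfolding normsq_def by (rule sum.swap)
  also have "\<dots> = real k"
    using orthonormal_normsq[OF on] by simp
  finally have tot: "(\<Sum>v\<in>S. \<Sum>j<k. (cmod (w j v))\<^sup>2) = real k" .
  obtain v where v: "v \<in> S" "real k / real (card S) \<le> (\<Sum>j<k. (cmod (w j v))\<^sup>2)"
  proof (rule ccontr)
    assume "\<not> thesis"
    with that have "\<And>v. v \<in> S \<Longrightarrow> (\<Sum>j<k. (cmod (w j v))\<^sup>2) < real k / real (card S)"
      by force
    then have "(\<Sum>v\<in>S. \<Sum>j<k. (cmod (w j v))\<^sup>2) < (\<Sum>v\<in>S. real k / real (card S))"
      using S ne by (intro sum_strict_mono) auto
    then show False using tot S ne by simp
  qed
  \<comment> \<open>The projection of the point mass at \<open>v\<close> onto the span. Its value at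
    \<open>v\<close> and its squared norm are the same diagonal entry \<open>t\<close>, so
    \<open>t\<^sup>2 \<le> t\<close> bounds the norm by 1.\<close>
  define f where "f = (\<lambda>x. \<Sum>j<k. cnj (w j v) * w j x)"
  define t where "t = (\<Sum>j<k. (cmod (w j v))\<^sup>2)"
  have ft: "f v = of_real t"
    unfolding f_def t_def of_real_sum complex_norm_square by (intro sum.cong) auto
  have nt: "normsq S f = t"
    unfolding f_def by (subst orthonormal_normsq_sum[OF on]) (auto simp: t_def)
  have "t\<^sup>2 \<le> t" using cmod_le_normsq[OF S v(1), of f] unfolding ft nt by simp
  then have "t \<le> 1" by (cases "t \<le> 0") (auto simp: power2_eq_square mult_le_cancel_right1)
  moreover have "t \<ge> 0" by (simp add: t_def sum_nonneg)
  ultimately have "normsq S f \<le> 1 \<and> real k / real (card S) \<le> cmod (f v)"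
    using v(2) nt by (simp add: ft flip: t_def)
  then show ?thesis
    using v(1) unfolding f_def by (intro bexI[of _ v] exI[of _ "\<lambda>j. cnj (w j v)"])
qed

section \<open>Operators with finitely supported Hermitian kernels\<close>

definition kernel_op :: "('v \<Rightarrow> 'v \<Rightarrow> complex) \<Rightarrow> ('v \<Rightarrow> complex) \<Rightarrow> 'v \<Rightarrow> complex" where
  "kernel_op a f v = (\<Sum>w | a v w \<noteq> 0. a v w * f w)"

text \<open>\<open>K\<close> bounds the absolute row sums; by symmetry it bounds the column sums
  too, which is the hypothesis of the Schur test. Entries vanish off \<open>V\<close>, so one type
  of kernel serves all vertex sets.\<close>

definition hermitian_kernel :: "'v set \<Rightarrow> real \<Rightarrow> ('v \<Rightarrow> 'v \<Rightarrow> complex) \<Rightarrow> bool" where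
  "hermitian_kernel V K a \<longleftrightarrow>
     (\<forall>v w. a v w \<noteq> 0 \<longrightarrow> v \<in> V \<and> w \<in> V) \<and>
     (\<forall>v. finite {w. a v w \<noteq> 0}) \<and>
     (\<forall>v w. a w v = cnj (a v w)) \<and>
     (\<forall>v. (\<Sum>w | a v w \<noteq> 0. cmod (a v w)) \<le> K)"

lemma hermitian_kernelD:
  assumes "hermitian_kernel V K a"
  shows "a v w \<noteq> 0 \<Longrightarrow> v \<in> V" "a v w \<noteq> 0 \<Longrightarrow> w \<in> V" "finite {w. a v w \<noteq> 0}"
    "a w v = cnj (a v w)" "(\<Sum>w | a v w \<noteq> 0. cmod (a v w)) \<le> K"
  using assms unfolding hermitian_kernel_def by blast+

lemma hermitian_kernel_nonneg: "hermitian_kernel V K a \<Longrightarrow> 0 \<le> K"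
  using hermitian_kernelD(5)[of V K a undefined] by (meson norm_ge_zero order_trans sum_nonneg)

lemma kernel_op_eq_sum:
  assumes "finite S" "{w. a v w \<noteq> 0 \<and> f w \<noteq> 0} \<subseteq> S" "finite {w. a v w \<noteq> 0}"
  shows "kernel_op a f v = (\<Sum>w\<in>S. a v w * f w)"
proof -
  have "kernel_op a f v = (\<Sum>w | a v w \<noteq> 0 \<and> f w \<noteq> 0. a v w * f w)"
    unfolding kernel_op_def using assms by (intro sum.mono_neutral_right) auto
  also have "\<dots> = (\<Sum>w\<in>S. a v w * f w)"
    using assms by (intro sum.mono_neutral_left) auto
  finally show ?thesis .
qed

lemma kernel_op_linear:
  "kernel_op a (\<lambda>v. f v + g v) = (\<lambda>v. kernel_op a f v + kernel_op a g v)"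
  "kernel_op a (\<lambda>v. f v - g v) = (\<lambda>v. kernel_op a f v - kernel_op a g v)"
  "kernel_op a (\<lambda>v. c * f v) = (\<lambda>v. c * kernel_op a f v)"
  by (auto simp: kernel_op_def algebra_simps sum.distrib sum_subtractf sum_distrib_left)

lemma kernel_op_sum:
  "kernel_op a (\<lambda>v. \<Sum>j\<in>J. c j * u j v) = (\<lambda>v. \<Sum>j\<in>J. c j * kernel_op a (u j) v)"
proof
  fix v
  have "kernel_op a (\<lambda>v. \<Sum>j\<in>J. c j * u j v) v
      = (\<Sum>w | a v w \<noteq> 0. \<Sum>j\<in>J. c j * (a v w * u j w))"
    by (simp add: kernel_op_def sum_distrib_left mult.left_commute)
  also have "\<dots> = (\<Sum>j\<in>J. c j * kernel_op a (u j) v)"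
    by (subst sum.swap) (simp add: kernel_op_def sum_distrib_left)
  finally show "kernel_op a (\<lambda>v. \<Sum>j\<in>J. c j * u j v) v = (\<Sum>j\<in>J. c j * kernel_op a (u j) v)" .
qed

lemma kernel_op_finite:
  assumes "hermitian_kernel V K a" "finite V"
  shows "kernel_op a f v = (\<Sum>w\<in>V. a v w * f w)"
  using hermitian_kernelD(2,3)[OF assms(1)] assms(2) by (intro kernel_op_eq_sum) auto

lemma kernel_op_in_funs_on: "hermitian_kernel V K a \<Longrightarrow> kernel_op a f \<in> funs_on V"
  by (auto simp: funs_on_def kernel_op_def intro!: sum.neutral dest: hermitian_kernelD(1))

text \<open>Hermitian symmetry turns the finiteness of rows into finiteness of columns, and the
  image of \<open>f\<close> is supported in the union of the columns indexed by
  \<open>S\<close>.\<close>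

lemma kernel_op_finite_support:
  assumes "hermitian_kernel V K a" "finite S" "f \<in> funs_on S"
  shows "finite {v. kernel_op a f v \<noteq> 0}"
proof -
  have "a v w \<noteq> 0 \<longleftrightarrow> a w v \<noteq> 0" for v w
    using hermitian_kernelD(4)[OF assms(1), of v w] by (metis complex_cnj_zero_iff)
  moreover have "\<exists>w\<in>S. a v w \<noteq> 0" if nz: "kernel_op a f v \<noteq> 0" for v
  proof -
    obtain w where "a v w \<noteq> 0" "f w \<noteq> 0"
      using nz unfolding kernel_op_def by (elim sum.not_neutral_contains_not_neutral) auto
    then show ?thesis using assms(3) by (auto simp: funs_on_def)
  qed
  ultimately have "{v. kernel_op a f v \<noteq> 0} \<subseteq> (\<Union>w\<in>S. {v. a w v \<noteq> 0})"
    by blast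
  then show ?thesis
    using assms(2) hermitian_kernelD(3)[OF assms(1)] by (auto intro: finite_subset)
qed

text \<open>\<open>S\<close> need not be invariant: the parts of the images lying outside
  \<open>S\<close> would be paired with zero, so only the finite block of the kernel over
  \<open>S\<close> matters.\<close>

lemma kernel_op_self_adjoint:
  assumes "hermitian_kernel V K a" "finite S" "f \<in> funs_on S" "g \<in> funs_on S"
  shows "inner_on S (kernel_op a f) g = inner_on S f (kernel_op a g)"
proof -
  have e: "kernel_op a h v = (\<Sum>w\<in>S. a v w * h w)" if "h \<in> funs_on S" for h v
    using assms(2) hermitian_kernelD(3)[OF assms(1)] that
    by (intro kernel_op_eq_sum) (auto simp: funs_on_def)
  have c: "cnj (a v w) = a w v" for v w using hermitian_kernelD(4)[OF assms(1), of v w] by simp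
  have "inner_on S (kernel_op a f) g = (\<Sum>v\<in>S. \<Sum>w\<in>S. a v w * f w * cnj (g v))"
    by (simp add: inner_on_def e[OF assms(3)] sum_distrib_right)
  also have "\<dots> = (\<Sum>w\<in>S. \<Sum>v\<in>S. a v w * f w * cnj (g v))" by (rule sum.swap)
  also have "\<dots> = inner_on S f (kernel_op a g)"
    by (simp add: inner_on_def e[OF assms(4)] c sum_distrib_left mult_ac)
  finally show ?thesis .
qed

text \<open>Schur test: Cauchy--Schwarz with the weights \<open>cmod (a v w)\<close>.\<close>

lemma normsq_kernel_op_le:
  assumes a: "hermitian_kernel V K a" and T: "finite T" and S: "finite S" and f: "f \<in> funs_on S"
  shows "normsq T (kernel_op a f) \<le> K\<^sup>2 * normsq S f"
proof -
  have fin: "finite {w. a v w \<noteq> 0}" and K: "(\<Sum>w | a v w \<noteq> 0. cmod (a v w)) \<le> K"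
    and sym: "cmod (a v w) = cmod (a w v)" for v w
    using hermitian_kernelD(3,5)[OF a] hermitian_kernelD(4)[OF a, of v w] by auto
  note K0 = hermitian_kernel_nonneg[OF a]
  have row: "(\<Sum>w\<in>U. cmod (a v w)) \<le> K" if "finite U" for U v
  proof -
    have "(\<Sum>w\<in>U. cmod (a v w)) = (\<Sum>w | w \<in> U \<and> a v w \<noteq> 0. cmod (a v w))"
      using that by (intro sum.mono_neutral_right) auto
    also have "\<dots> \<le> (\<Sum>w | a v w \<noteq> 0. cmod (a v w))"
      using fin by (intro sum_mono2) auto
    finally show ?thesis using K[of v] by simp
  qed
  have pt: "(cmod (kernel_op a f v))\<^sup>2 \<le> K * (\<Sum>w\<in>S. cmod (a v w) * (cmod (f w))\<^sup>2)" for v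
  proof -
    have "kernel_op a f v = (\<Sum>w\<in>S. a v w * f w)"
      using f S fin by (intro kernel_op_eq_sum) (auto simp: funs_on_def)
    then have "cmod (kernel_op a f v) \<le> (\<Sum>w\<in>S. cmod (a v w) * cmod (f w))"
      by (metis (no_types, lifting) norm_mult sum_norm_le order_refl)
    then have "(cmod (kernel_op a f v))\<^sup>2 \<le> (\<Sum>w\<in>S. cmod (a v w) * cmod (f w))\<^sup>2"
      by (simp add: power_mono)
    also have "(\<Sum>w\<in>S. cmod (a v w) * cmod (f w))
        = (\<Sum>w\<in>S. sqrt (cmod (a v w)) * (sqrt (cmod (a v w)) * cmod (f w)))"
      by (intro sum.cong) (auto simp: mult.assoc[symmetric])
    also have "\<dots>\<^sup>2 \<le> (\<Sum>w\<in>S. (sqrt (cmod (a v w)))\<^sup>2) * (\<Sum>w\<in>S. (sqrt (cmod (a v w)) * cmod (f w))\<^sup>2)"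
      by (rule Cauchy_Schwarz_ineq_sum)
    also have "\<dots> = (\<Sum>w\<in>S. cmod (a v w)) * (\<Sum>w\<in>S. cmod (a v w) * (cmod (f w))\<^sup>2)"
      by (simp add: power_mult_distrib)
    also have "\<dots> \<le> K * (\<Sum>w\<in>S. cmod (a v w) * (cmod (f w))\<^sup>2)"
      using row[OF S] by (intro mult_right_mono) (auto intro: sum_nonneg)
    finally show ?thesis .
  qed
  have "normsq T (kernel_op a f) \<le> (\<Sum>v\<in>T. K * (\<Sum>w\<in>S. cmod (a v w) * (cmod (f w))\<^sup>2))"
    unfolding normsq_def by (intro sum_mono pt)
  also have "\<dots> = K * (\<Sum>w\<in>S. (\<Sum>v\<in>T. cmod (a w v)) * (cmod (f w))\<^sup>2)"
    unfolding sum_distrib_left[symmetric] sum_distrib_right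
    by (subst sum.swap) (simp add: sym)
  also have "\<dots> \<le> K * (\<Sum>w\<in>S. K * (cmod (f w))\<^sup>2)"
    using row[OF T] K0 by (intro mult_left_mono sum_mono mult_right_mono) auto
  also have "\<dots> = K\<^sup>2 * normsq S f"
    by (simp add: normsq_def sum_distrib_left power2_eq_square mult.assoc)
  finally show ?thesis .
qed

text \<open>Tychonoff's theorem for the topology of pointwise convergence. It supplies minimizers
  for the finite-dimensional spectral theorem and limits of almost eigenfunctions on the infinite
  graph.\<close>

lemma compact_unit_functions: "compact {f :: 'v \<Rightarrow> complex. \<forall>v. cmod (f v) \<le> 1}"
proof -
  have "compactin (product_topology (\<lambda>_. euclidean) UNIV) (PiE (UNIV :: 'v set) (\<lambda>_. cball (0::complex) 1))"
    unfolding compactin_PiE by simp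
  moreover have "PiE (UNIV :: 'v set) (\<lambda>_. cball (0::complex) 1) = {f. \<forall>v. cmod (f v) \<le> 1}"
    by (auto simp: PiE_def Pi_def)
  ultimately have "compactin (product_topology (\<lambda>_. euclidean) UNIV) {f :: 'v \<Rightarrow> complex. \<forall>v. cmod (f v) \<le> 1}"
    by (simp only:)
  then show ?thesis
    by (simp only: euclidean_product_topology compactin_euclidean_iff)
qed

lemma continuous_on_eval [continuous_intros]:
  "continuous_on A (\<lambda>f :: 'v \<Rightarrow> 'b :: topological_space. f v)"
  by (rule continuous_on_subset[OF continuous_on_product_coordinates]) simp

lemma kernel_op_continuous [continuous_intros]: "continuous_on A (\<lambda>f. kernel_op a f v)"
  unfolding kernel_op_def by (intro continuous_intros)

lemma closed_Collect_eq_const: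
  "continuous_on UNIV f \<Longrightarrow> closed {x. f x = (c :: 'b :: t1_space)}"
  using continuous_closed_preimage[of UNIV f "{c}"] by (auto simp: vimage_def)

lemma hermitian_kernel_mono: "hermitian_kernel V K a \<Longrightarrow> K \<le> K' \<Longrightarrow> hermitian_kernel V K' a"
  unfolding hermitian_kernel_def by (meson order_trans)

text \<open>The diagonal is changed only on \<open>V\<close>, so the result is again a kernel
  supported on \<open>V\<close>.\<close>

definition shift_kernel :: "'v set \<Rightarrow> ('v \<Rightarrow> 'v \<Rightarrow> complex) \<Rightarrow> real \<Rightarrow> 'v \<Rightarrow> 'v \<Rightarrow> complex" where
  "shift_kernel V a m v w = a v w - (if v = w \<and> v \<in> V then of_real m else 0)"

lemma shift_kernel_support:
  "{w. shift_kernel V a m v w \<noteq> 0} \<subseteq> insert v {w. a v w \<noteq> 0}"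
  by (auto simp: shift_kernel_def split: if_splits)

lemma hermitian_kernel_shift:
  assumes "hermitian_kernel V K a"
  shows "hermitian_kernel V (K + \<bar>m\<bar>) (shift_kernel V a m)"
  unfolding hermitian_kernel_def
proof (intro conjI allI impI)
  note D = hermitian_kernelD[OF assms]
  fix v w
  show "finite {w. shift_kernel V a m v w \<noteq> 0}"
    by (rule finite_subset[OF shift_kernel_support]) (simp add: D(3))
  show "v \<in> V" "w \<in> V" if "shift_kernel V a m v w \<noteq> 0"
    using that D(1,2)[of v w] by (auto simp: shift_kernel_def split: if_splits)
  show "shift_kernel V a m w v = cnj (shift_kernel V a m v w)"
    using D(4)[of w v] by (auto simp: shift_kernel_def)
  have "(\<Sum>w | shift_kernel V a m v w \<noteq> 0. cmod (shift_kernel V a m v w))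
      \<le> (\<Sum>w\<in>insert v {w. a v w \<noteq> 0}. cmod (shift_kernel V a m v w))"
    using D(3) shift_kernel_support[of V a m v] by (intro sum_mono2) auto
  also have "\<dots> \<le> (\<Sum>w\<in>insert v {w. a v w \<noteq> 0}. cmod (a v w) + (if w = v then \<bar>m\<bar> else 0))"
    by (intro sum_mono) (auto simp: shift_kernel_def intro: norm_triangle_ineq4[THEN order_trans])
  also have "\<dots> = (\<Sum>w\<in>insert v {w. a v w \<noteq> 0}. cmod (a v w)) + \<bar>m\<bar>"
    using D(3) by (simp add: sum.distrib)
  also have "(\<Sum>w\<in>insert v {w. a v w \<noteq> 0}. cmod (a v w)) = (\<Sum>w | a v w \<noteq> 0. cmod (a v w))"
    using D(3) by (intro sum.mono_neutral_right) auto
  also have "\<dots> \<le> K" by (rule D(5))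
  finally show "(\<Sum>w | shift_kernel V a m v w \<noteq> 0. cmod (shift_kernel V a m v w)) \<le> K + \<bar>m\<bar>"
    by simp
qed

lemma kernel_op_shift:
  assumes "hermitian_kernel V K a" "f \<in> funs_on V"
  shows "kernel_op (shift_kernel V a m) f = (\<lambda>v. kernel_op a f v - of_real m * f v)"
proof
  fix v
  let ?S = "insert v {w. a v w \<noteq> 0}"
  have S: "finite ?S" using hermitian_kernelD(3)[OF assms(1)] by simp
  have "kernel_op (shift_kernel V a m) f v = (\<Sum>w\<in>?S. shift_kernel V a m v w * f w)"
    using shift_kernel_support[of V a m v] S
    by (intro kernel_op_eq_sum) (auto intro: finite_subset)
  also have "\<dots> = (\<Sum>w\<in>?S. a v w * f w - (if w = v then of_real m * f v else 0))"
    using assms(2) by (intro sum.cong) (auto simp: shift_kernel_def funs_on_def algebra_simps)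
  also have "\<dots> = (\<Sum>w\<in>?S. a v w * f w) - of_real m * f v"
    using S by (simp add: sum_subtractf)
  also have "(\<Sum>w\<in>?S. a v w * f w) = kernel_op a f v"
    using S by (intro kernel_op_eq_sum[symmetric]) auto
  finally show "kernel_op (shift_kernel V a m) f v = kernel_op a f v - of_real m * f v" .
qed

text \<open>Weighted arithmetic-geometric mean, with weights chosen so that after the Schur bound
  each of the two terms contributes the factor \<open>K / 2\<close>.\<close>

lemma Re_inner_kernel_op_le:
  assumes "hermitian_kernel V K a" "0 < K" "finite S" "g \<in> funs_on S"
  shows "Re (inner_on S (kernel_op a g) g) \<le> K * normsq S g"
proof -
  have "Re (inner_on S (kernel_op a g) g)
      \<le> (\<Sum>v\<in>S. (cmod (kernel_op a g v))\<^sup>2 / (2 * K) + K / 2 * (cmod (g v))\<^sup>2)"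
    unfolding inner_on_def Re_sum
  proof (intro sum_mono)
    fix v
    let ?x = "cmod (kernel_op a g v)" and ?y = "cmod (g v)"
    have "Re (kernel_op a g v * cnj (g v)) \<le> ?x * ?y"
      using complex_Re_le_cmod[of "kernel_op a g v * cnj (g v)"] by (simp add: norm_mult)
    also have "\<dots> \<le> ?x\<^sup>2 / (2 * K) + K / 2 * ?y\<^sup>2"
    proof -
      have "0 \<le> (?x - K * ?y)\<^sup>2 / (2 * K)" using assms(2) by simp
      also have "\<dots> = ?x\<^sup>2 / (2 * K) + K / 2 * ?y\<^sup>2 - ?x * ?y"
        using assms(2) by (simp add: power2_eq_square field_simps)
      finally show ?thesis by simp
    qed
    finally show "Re (kernel_op a g v * cnj (g v)) \<le> ?x\<^sup>2 / (2 * K) + K / 2 * ?y\<^sup>2" .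
  qed
  also have "\<dots> = normsq S (kernel_op a g) / (2 * K) + K / 2 * normsq S g"
    by (simp add: normsq_def sum.distrib sum_divide_distrib sum_distrib_left)
  also have "\<dots> \<le> K\<^sup>2 * normsq S g / (2 * K) + K / 2 * normsq S g"
    using normsq_kernel_op_le[OF assms(1,3,3,4)] assms(2) by (intro add_right_mono divide_right_mono) auto
  also have "\<dots> = K * normsq S g"
    using assms(2) by (simp add: power2_eq_square field_simps)
  finally show ?thesis .
qed

text \<open>Cauchy--Schwarz for the form of \<open>P\<close>, obtained from the single test vector
  \<open>f - t P f\<close> with \<open>t = 1 / M\<close>.\<close>

lemma semidefinite_normsq_le:
  assumes lin: "\<And>t. P (\<lambda>v. f v - of_real t * P f v) = (\<lambda>v. P f v - of_real t * P (P f) v)"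
    and sa: "inner_on S (P (P f)) f = inner_on S (P f) (P f)"
    and pos: "\<And>t. 0 \<le> Re (inner_on S (P (\<lambda>v. f v - of_real t * P f v)) (\<lambda>v. f v - of_real t * P f v))"
    and M: "Re (inner_on S (P (P f)) (P f)) \<le> M * normsq S (P f)" "M > 0"
  shows "normsq S (P f) \<le> M * Re (inner_on S (P f) f)"
proof -
  define t where "t = 1 / M"
  let ?q = "Re (inner_on S (P f) f)" and ?n = "normsq S (P f)"
  have "0 \<le> Re (inner_on S (\<lambda>v. P f v - of_real t * P (P f) v) (\<lambda>v. f v - of_real t * P f v))"
    using pos[of t] by (simp add: lin)
  also have "\<dots> = ?q - 2 * t * ?n + t\<^sup>2 * Re (inner_on S (P (P f)) (P f))"
    by (simp add: inner_on_diff_left inner_on_diff_right inner_on_scale_left inner_on_scale_right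
        sa inner_on_self power2_eq_square algebra_simps)
  also have "\<dots> \<le> ?q - 2 * t * ?n + t\<^sup>2 * (M * ?n)"
    using M by (intro add_left_mono mult_left_mono) auto
  also have "\<dots> = ?q - ?n / M"
    using M by (simp add: t_def power2_eq_square field_simps)
  finally show ?thesis using M by (simp add: field_simps)
qed

text \<open>The complement \<open>U\<close> of the given eigenvectors is invariant, and the
  quadratic form attains its minimum \<open>m\<close> on the unit sphere of \<open>U\<close>.
  Subtracting \<open>m\<close> leaves a nonnegative form that vanishes at the minimizer, and
  Cauchy-Schwarz for this form shows that the shifted operator kills it.\<close>

lemma hermitian_eigenvector_in_complement:
  assumes a: "hermitian_kernel V K a" and V: "finite V"
    and u: "\<And>i. i < k \<Longrightarrow> u i \<in> funs_on V"
      "\<And>i. i < k \<Longrightarrow> kernel_op a (u i) = (\<lambda>v. of_real (d i) * u i v)"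
    and g: "g \<in> funs_on V" "g x \<noteq> 0" "\<And>i. i < k \<Longrightarrow> inner_on V g (u i) = 0"
  shows "\<exists>f m. f \<in> funs_on V \<and> (\<exists>v. f v \<noteq> 0) \<and> (\<forall>i<k. inner_on V f (u i) = 0) \<and>
           kernel_op a f = (\<lambda>v. of_real (m::real) * f v)"
proof -
  define U where "U = {f \<in> funs_on V. \<forall>i<k. inner_on V f (u i) = 0}"
  define C where "C = U \<inter> {f. normsq V f = 1}"
  note K0 = hermitian_kernel_nonneg[OF a]
  have UI: "kernel_op a f \<in> U" if "f \<in> U" for f
  proof -
    have "inner_on V (kernel_op a f) (u i) = 0" if "i < k" for i
      using kernel_op_self_adjoint[OF a V, of f "u i"] u[OF that] \<open>f \<in> U\<close> that
      by (simp add: U_def inner_on_scale_right)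
    then show ?thesis using kernel_op_in_funs_on[OF a] by (simp add: U_def)
  qed
  have Ulin: "(\<lambda>v. f v - c * h v) \<in> U" "(\<lambda>v. c * f v) \<in> U" if "f \<in> U" "h \<in> U" for f h c
    using that by (auto simp: U_def funs_on_def inner_on_diff_left inner_on_scale_left)
  have clU: "closed U"
  proof -
    have "U = (\<Inter>v\<in>-V. {f. f v = 0}) \<inter> (\<Inter>i\<in>{..<k}. {f. inner_on V f (u i) = 0})"
      by (auto simp: U_def funs_on_def)
    moreover have "closed {f :: 'a \<Rightarrow> complex. f v = 0}" for v
      by (intro closed_Collect_eq_const continuous_intros)
    moreover have "closed {f. inner_on V f (u i) = 0}" for i
      unfolding inner_on_def by (intro closed_Collect_eq_const continuous_intros)
    ultimately show ?thesis by auto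
  qed
  have clN: "closed {f. normsq V f = 1}"
    unfolding normsq_def by (intro closed_Collect_eq_const continuous_intros)
  have "C \<subseteq> {f. \<forall>v. cmod (f v) \<le> 1}"
  proof safe
    fix f v assume f: "f \<in> C"
    show "cmod (f v) \<le> 1"
    proof (cases "v \<in> V")
      case True
      then show ?thesis
        using cmod_le_normsq[OF V True, of f] f by (simp add: C_def abs_square_le_1)
    next
      case False
      then show ?thesis using f by (auto simp: C_def U_def funs_on_def)
    qed
  qed
  moreover have "C = {f. \<forall>v. cmod (f v) \<le> 1} \<inter> C" using calculation by blast
  ultimately have cC: "compact C"
    using compact_Int_closed[OF compact_unit_functions, of C] clU clN
    by (simp add: C_def closed_Int)
  have gU: "g \<in> U" using g by (simp add: U_def)
  have npos: "normsq V g > 0" by (rule normsq_pos[OF V g(1,2)])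
  have "(\<lambda>v. of_real (1 / sqrt (normsq V g)) * g v) \<in> C"
    unfolding C_def Int_iff mem_Collect_eq normsq_scale
    using npos by (intro conjI Ulin(2)[OF gU gU]) (simp add: norm_divide power_divide)
  then have "C \<noteq> {}" by blast
  moreover have "continuous_on C (\<lambda>f. Re (inner_on V (kernel_op a f) f))"
    unfolding inner_on_def by (intro continuous_intros)
  ultimately obtain f where f: "f \<in> C"
    and fmin: "\<And>h. h \<in> C \<Longrightarrow> Re (inner_on V (kernel_op a f) f) \<le> Re (inner_on V (kernel_op a h) h)"
    using continuous_attains_inf[OF cC] by blast
  define m where "m = Re (inner_on V (kernel_op a f) f)"
  define b where "b = shift_kernel V a m"
  have b: "hermitian_kernel V (K + \<bar>m\<bar>) b" unfolding b_def by (rule hermitian_kernel_shift[OF a])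
  \<comment> \<open>The additional 1 makes the bound strictly positive even for \<open>K = 0\<close>
    and \<open>m = 0\<close>.\<close>
  then have b1: "hermitian_kernel V (K + \<bar>m\<bar> + 1) b" by (rule hermitian_kernel_mono) simp
  have UV: "h \<in> funs_on V" if "h \<in> U" for h using that by (simp add: U_def)
  have bop: "kernel_op b h = (\<lambda>v. kernel_op a h v - of_real m * h v)" if "h \<in> U" for h
    unfolding b_def by (rule kernel_op_shift[OF a UV[OF that]])
  have bU: "kernel_op b h \<in> U" if "h \<in> U" for h
    using Ulin(1)[OF UI[OF that] that] bop[OF that] by simp
  have bpos: "0 \<le> Re (inner_on V (kernel_op b h) h)" if h: "h \<in> U" for h
  proof (cases "normsq V h = 0")
    case True
    then have "h v = 0" if "v \<in> V" for v using that V by (simp add: normsq_eq_0_iff)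
    then show ?thesis by (simp add: inner_on_def)
  next
    case False
    define s where "s = 1 / sqrt (normsq V h)"
    have np: "normsq V h > 0" using False normsq_nonneg[of V h] by linarith
    then have s: "s\<^sup>2 = 1 / normsq V h" by (simp add: s_def power_divide)
    have "(\<lambda>v. of_real s * h v) \<in> C"
      using Ulin(2)[OF h h] np s by (simp add: C_def normsq_scale)
    from fmin[OF this] have "m \<le> s\<^sup>2 * Re (inner_on V (kernel_op a h) h)"
      by (simp add: m_def kernel_op_linear inner_on_scale_left inner_on_scale_right
          power2_eq_square mult.assoc)
    then have "m * normsq V h \<le> Re (inner_on V (kernel_op a h) h)"
      using np by (simp add: s field_simps)
    then show ?thesis
      unfolding bop[OF h] by (simp add: inner_on_diff_left inner_on_scale_left inner_on_self)
  qed
  have fU: "f \<in> U" and fn: "normsq V f = 1" using f by (auto simp: C_def)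
  have "normsq V (kernel_op b f) \<le> (K + \<bar>m\<bar> + 1) * Re (inner_on V (kernel_op b f) f)"
  proof (rule semidefinite_normsq_le)
    show "inner_on V (kernel_op b (kernel_op b f)) f = inner_on V (kernel_op b f) (kernel_op b f)"
      using kernel_op_self_adjoint[OF b V] fU bU UV by blast
    show "Re (inner_on V (kernel_op b (kernel_op b f)) (kernel_op b f))
        \<le> (K + \<bar>m\<bar> + 1) * normsq V (kernel_op b f)"
      using Re_inner_kernel_op_le[OF b1 _ V] K0 fU bU UV by fastforce
    show "0 \<le> Re (inner_on V (kernel_op b (\<lambda>v. f v - of_real t * kernel_op b f v))
        (\<lambda>v. f v - of_real t * kernel_op b f v))" for t
      by (intro bpos Ulin(1) fU bU)
  qed (use K0 in \<open>auto simp: kernel_op_linear\<close>)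
  also have "Re (inner_on V (kernel_op b f) f) = 0"
    unfolding bop[OF fU] using fn
    by (simp add: inner_on_diff_left inner_on_scale_left inner_on_self m_def)
  finally have "normsq V (kernel_op b f) = 0" using normsq_nonneg[of V "kernel_op b f"] by linarith
  then have "kernel_op b f v = 0" for v
    using V UV[OF bU[OF fU]] by (cases "v \<in> V") (auto simp: normsq_eq_0_iff funs_on_def)
  then have "kernel_op a f = (\<lambda>v. of_real m * f v)" using bop[OF fU] by (simp add: fun_eq_iff)
  moreover have "\<exists>v. f v \<noteq> 0"
    using fn by (metis V normsq_eq_0_iff zero_neq_one)
  ultimately show ?thesis using fU by (auto simp: U_def)
qed

section \<open>Spectral theorem and multiplicities\<close>

definition spectral_basis ::
  "'v set \<Rightarrow> ('v \<Rightarrow> 'v \<Rightarrow> complex) \<Rightarrow> (nat \<Rightarrow> 'v \<Rightarrow> complex) \<Rightarrow> (nat \<Rightarrow> real) \<Rightarrow> bool" where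
  "spectral_basis V a u d \<longleftrightarrow> orthonormal_on V {..<card V} u \<and>
     (\<forall>i<card V. u i \<in> funs_on V \<and> kernel_op a (u i) = (\<lambda>v. of_real (d i) * u i v))"

lemma spectral_basisD:
  assumes "spectral_basis V a u d"
  shows "orthonormal_on V {..<card V} u" "i < card V \<Longrightarrow> u i \<in> funs_on V"
    "i < card V \<Longrightarrow> kernel_op a (u i) = (\<lambda>v. of_real (d i) * u i v)"
  using assms by (auto simp: spectral_basis_def)

text \<open>Induction on the number of eigenvectors: below \<open>card V\<close> there are fewer
  orthogonality equations than unknowns, which leaves a nonzero vector in the complement and hence a
  further eigenvector there.\<close>

theorem hermitian_spectral_theorem:
  assumes a: "hermitian_kernel V K a" and V: "finite V"
  obtains u d where "spectral_basis V a u d"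
proof -
  have "\<exists>u d. orthonormal_on V {..<k} u \<and>
     (\<forall>i<k. u i \<in> funs_on V \<and> kernel_op a (u i) = (\<lambda>v. of_real (d i :: real) * u i v))"
    if "k \<le> card V" for k
    using that
  proof (induction k)
    case 0
    then show ?case by (simp add: orthonormal_on_def)
  next
    case (Suc k)
    then obtain u and d :: "nat \<Rightarrow> real" where u: "orthonormal_on V {..<k} u"
      "\<And>i. i < k \<Longrightarrow> u i \<in> funs_on V"
      "\<And>i. i < k \<Longrightarrow> kernel_op a (u i) = (\<lambda>v. of_real (d i) * u i v)"
      by auto
    obtain c where c: "\<exists>v\<in>V. c v \<noteq> 0" "\<And>i. i < k \<Longrightarrow> (\<Sum>v\<in>V. cnj (u i v) * c v) = 0"
      using homogeneous_system_nontrivial[of "{..<k}" V "\<lambda>i v. cnj (u i v)"] V Suc.prems by auto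
    define g where "g v = (if v \<in> V then c v else 0)" for v
    have g: "g \<in> funs_on V" "\<exists>v. g v \<noteq> 0" using c(1) by (auto simp: funs_on_def g_def)
    have go: "inner_on V g (u i) = 0" if "i < k" for i
      using c(2)[OF that] by (simp add: inner_on_def g_def mult.commute)
    from g(2) obtain x where gx: "g x \<noteq> 0" by blast
    have "\<exists>f m. f \<in> funs_on V \<and> (\<exists>v. f v \<noteq> 0) \<and> (\<forall>i<k. inner_on V f (u i) = 0) \<and>
           kernel_op a f = (\<lambda>v. of_real (m::real) * f v)"
      by (rule hermitian_eigenvector_in_complement[where d = d, OF a V u(2,3) g(1) gx go])
    then obtain f and m :: real where f: "f \<in> funs_on V" "\<exists>v. f v \<noteq> 0"
      "\<forall>i<k. inner_on V f (u i) = 0" "kernel_op a f = (\<lambda>v. of_real m * f v)"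
      by (elim exE conjE) (rule that, auto)
    obtain y where y: "f y \<noteq> 0" using f(2) by blast
    define w where "w = (\<lambda>v. of_real (1 / sqrt (normsq V f)) * f v)"
    have "orthonormal_on V {..<Suc k} (u(k := w))"
      unfolding w_def by (rule orthonormal_extend[OF u(1) V f(1) y]) (use f(3) in simp)
    moreover have "w \<in> funs_on V" using f(1) by (simp add: w_def funs_on_def)
    moreover have "kernel_op a w = (\<lambda>v. of_real m * w v)"
      unfolding w_def kernel_op_linear f(4) by (simp add: mult_ac)
    ultimately show ?case
      using u by (intro exI[of _ "u(k := w)"] exI[of _ "d(k := m)"]) (simp add: less_Suc_eq del: fun_upd_apply, simp)
  qed
  from this[of "card V"] show ?thesis using that unfolding spectral_basis_def by blast
qed

lemma ell2_finite: "finite V \<Longrightarrow> ell2 V = funs_on V"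
  by (auto simp: ell2_def funs_on_def)

lemma sum_fun_eq: "(\<Sum>i\<in>I. g i) = (\<lambda>v. \<Sum>i\<in>I. (g i v :: complex))"
  by (induction I rule: infinite_finite_induct) (auto simp: fun_eq_iff)

lemma spectral_basis_eigen_coeff:
  assumes a: "hermitian_kernel V K a" and V: "finite V" and sb: "spectral_basis V a u d"
    and i: "i < card V" and f: "f \<in> funs_on V"
  shows "inner_on V (kernel_op a f) (u i) = of_real (d i) * inner_on V f (u i)"
  using kernel_op_self_adjoint[OF a V f spectral_basisD(2)[OF sb i]] spectral_basisD(3)[OF sb i]
  by (simp add: inner_on_scale_right)

text \<open>An eigenfunction has zero coefficient along every basis vector with a different
  eigenvalue, so the basis vectors with eigenvalue \<mu> already span. \<open>A\<close> has to agree
  with the kernel only on functions supported in \<open>V\<close>.\<close>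

lemma dim_eigenspace:
  assumes a: "hermitian_kernel V K a" and V: "finite V" and sb: "spectral_basis V a u d"
    and A: "\<And>f. f \<in> funs_on V \<Longrightarrow> A f = kernel_op a f"
  shows "cfun.dim (eigenspace V A (of_real \<mu>)) = card {i. i < card V \<and> d i = \<mu>}"
proof -
  define I where "I = {i. i < card V \<and> d i = \<mu>}"
  note on = spectral_basisD(1)[OF sb]
  have E: "eigenspace V A (of_real \<mu>) = {f \<in> funs_on V. kernel_op a f = (\<lambda>v. of_real \<mu> * f v)}"
    using A by (auto simp: eigenspace_def ell2_finite[OF V])
  have I: "finite I" "I \<subseteq> {..<card V}" by (auto simp: I_def)
  have onI: "orthonormal_on V I u" by (rule orthonormal_on_subset[OF on I(2)])
  have inj: "inj_on u I"
    using onI unfolding orthonormal_on_def by (intro inj_onI) (metis zero_neq_one)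
  have "cfun.dim (eigenspace V A (of_real \<mu>)) = card (u ` I)"
  proof (rule cfun.dim_unique[OF _ _ _ refl])
    show "u ` I \<subseteq> eigenspace V A (of_real \<mu>)"
      unfolding E using spectral_basisD[OF sb] by (auto simp: I_def)
    show "eigenspace V A (of_real \<mu>) \<subseteq> cfun.span (u ` I)"
    proof
      fix f assume "f \<in> eigenspace V A (of_real \<mu>)"
      then have f: "f \<in> funs_on V" "kernel_op a f = (\<lambda>v. of_real \<mu> * f v)" by (auto simp: E)
      have z: "inner_on V f (u j) = 0" if "j < card V" "j \<notin> I" for j
      proof -
        have "of_real \<mu> * inner_on V f (u j) = of_real (d j) * inner_on V f (u j)"
          using spectral_basis_eigen_coeff[OF a V sb that(1) f(1)] f(2) by (simp add: inner_on_scale_left)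
        then show ?thesis using that by (auto simp: I_def)
      qed
      have "f = (\<lambda>v. \<Sum>j<card V. inner_on V f (u j) * u j v)"
        using spectral_basisD[OF sb] V f(1) by (intro orthonormal_basis_expansion) auto
      also have "\<dots> = (\<Sum>j\<in>I. (\<lambda>v. inner_on V f (u j) * u j v))"
        unfolding sum_fun_eq
        by (intro ext sum.mono_neutral_right) (use z I in auto)
      also have "\<dots> \<in> cfun.span (u ` I)"
        by (intro cfun.span_sum cfun.span_scale[of _ _ "inner_on V f (u _)", simplified] cfun.span_base) auto
      finally show "f \<in> cfun.span (u ` I)" .
    qed
    show "\<not> cfun.dependent (u ` I)"
    proof
      assume "cfun.dependent (u ` I)"
      then obtain c where c: "\<exists>x\<in>u ` I. c x \<noteq> 0" "(\<Sum>x\<in>u ` I. (\<lambda>v. c x * x v)) = 0"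
        using cfun.dependent_finite[of "u ` I"] I by auto
      have "(\<lambda>v. \<Sum>i\<in>I. c (u i) * u i v) = (\<lambda>_. 0)"
        using c(2) by (simp add: sum.reindex[OF inj] sum_fun_eq zero_fun_def)
      then have "c (u i) = 0" if "i \<in> I" for i
        using orthonormal_inner_sum[OF onI I(1) that, of "\<lambda>i. c (u i)"] by (simp add: inner_on_def)
      then show False using c(1) by auto
    qed
  qed
  then show ?thesis unfolding card_image[OF inj] by (simp add: I_def)
qed

text \<open>Replaces the sum of dimensions over distinct eigenvalues by counting indices of one
  eigenbasis, the form in which all later estimates are made.\<close>

lemma eigenvalue_count_eq_card:
  assumes a: "hermitian_kernel V K a" and V: "finite V" and sb: "spectral_basis V a u d"
    and A: "\<And>f. f \<in> funs_on V \<Longrightarrow> A f = kernel_op a f"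
  shows "eigenvalue_count V A r = card {i. i < card V \<and> d i \<le> r}"
proof -
  let ?I = "\<lambda>\<mu>. {i. i < card V \<and> d i = \<mu>}"
  have ev: "is_eigenvalue V A (of_real \<mu>) \<longleftrightarrow> ?I \<mu> \<noteq> {}" for \<mu>
  proof
    assume "is_eigenvalue V A (of_real \<mu>)"
    then obtain f where f: "f \<in> eigenspace V A (of_real \<mu>)" "f \<noteq> (\<lambda>_. 0)"
      by (auto simp: is_eigenvalue_def)
    show "?I \<mu> \<noteq> {}"
    proof
      assume e: "?I \<mu> = {}"
      have fV: "f \<in> funs_on V" "kernel_op a f = (\<lambda>v. of_real \<mu> * f v)"
        using f A by (auto simp: eigenspace_def ell2_finite[OF V])
      have "inner_on V f (u j) = 0" if "j < card V" for j
      proof -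
        have "of_real \<mu> * inner_on V f (u j) = of_real (d j) * inner_on V f (u j)"
          using spectral_basis_eigen_coeff[OF a V sb that fV(1)] fV(2) by (simp add: inner_on_scale_left)
        then show ?thesis using e that by auto
      qed
      moreover have "f = (\<lambda>v. \<Sum>j<card V. inner_on V f (u j) * u j v)"
        using spectral_basisD[OF sb] V fV(1) by (intro orthonormal_basis_expansion) auto
      ultimately show False using f(2) by simp
    qed
  next
    assume "?I \<mu> \<noteq> {}"
    then obtain i where i: "i < card V" "d i = \<mu>" by auto
    have "inner_on V (u i) (u i) = 1"
      using spectral_basisD(1)[OF sb] i by (simp add: orthonormal_on_def)
    then have "u i \<noteq> (\<lambda>_. 0)" by (auto simp: inner_on_def)
    then show "is_eigenvalue V A (of_real \<mu>)"
      using spectral_basisD(2,3)[OF sb i(1)] A[of "u i"] i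
      unfolding is_eigenvalue_def eigenspace_def ell2_finite[OF V] by (intro bexI[of _ "u i"]) auto
  qed
  have "{\<mu>. \<mu> \<le> r \<and> is_eigenvalue V A (of_real \<mu>)} = d ` {i. i < card V \<and> d i \<le> r}"
    by (auto simp: ev)
  then have "eigenvalue_count V A r = (\<Sum>\<mu>\<in>d ` {i. i < card V \<and> d i \<le> r}. card (?I \<mu>))"
    by (simp add: eigenvalue_count_def dim_eigenspace[OF assms])
  also have "\<dots> = card (\<Union>\<mu>\<in>d ` {i. i < card V \<and> d i \<le> r}. ?I \<mu>)"
    by (rule card_UN_disjoint[symmetric]) auto
  also have "(\<Union>\<mu>\<in>d ` {i. i < card V \<and> d i \<le> r}. ?I \<mu>) = {i. i < card V \<and> d i \<le> r}"
    by auto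
  finally show ?thesis .
qed

section \<open>Integral operators with few small eigenvalues\<close>

text \<open>The eigenbasis diagonalizes the integer matrix of \<open>t\<close> over the complex
  numbers, so its characteristic polynomial, which has integer coefficients, splits with the numbers
  \<open>e i\<close> as roots.\<close>

lemma integer_charpoly_of_eigenbasis:
  fixes t :: "'v \<Rightarrow> 'v \<Rightarrow> int" and e :: "nat \<Rightarrow> complex"
  assumes V: "finite V" and on: "orthonormal_on V {..<card V} u"
    and eig: "\<And>i v. i < card V \<Longrightarrow> v \<in> V \<Longrightarrow> (\<Sum>w\<in>V. of_int (t v w) * u i w) = e i * u i v"
  obtains q :: "int poly" where "of_int_poly q = (\<Prod>i<card V. [:- e i, 1:])"
proof -
  define N where "N = card V"
  obtain h where h: "bij_betw h {..<N} V"
    using ex_bij_betw_nat_finite[OF V] by (auto simp: N_def atLeast0LessThan)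
  have hV: "h i \<in> V" if "i < N" for i using h that by (auto simp: bij_betw_def)
  have sumh: "(\<Sum>k = 0..<N. g (h k)) = (\<Sum>v\<in>V. g v)" for g :: "'v \<Rightarrow> complex"
    using sum.reindex_bij_betw[OF h] by (simp add: atLeast0LessThan)
  define A :: "int Matrix.mat" where "A = Matrix.mat N N (\<lambda>(i, j). t (h i) (h j))"
  define U where "U = Matrix.mat N N (\<lambda>(i, j). u j (h i))"
  define W where "W = Matrix.mat N N (\<lambda>(i, j). cnj (u i (h j)))"
  define D where "D = Matrix.mat N N (\<lambda>(i, j). if i = j then e i else 0)"
  define AC where "AC = map_mat complex_of_int A"
  have carr: "A \<in> carrier_mat N N" "U \<in> carrier_mat N N" "W \<in> carrier_mat N N" "D \<in> carrier_mat N N"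
    "AC \<in> carrier_mat N N"
    by (auto simp: A_def U_def W_def D_def AC_def)
  have WU: "W * U = 1\<^sub>m N"
  proof (intro eq_matI)
    fix i j assume "i < dim_row (1\<^sub>m N :: complex Matrix.mat)" "j < dim_col (1\<^sub>m N :: complex Matrix.mat)"
    then have ij: "i < N" "j < N" by auto
    have "(W * U) $$ (i, j) = (\<Sum>k = 0..<N. u j (h k) * cnj (u i (h k)))"
      using ij by (simp add: W_def U_def scalar_prod_def mult.commute)
    also have "\<dots> = inner_on V (u j) (u i)" unfolding inner_on_def by (rule sumh)
    also have "\<dots> = 1\<^sub>m N $$ (i, j)" using on ij by (auto simp: orthonormal_on_def N_def)
    finally show "(W * U) $$ (i, j) = 1\<^sub>m N $$ (i, j)" .
  qed (use carr in auto)
  then have UW: "U * W = 1\<^sub>m N" by (rule mat_mult_left_right_inverse[OF carr(3,2)])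
  have AU: "AC * U = U * D"
  proof (intro eq_matI)
    fix i j assume "i < dim_row (U * D)" "j < dim_col (U * D)"
    then have ij: "i < N" "j < N" using carr by auto
    have "(AC * U) $$ (i, j) = (\<Sum>k = 0..<N. of_int (t (h i) (h k)) * u j (h k))"
      using ij by (simp add: AC_def A_def U_def scalar_prod_def)
    also have "\<dots> = (\<Sum>w\<in>V. of_int (t (h i) w) * u j w)" by (rule sumh)
    also have "\<dots> = u j (h i) * e j" using eig[of j "h i"] ij hV by (simp add: N_def)
    also have "\<dots> = (\<Sum>k = 0..<N. u k (h i) * (if k = j then e k else 0))"
    proof -
      have "(\<Sum>k = 0..<N. u k (h i) * (if k = j then e k else 0))
          = (\<Sum>k = 0..<N. if k = j then u j (h i) * e j else 0)"
        by (intro sum.cong) auto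
      then show ?thesis using ij by simp
    qed
    also have "\<dots> = (U * D) $$ (i, j)"
      using ij by (simp add: U_def D_def scalar_prod_def)
    finally show "(AC * U) $$ (i, j) = (U * D) $$ (i, j)" .
  qed (use carr in auto)
  have "AC = AC * (U * W)" using UW carr by simp
  also have "\<dots> = U * D * W" using carr AU by (metis assoc_mult_mat)
  finally have "similar_mat AC D"
    using carr UW WU by (intro similar_matI[of _ _ U W N]) auto
  then have "char_poly AC = char_poly D" by (rule char_poly_similar)
  also have "\<dots> = (\<Prod>a\<leftarrow>diag_mat D. [:- a, 1:])"
    using carr by (intro char_poly_upper_triangular) (auto simp: D_def upper_triangular_def)
  also have "diag_mat D = map e [0..<N]"
    by (auto simp: diag_mat_def D_def)
  also have "(\<Prod>a\<leftarrow>map e [0..<N]. [:- a, 1:]) = (\<Prod>i<N. [:- e i, 1:])"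
    by (simp add: o_def prod.distinct_set_conv_list[symmetric] atLeast0LessThan)
  finally have "char_poly AC = (\<Prod>i<N. [:- e i, 1:])" .
  moreover have "char_poly AC = of_int_poly (char_poly A)"
    unfolding AC_def by (rule of_int_hom.char_poly_hom[OF carr(1)])
  ultimately show ?thesis using that by (metis N_def)
qed

text \<open>After removal of the power of the variable contributed by the zero roots, the constant
  term is up to sign the product of the nonzero roots, and it is a nonzero integer.\<close>

lemma prod_nonzero_roots_ge_1:
  fixes e :: "'i \<Rightarrow> complex" and q :: "int poly"
  assumes fin: "finite I" and q: "of_int_poly q = (\<Prod>i\<in>I. [:- e i, 1:])"
  shows "1 \<le> (\<Prod>i\<in>{i\<in>I. e i \<noteq> 0}. cmod (e i))"
proof -
  define J where "J = {i\<in>I. e i \<noteq> 0}"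
  define Z where "Z = {i\<in>I. e i = 0}"
  have "(\<Prod>i\<in>I. [:- e i, 1:]) = (\<Prod>i\<in>Z. [:- e i, 1:]) * (\<Prod>i\<in>J. [:- e i, 1:])"
    using fin by (subst prod.union_disjoint[symmetric]) (auto simp: J_def Z_def intro!: prod.cong)
  also have "(\<Prod>i\<in>Z. [:- e i, 1:]) = (\<Prod>i\<in>Z. [:0, 1:])"
    by (intro prod.cong) (auto simp: Z_def)
  also have "\<dots> = monom 1 (card Z)" by (simp add: monom_altdef)
  finally have eq: "of_int_poly q = monom 1 (card Z) * (\<Prod>i\<in>J. [:- e i, 1:])" using q by simp
  have "complex_of_int (coeff q (card Z)) = coeff (of_int_poly q) (card Z)" by simp
  also have "\<dots> = coeff (\<Prod>i\<in>J. [:- e i, 1:]) 0"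
    unfolding eq coeff_monom_mult by simp
  also have "\<dots> = (\<Prod>i\<in>J. - e i)" by (simp add: poly_0_coeff_0[symmetric] poly_prod)
  finally have c: "complex_of_int (coeff q (card Z)) = (\<Prod>i\<in>J. - e i)" .
  have "(\<Prod>i\<in>J. cmod (e i)) = cmod (complex_of_int (coeff q (card Z)))"
    unfolding c by (simp add: prod_norm[symmetric])
  also have "\<dots> = real_of_int \<bar>coeff q (card Z)\<bar>" by simp
  finally have n: "(\<Prod>i\<in>J. cmod (e i)) = real_of_int \<bar>coeff q (card Z)\<bar>" .
  have "(\<Prod>i\<in>J. cmod (e i)) \<noteq> 0" using fin by (auto simp: J_def)
  then have "coeff q (card Z) \<noteq> 0" using n by auto
  then have "\<bar>coeff q (card Z)\<bar> \<ge> 1" by linarith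
  then show ?thesis using n unfolding J_def by linarith
qed

text \<open>Lueck's estimate of the number of small eigenvalues of an integral matrix.\<close>

lemma card_small_factors_le:
  fixes e :: "'i \<Rightarrow> real"
  assumes fin: "finite I" and prod: "1 \<le> (\<Prod>i\<in>{i\<in>I. e i \<noteq> 0}. \<bar>e i\<bar>)"
    and K: "\<And>i. i \<in> I \<Longrightarrow> \<bar>e i\<bar> \<le> K" "1 \<le> K" and \<delta>: "0 < \<delta>" "\<delta> < 1"
  shows "real (card {i\<in>I. e i \<noteq> 0 \<and> \<bar>e i\<bar> \<le> \<delta>}) * ln (1 / \<delta>) \<le> real (card I) * ln K"
proof -
  define J where "J = {i\<in>I. e i \<noteq> 0}"
  define Q where "Q = {i\<in>I. e i \<noteq> 0 \<and> \<bar>e i\<bar> \<le> \<delta>}"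
  have f: "finite J" "finite Q" "Q \<subseteq> J" "J \<subseteq> I" using fin by (auto simp: J_def Q_def)
  have "0 \<le> ln (\<Prod>i\<in>J. \<bar>e i\<bar>)" using prod unfolding J_def[symmetric] by (rule ln_ge_zero)
  also have "\<dots> = (\<Sum>i\<in>J. ln \<bar>e i\<bar>)"
    by (rule ln_prod) (use f in \<open>auto simp: J_def\<close>)
  \<comment> \<open>The nonnegative \<open>ln K\<close> is allowed for every factor, also for the
    small ones already bounded by \<open>ln \<delta>\<close>; the total then involves only
    \<open>card I\<close>.\<close>
  also have "\<dots> \<le> (\<Sum>i\<in>J. (if i \<in> Q then ln \<delta> else 0) + ln K)"
  proof (intro sum_mono)
    fix i assume i: "i \<in> J"
    then have e: "0 < \<bar>e i\<bar>" "\<bar>e i\<bar> \<le> K" using K f by (auto simp: J_def)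
    have lK: "0 \<le> ln K" using K by simp
    show "ln \<bar>e i\<bar> \<le> (if i \<in> Q then ln \<delta> else 0) + ln K"
    proof (cases "i \<in> Q")
      case True
      then have "ln \<bar>e i\<bar> \<le> ln \<delta>" using e \<delta> by (subst ln_le_cancel_iff) (auto simp: Q_def)
      then show ?thesis using True lK by simp
    next
      case False
      then show ?thesis using e K by simp
    qed
  qed
  also have "\<dots> = real (card Q) * ln \<delta> + real (card J) * ln K"
    using f by (simp add: sum.distrib sum.If_cases Int_absorb1)
  also have "\<dots> \<le> real (card Q) * ln \<delta> + real (card I) * ln K"
    using K fin f by (intro add_left_mono mult_right_mono) (auto intro: card_mono)
  finally show ?thesis using \<delta> by (simp add: Q_def ln_div)
qed

section \<open>Polynomials of integral kernels\<close>

fun kernel_power :: "'v set \<Rightarrow> ('v \<Rightarrow> 'v \<Rightarrow> int) \<Rightarrow> nat \<Rightarrow> 'v \<Rightarrow> 'v \<Rightarrow> int" where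
  "kernel_power V t 0 v w = (if v = w then 1 else 0)"
| "kernel_power V t (Suc k) v w = (\<Sum>x\<in>V. kernel_power V t k v x * t x w)"

lemma kernel_power_eigen:
  assumes V: "finite V"
    and eig: "\<And>v. v \<in> V \<Longrightarrow> (\<Sum>w\<in>V. of_int (t v w) * u w) = e * (u v :: complex)"
    and v: "v \<in> V"
  shows "(\<Sum>w\<in>V. of_int (kernel_power V t k v w) * u w) = e ^ k * u v"
proof (induction k)
  case 0
  have "(\<Sum>w\<in>V. of_int (kernel_power V t 0 v w) * u w) = (\<Sum>w\<in>V. if w = v then u v else 0)"
    by (intro sum.cong) auto
  then show ?case using V v by simp
next
  case (Suc k)
  have "(\<Sum>w\<in>V. of_int (kernel_power V t (Suc k) v w) * u w)
      = (\<Sum>w\<in>V. \<Sum>x\<in>V. of_int (kernel_power V t k v x) * (of_int (t x w) * u w))"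
    by (simp add: sum_distrib_right mult.assoc)
  also have "\<dots> = (\<Sum>x\<in>V. of_int (kernel_power V t k v x) * (\<Sum>w\<in>V. of_int (t x w) * u w))"
    by (subst sum.swap) (simp add: sum_distrib_left)
  also have "\<dots> = (\<Sum>x\<in>V. of_int (kernel_power V t k v x) * (e * u x))"
    by (intro sum.cong) (simp_all add: eig)
  also have "\<dots> = e * (\<Sum>x\<in>V. of_int (kernel_power V t k v x) * u x)"
    by (simp add: sum_distrib_left mult_ac)
  finally show ?case using Suc by (simp add: mult_ac)
qed

text \<open>Evaluating \<open>p\<close> at the kernel gives again an integral kernel, with the same
  eigenbasis and with the values of \<open>p\<close> at \<open>d i\<close> as eigenvalues. Its
  nonzero eigenvalues multiply to at least 1 in absolute value, so few can be small. The bound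
  depends on \<open>p\<close> only through \<open>K\<close>.\<close>

lemma card_small_polynomial_values_le:
  fixes t :: "'v \<Rightarrow> 'v \<Rightarrow> int" and p :: "int poly" and d :: "nat \<Rightarrow> real"
  assumes V: "finite V" and on: "orthonormal_on V {..<card V} u"
    and eig: "\<And>i v. i < card V \<Longrightarrow> v \<in> V \<Longrightarrow>
      (\<Sum>w\<in>V. of_int (t v w) * u i w) = of_real (d i) * u i v"
    and K: "\<And>i. i < card V \<Longrightarrow> \<bar>poly (of_int_poly p) (d i)\<bar> \<le> K" "1 \<le> K"
    and \<delta>: "0 < \<delta>" "\<delta> < 1"
  shows "real (card {i. i < card V \<and> poly (of_int_poly p) (d i) \<noteq> 0 \<and>
           \<bar>poly (of_int_poly p) (d i)\<bar> \<le> \<delta>}) * ln (1 / \<delta>) \<le> real (card V) * ln K"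
proof -
  define pt where "pt v w = (\<Sum>k\<le>degree p. coeff p k * kernel_power V t k v w)" for v w
  define e where "e i = poly (of_int_poly p) (d i)" for i
  have pe: "(\<Sum>w\<in>V. of_int (pt v w) * u i w) = of_real (e i) * u i v"
    if "i < card V" "v \<in> V" for i v
  proof -
    have "(\<Sum>w\<in>V. of_int (pt v w) * u i w)
        = (\<Sum>w\<in>V. \<Sum>k\<le>degree p. of_int (coeff p k) * (of_int (kernel_power V t k v w) * u i w))"
      by (simp add: pt_def sum_distrib_right mult.assoc)
    also have "\<dots> = (\<Sum>k\<le>degree p. of_int (coeff p k) * (\<Sum>w\<in>V. of_int (kernel_power V t k v w) * u i w))"
      by (subst sum.swap) (simp add: sum_distrib_left)
    also have "\<dots> = (\<Sum>k\<le>degree p. of_int (coeff p k) * (of_real (d i) ^ k * u i v))"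
      using kernel_power_eigen[OF V eig[OF that(1)] that(2)] by simp
    also have "\<dots> = of_real (e i) * u i v"
      by (simp add: e_def poly_altdef sum_distrib_right mult.assoc)
    finally show ?thesis .
  qed
  obtain q :: "int poly" where q: "of_int_poly q = (\<Prod>i<card V. [:- complex_of_real (e i), 1:])"
    by (rule integer_charpoly_of_eigenbasis[OF V on pe])
  have "1 \<le> (\<Prod>i\<in>{i\<in>{..<card V}. e i \<noteq> 0}. \<bar>e i\<bar>)"
    using prod_nonzero_roots_ge_1[OF _ q] by simp
  from card_small_factors_le[OF _ this _ K(2) \<delta>] K(1) show ?thesis by (simp add: e_def)
qed

section \<open>Resolvents and gaps\<close>

definition finsupp :: "'v set \<Rightarrow> ('v \<Rightarrow> complex) set" where
  "finsupp V = {f \<in> funs_on V. finite {v. f v \<noteq> 0}}"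

text \<open>Summation over the function's own support makes the value independent of any ambient
  finite set. It is the squared l2-norm for finite supports only, since sums over infinite sets are
  0.\<close>

definition nsq :: "('v \<Rightarrow> complex) \<Rightarrow> real" where
  "nsq f = normsq {v. f v \<noteq> 0} f"

text \<open>For a Hermitian kernel and positive \<epsilon>, this test on finitely supported
  functions already yields invertibility on l2. As squared norms are compared, \<epsilon> is the
  square of the usual lower bound.\<close>

definition bounded_below :: "'v set \<Rightarrow> ('v \<Rightarrow> 'v \<Rightarrow> complex) \<Rightarrow> real \<Rightarrow> bool" where
  "bounded_below V b \<epsilon> \<longleftrightarrow> (\<forall>f\<in>finsupp V. \<epsilon> * nsq f \<le> nsq (kernel_op b f))"

lemma nsq_eq: "finite S \<Longrightarrow> f \<in> funs_on S \<Longrightarrow> nsq f = normsq S f"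
  unfolding nsq_def by (intro normsq_cong_supp) (auto simp: funs_on_def intro: finite_subset)

lemma nsq_nonneg [simp]: "0 \<le> nsq f"
  by (simp add: nsq_def)

lemma finsuppD:
  assumes "f \<in> finsupp V"
  shows "finite {v. f v \<noteq> 0}" "f \<in> funs_on V" "f \<in> funs_on {v. f v \<noteq> 0}"
  using assms by (auto simp: finsupp_def funs_on_def)

lemma finsupp_comb:
  assumes "f \<in> finsupp V" "g \<in> finsupp V"
  shows "(\<lambda>v. f v - c * g v) \<in> finsupp V"
proof -
  have "{v. f v - c * g v \<noteq> 0} \<subseteq> {v. f v \<noteq> 0} \<union> {v. g v \<noteq> 0}" by auto
  then show ?thesis
    using assms by (auto simp: finsupp_def funs_on_def intro: finite_subset)
qed

lemma finsupp_kernel_op: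
  assumes "hermitian_kernel V K b" "f \<in> finsupp V"
  shows "kernel_op b f \<in> finsupp V"
  using kernel_op_finite_support[OF assms(1) finsuppD(1,3)[OF assms(2)]] kernel_op_in_funs_on[OF assms(1)]
  by (simp add: finsupp_def)

lemma nsq_kernel_op_le:
  assumes "hermitian_kernel V K b" "f \<in> finsupp V"
  shows "nsq (kernel_op b f) \<le> K\<^sup>2 * nsq f"
  unfolding nsq_def[of f] nsq_def[of "kernel_op b f"]
  using finsuppD[OF assms(2)] finsuppD(1)[OF finsupp_kernel_op[OF assms]]
  by (intro normsq_kernel_op_le[OF assms(1)]) auto

text \<open>If \<open>\<delta>\<^sup>2\<close> were the best lower bound of \<open>b\<^sup>2\<close> and \<open>\<delta> < r\<close>, then
  \<open>b\<^sup>2 - \<delta>\<^sup>2 = (b - \<delta>) (b + \<delta>)\<close> would be a nonnegative operator that is bounded below, which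
  improves the bound.\<close>

lemma gap_bounded_below:
  assumes a: "hermitian_kernel V K a" and lt: "lam1 < lam2"
    and bb: "\<And>\<mu>. lam1 < \<mu> \<Longrightarrow> \<mu> < lam2 \<Longrightarrow> \<exists>\<epsilon>>0. bounded_below V (shift_kernel V a \<mu>) \<epsilon>"
  shows "bounded_below V (shift_kernel V a ((lam1 + lam2) / 2)) (((lam2 - lam1) / 2)\<^sup>2)"
proof (rule ccontr)
  define c where "c = (lam1 + lam2) / 2"
  define r where "r = (lam2 - lam1) / 2"
  define b where "b = shift_kernel V a c"
  assume "\<not> ?thesis"
  then obtain f0 where f0: "f0 \<in> finsupp V" "nsq (kernel_op b f0) < r\<^sup>2 * nsq f0"
    by (auto simp: bounded_below_def b_def c_def r_def not_le)
  have f0p: "nsq f0 > 0"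
    using f0(2) nsq_nonneg[of "kernel_op b f0"] nsq_nonneg[of f0] by (cases "nsq f0 = 0") (auto simp: less_le)
  \<comment> \<open>Rayleigh quotients of the square of \<open>b\<close>; the counterexample
    \<open>f0\<close> makes the set nonempty and pushes its infimum below
    \<open>r\<^sup>2\<close>.\<close>
  define Q where "Q = {nsq (kernel_op b f) / nsq f | f. f \<in> finsupp V \<and> nsq f > 0}"
  have bdd: "bdd_below Q" by (rule bdd_belowI[of _ 0]) (auto simp: Q_def)
  have q0: "nsq (kernel_op b f0) / nsq f0 \<in> Q" using f0 f0p by (auto simp: Q_def)
  define \<delta> where "\<delta> = sqrt (Inf Q)"
  have iq: "0 \<le> Inf Q" using q0 by (intro cInf_greatest) (auto simp: Q_def)
  then have d0: "0 \<le> \<delta>" and d2: "\<delta>\<^sup>2 = Inf Q" by (auto simp: \<delta>_def)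
  have "Inf Q \<le> nsq (kernel_op b f0) / nsq f0" by (rule cInf_lower[OF q0 bdd])
  also have "\<dots> < r\<^sup>2" using f0(2) f0p by (simp add: field_simps)
  finally have "\<delta>\<^sup>2 < r\<^sup>2" using d2 by simp
  then have "\<delta> < r" by (rule power_less_imp_less_base) (use lt in \<open>simp add: r_def\<close>)
  \<comment> \<open>This is where \<open>\<delta> < r\<close> matters: \<open>c + \<delta>\<close>
    and \<open>c - \<delta>\<close> lie strictly inside the interval, so both factors of
    \<open>P\<close> are bounded below.\<close>
  then have mem: "lam1 < c + \<delta>" "c + \<delta> < lam2" "lam1 < c - \<delta>" "c - \<delta> < lam2"
    using d0 lt unfolding c_def r_def by (simp_all add: field_simps)
  obtain e1 where e1: "e1 > 0" "bounded_below V (shift_kernel V a (c + \<delta>)) e1" using bb mem by blast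
  obtain e2 where e2: "e2 > 0" "bounded_below V (shift_kernel V a (c - \<delta>)) e2" using bb mem by blast
  define K1 where "K1 = K + \<bar>c\<bar>"
  have b: "hermitian_kernel V K1 b" unfolding b_def K1_def by (rule hermitian_kernel_shift[OF a])
  define M where "M = K1\<^sup>2 + 1"
  have M: "M > 0" by (simp add: M_def add_nonneg_pos)
  define P where "P f = (\<lambda>v. kernel_op b (kernel_op b f) v - of_real (\<delta>\<^sup>2) * f v)" for f
  have PF: "P f \<in> finsupp V" if "f \<in> finsupp V" for f
    unfolding P_def using that by (intro finsupp_comb finsupp_kernel_op[OF b]) auto
  have lower: "\<delta>\<^sup>2 * nsq f \<le> nsq (kernel_op b f)" if "f \<in> finsupp V" for f
  proof (cases "nsq f > 0")
    case True
    then have "nsq (kernel_op b f) / nsq f \<in> Q" using that by (auto simp: Q_def)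
    from cInf_lower[OF this bdd] show ?thesis using True by (simp add: d2 field_simps)
  next
    case False
    then show ?thesis using nsq_nonneg[of f] by simp
  qed
  have improve: "e1 * e2 * nsq f \<le> M * (nsq (kernel_op b f) - \<delta>\<^sup>2 * nsq f)" if f: "f \<in> finsupp V" for f
  proof -
    define g where "g = kernel_op (shift_kernel V a (c - \<delta>)) f"
    have sc: "kernel_op (shift_kernel V a \<mu>) h = (\<lambda>v. kernel_op b h v - of_real (\<mu> - c) * h v)"
      if "h \<in> finsupp V" for h \<mu>
      unfolding b_def using kernel_op_shift[OF a finsuppD(2)[OF that]] by (simp add: algebra_simps)
    have g: "g = (\<lambda>v. kernel_op b f v - of_real (- \<delta>) * f v)"
      unfolding g_def by (subst sc[OF f]) simp
    have gF: "g \<in> finsupp V" unfolding g_def by (intro finsupp_kernel_op[OF hermitian_kernel_shift[OF a]] f)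
    have "kernel_op (shift_kernel V a (c + \<delta>)) g = (\<lambda>v. kernel_op b g v - of_real (c + \<delta> - c) * g v)"
      by (rule sc[OF gF])
    also have "\<dots> = P f"
      unfolding g kernel_op_linear P_def by (auto simp: algebra_simps power2_eq_square)
    finally have "kernel_op (shift_kernel V a (c + \<delta>)) g = P f" .
    then have "e1 * nsq g \<le> nsq (P f)" using e1 gF by (auto simp: bounded_below_def)
    moreover have "e2 * nsq f \<le> nsq g" using e2 f by (auto simp: bounded_below_def g_def)
    ultimately have 1: "e1 * e2 * nsq f \<le> nsq (P f)"
    proof -
      have "e1 * (e2 * nsq f) \<le> e1 * nsq g" using \<open>e2 * nsq f \<le> nsq g\<close> e1(1) by (intro mult_left_mono) auto
      then show ?thesis using \<open>e1 * nsq g \<le> nsq (P f)\<close> by (simp add: mult.assoc)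
    qed
    \<comment> \<open>Contains the supports of all functions occurring in the semidefinite estimate,
      so that every pairing can be taken over one finite set.\<close>
    define S where "S = {v. f v \<noteq> 0} \<union> {v. kernel_op b f v \<noteq> 0} \<union> {v. P f v \<noteq> 0}
       \<union> {v. kernel_op b (P f) v \<noteq> 0} \<union> {v. P (P f) v \<noteq> 0}"
    have S: "finite S"
      unfolding S_def
      using f finsupp_kernel_op[OF b f] PF[OF f] finsupp_kernel_op[OF b PF[OF f]] PF[OF PF[OF f]]
      by (simp add: finsupp_def)
    have fS: "f \<in> funs_on S" "kernel_op b f \<in> funs_on S" "P f \<in> funs_on S"
      "kernel_op b (P f) \<in> funs_on S" "P (P f) \<in> funs_on S"
      by (auto simp: funs_on_def S_def)
    have sa: "inner_on S (kernel_op b (kernel_op b x)) y = inner_on S (kernel_op b x) (kernel_op b y)"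
      if "x \<in> funs_on S" "y \<in> funs_on S" "kernel_op b x \<in> funs_on S" for x y
      by (rule kernel_op_self_adjoint[OF b S that(3,2)])
    have form: "Re (inner_on S (P x) x) = normsq S (kernel_op b x) - \<delta>\<^sup>2 * normsq S x"
      if "x \<in> funs_on S" "kernel_op b x \<in> funs_on S" for x
      unfolding P_def using sa[OF that(1,1,2)]
      by (simp add: inner_on_diff_left inner_on_scale_left inner_on_self power2_eq_square)
    have "normsq S (P f) \<le> M * Re (inner_on S (P f) f)"
    proof (rule semidefinite_normsq_le)
      show "P (\<lambda>v. f v - of_real t * P f v) = (\<lambda>v. P f v - of_real t * P (P f) v)" for t
        unfolding P_def kernel_op_linear by (simp add: algebra_simps fun_eq_iff)
      show "inner_on S (P (P f)) f = inner_on S (P f) (P f)"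
      proof -
        have "inner_on S (P (P f)) f = inner_on S (kernel_op b (kernel_op b (P f))) f - of_real (\<delta>\<^sup>2) * inner_on S (P f) f"
          by (subst P_def) (simp only: inner_on_diff_left inner_on_scale_left)
        also have "inner_on S (kernel_op b (kernel_op b (P f))) f = inner_on S (P f) (kernel_op b (kernel_op b f))"
          using kernel_op_self_adjoint[OF b S fS(4,1)] kernel_op_self_adjoint[OF b S fS(3,2)] by simp
        also have "\<dots> - of_real (\<delta>\<^sup>2) * inner_on S (P f) f = inner_on S (P f) (P f)"
          by (subst (4) P_def) (simp add: inner_on_diff_right inner_on_scale_right)
        finally show ?thesis .
      qed
      show "0 \<le> Re (inner_on S (P (\<lambda>v. f v - of_real t * P f v)) (\<lambda>v. f v - of_real t * P f v))" for t
      proof -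
        define h where "h = (\<lambda>v. f v - of_real t * P f v)"
        have h: "h \<in> finsupp V" "h \<in> funs_on S" "kernel_op b h \<in> funs_on S"
          using finsupp_comb[OF f PF[OF f]] fS unfolding h_def kernel_op_linear
          by (auto simp: funs_on_def)
        show ?thesis unfolding h_def[symmetric] form[OF h(2,3)]
          using lower[OF h(1)] nsq_eq[OF S h(2)] nsq_eq[OF S h(3)] by simp
      qed
      show "Re (inner_on S (P (P f)) (P f)) \<le> M * normsq S (P f)"
      proof -
        have "normsq S (kernel_op b (P f)) \<le> K1\<^sup>2 * normsq S (P f)"
          by (rule normsq_kernel_op_le[OF b S S fS(3)])
        moreover have "0 \<le> \<delta>\<^sup>2 * normsq S (P f)" by simp
        ultimately show ?thesis
          unfolding form[OF fS(3,4)] M_def distrib_right using normsq_nonneg[of S "P f"] by linarith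
      qed
    qed (rule M)
    then have "nsq (P f) \<le> M * (nsq (kernel_op b f) - \<delta>\<^sup>2 * nsq f)"
      unfolding form[OF fS(1,2)] using nsq_eq[OF S] fS by simp
    then show ?thesis using 1 by simp
  qed
  have "\<delta>\<^sup>2 + e1 * e2 / M \<le> Inf Q"
  proof (rule cInf_greatest)
    show "Q \<noteq> {}" using q0 by blast
    fix x assume "x \<in> Q"
    then obtain f where f: "x = nsq (kernel_op b f) / nsq f" "f \<in> finsupp V" "nsq f > 0"
      by (auto simp: Q_def)
    have "e1 * e2 / M * nsq f \<le> nsq (kernel_op b f) - \<delta>\<^sup>2 * nsq f"
      using improve[OF f(2)] M by (simp add: field_simps)
    then have "(\<delta>\<^sup>2 + e1 * e2 / M) * nsq f \<le> nsq (kernel_op b f)" by (simp add: algebra_simps)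
    then show "\<delta>\<^sup>2 + e1 * e2 / M \<le> x" using f by (simp add: pos_le_divide_eq)
  qed
  moreover have "e1 * e2 / M > 0" using e1 e2 M by simp
  ultimately show False using d2 by simp
qed

section \<open>Square-summable functions and bounded inverses\<close>

definition L2 :: "'v set \<Rightarrow> ('v \<Rightarrow> complex) \<Rightarrow> real" where
  "L2 V f = (\<Sum>\<^sub>\<infinity>v\<in>V. (cmod (f v))\<^sup>2)"

lemma ell2_norm_eq: "ell2_norm V f = sqrt (L2 V f)"
  by (simp add: ell2_norm_def L2_def)

lemma L2_nonneg [simp]: "0 \<le> L2 V f"
  by (simp add: L2_def infsum_nonneg)

lemma ell2_funs_on: "f \<in> ell2 V \<Longrightarrow> f \<in> funs_on V"
  by (simp add: ell2_def funs_on_def)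

lemma normsq_le_L2:
  assumes "f \<in> ell2 V" "finite G"
  shows "normsq G f \<le> L2 V f"
proof -
  have "normsq G f = normsq (G \<inter> V) f"
    unfolding normsq_def using assms ell2_funs_on[OF assms(1)]
    by (intro sum.mono_neutral_right) (auto simp: funs_on_def)
  also have "\<dots> \<le> L2 V f"
    unfolding normsq_def L2_def using assms by (intro finite_sum_le_infsum) (auto simp: ell2_def)
  finally show ?thesis .
qed

lemma ell2I:
  assumes "f \<in> funs_on V" "\<And>G. finite G \<Longrightarrow> G \<subseteq> V \<Longrightarrow> normsq G f \<le> C"
  shows "f \<in> ell2 V" "L2 V f \<le> C"
proof -
  have s: "(\<lambda>v. (cmod (f v))\<^sup>2) summable_on V"
    using assms(2) by (intro nonneg_bdd_above_summable_on bdd_aboveI[of _ C]) (auto simp: normsq_def)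
  then show "f \<in> ell2 V" using assms(1) by (simp add: ell2_def funs_on_def)
  show "L2 V f \<le> C"
    unfolding L2_def using s assms(2) by (intro infsum_le_finite_sums) (auto simp: normsq_def)
qed

lemma finsupp_ell2:
  assumes "f \<in> finsupp V"
  shows "f \<in> ell2 V" "L2 V f = nsq f"
proof -
  note D = finsuppD[OF assms]
  have b: "normsq G f \<le> nsq f" if "finite G" for G
  proof -
    have "normsq G f \<le> normsq (G \<union> {v. f v \<noteq> 0}) f"
      using that D by (intro normsq_mono) auto
    also have "\<dots> = nsq f"
      using that D by (intro nsq_eq[symmetric]) (auto simp: funs_on_def)
    finally show ?thesis .
  qed
  show e: "f \<in> ell2 V" using ell2I(1)[OF D(2) b] .
  show "L2 V f = nsq f"
    using ell2I(2)[OF D(2) b] normsq_le_L2[OF e D(1)] by (simp add: nsq_def)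
qed

definition local_op :: "(('v \<Rightarrow> complex) \<Rightarrow> 'v \<Rightarrow> complex) \<Rightarrow> bool" where
  "local_op P \<longleftrightarrow> (\<forall>G. finite G \<longrightarrow> (\<exists>S. finite S \<and>
     (\<forall>f g. (\<forall>w\<in>S. f w = g w) \<longrightarrow> (\<forall>v\<in>G. P f v = P g v))))"

lemma local_kernel_op:
  assumes "hermitian_kernel V K b"
  shows "local_op (kernel_op b)"
  unfolding local_op_def
proof (intro allI impI)
  fix G :: "'a set" assume "finite G"
  then show "\<exists>S. finite S \<and> (\<forall>f g. (\<forall>w\<in>S. f w = g w) \<longrightarrow> (\<forall>v\<in>G. kernel_op b f v = kernel_op b g v))"
    using hermitian_kernelD(3)[OF assms]
    by (intro exI[of _ "\<Union>v\<in>G. {w. b v w \<noteq> 0}"]) (auto simp: kernel_op_def intro!: sum.cong)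
qed

text \<open>Finitely many values of \<open>P f\<close> depend on finitely many values of
  \<open>f\<close>, so \<open>f\<close> may be truncated there. Truncation does not increase the
  norm, and the bound for finitely supported functions passes to all finite partial sums.\<close>

lemma local_op_bound:
  assumes P: "local_op P" and supp: "\<And>f. f \<in> ell2 V \<Longrightarrow> P f \<in> funs_on V" and q: "0 \<le> q"
    and bd: "\<And>f. f \<in> finsupp V \<Longrightarrow> P f \<in> finsupp V \<and> nsq (P f) \<le> q * nsq f"
    and f: "f \<in> ell2 V"
  shows "P f \<in> ell2 V" "L2 V (P f) \<le> q * L2 V f"
proof -
  have "normsq G (P f) \<le> q * L2 V f" if G: "finite G" for G
  proof -
    obtain S where S: "finite S" "\<And>f g. (\<forall>w\<in>S. f w = g w) \<Longrightarrow> (\<forall>v\<in>G. P f v = P g v)"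
      using P G unfolding local_op_def by blast
    define g where "g v = (if v \<in> S then f v else 0)" for v
    have "{v. g v \<noteq> 0} \<subseteq> S" by (auto simp: g_def)
    then have g: "g \<in> finsupp V" "g \<in> funs_on S"
      using S(1) ell2_funs_on[OF f] by (auto simp: finsupp_def funs_on_def g_def intro: finite_subset)
    have "normsq G (P f) = normsq G (P g)"
      unfolding normsq_def using S(2)[of f g] by (intro sum.cong) (auto simp: g_def)
    also have "\<dots> \<le> L2 V (P g)" using bd[OF g(1)] G by (intro normsq_le_L2 finsupp_ell2) auto
    also have "\<dots> \<le> q * nsq g" using bd[OF g(1)] finsupp_ell2(2) by metis
    also have "nsq g = normsq S f"
      unfolding nsq_eq[OF S(1) g(2)] by (auto simp: normsq_def g_def)
    also have "\<dots> \<le> L2 V f" by (rule normsq_le_L2[OF f S(1)])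
    finally show ?thesis using q by (simp add: mult_left_mono)
  qed
  then show "P f \<in> ell2 V" "L2 V (P f) \<le> q * L2 V f"
    using ell2I[OF supp[OF f]] by blast+
qed

lemma sqrt_normsq_eq: "sqrt (normsq G f) = L2_set (\<lambda>v. cmod (f v)) G"
  by (simp add: L2_set_def normsq_def)

lemma sqrt_normsq_sum_le:
  "sqrt (normsq G (\<lambda>v. \<Sum>k<n. h k v)) \<le> (\<Sum>k<n. sqrt (normsq G (h (k::nat))))"
proof (induction n)
  case 0
  then show ?case by (simp add: normsq_def)
next
  case (Suc n)
  have "sqrt (normsq G (\<lambda>v. \<Sum>k<Suc n. h k v))
      \<le> L2_set (\<lambda>v. cmod (\<Sum>k<n. h k v) + cmod (h n v)) G"
    unfolding sqrt_normsq_eq by (intro L2_set_mono) (auto intro: norm_triangle_ineq)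
  also have "\<dots> \<le> sqrt (normsq G (\<lambda>v. \<Sum>k<n. h k v)) + sqrt (normsq G (h n))"
    unfolding sqrt_normsq_eq by (rule L2_set_triangle_ineq)
  finally show ?case using Suc by simp
qed

text \<open>The inverse is the Neumann series
  \<open>b\<^sup>-\<^sup>1 = K\<^sup>-\<^sup>2 (\<Sum>k. (1 - b\<^sup>2 / K\<^sup>2)\<^sup>k) b\<close>.\<close>

lemma bounded_below_invertible:
  fixes b :: "'v \<Rightarrow> 'v \<Rightarrow> complex"
  assumes b: "hermitian_kernel V K b" and K: "K > 0" and eps: "\<epsilon> > 0" and bb: "bounded_below V b \<epsilon>"
  shows "\<exists>R. bounded_operator V R \<and> (\<forall>f\<in>ell2 V. R (kernel_op b f) = f \<and> kernel_op b (R f) = f)"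
proof -
  define T where "T f = (\<lambda>v :: 'v. f v - of_real (1 / K\<^sup>2) * kernel_op b (kernel_op b f) v)" for f
  \<comment> \<open>The lower bound \<epsilon> makes \<open>T\<close> contract squared norms by
    \<open>1 - \<epsilon> / K\<^sup>2\<close>; the maximum with 0 keeps \<open>q\<close> nonnegative
    for arbitrary \<epsilon>.\<close>
  define q where "q = max 0 (1 - \<epsilon> / K\<^sup>2)"
  have q: "0 \<le> q" "q < 1" using eps K by (auto simp: q_def)
  define r where "r = sqrt q"
  have r: "0 \<le> r" "r < 1" using q by (auto simp: r_def)
  note BV = kernel_op_in_funs_on[OF b]
  have B2: "kernel_op b f \<in> ell2 V" "L2 V (kernel_op b f) \<le> K\<^sup>2 * L2 V f" if "f \<in> ell2 V" for f
    using local_op_bound[OF local_kernel_op[OF b] _ _ _ that, of "K\<^sup>2"] BV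
      finsupp_kernel_op[OF b] nsq_kernel_op_le[OF b] by auto
  have lT: "local_op T"
    unfolding local_op_def
  proof (intro allI impI)
    fix G :: "'v set" assume G: "finite G"
    obtain S1 where S1: "finite S1"
      "\<And>f g. (\<forall>w\<in>S1. f w = g w) \<Longrightarrow> (\<forall>v\<in>G. kernel_op b f v = kernel_op b g v)"
      using local_kernel_op[OF b] G unfolding local_op_def by blast
    obtain S2 where S2: "finite S2"
      "\<And>f g. (\<forall>w\<in>S2. f w = g w) \<Longrightarrow> (\<forall>v\<in>S1. kernel_op b f v = kernel_op b g v)"
      using local_kernel_op[OF b] S1(1) unfolding local_op_def by blast
    show "\<exists>S. finite S \<and> (\<forall>f g. (\<forall>w\<in>S. f w = g w) \<longrightarrow> (\<forall>v\<in>G. T f v = T g v))"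
    proof (intro exI[of _ "G \<union> S2"] conjI allI impI ballI)
      show "finite (G \<union> S2)" using G S2(1) by simp
      fix f g :: "'v \<Rightarrow> complex" and v assume fg: "\<forall>w\<in>G \<union> S2. f w = g w" and v: "v \<in> G"
      then have "\<forall>v\<in>S1. kernel_op b f v = kernel_op b g v" by (intro S2(2)) simp
      then have "\<forall>v\<in>G. kernel_op b (kernel_op b f) v = kernel_op b (kernel_op b g) v" by (rule S1(2))
      then show "T f v = T g v" using fg v by (simp add: T_def)
    qed
  qed
  have T2: "T f \<in> ell2 V" "L2 V (T f) \<le> q * L2 V f" if "f \<in> ell2 V" for f
  proof -
    have "T g \<in> finsupp V \<and> nsq (T g) \<le> q * nsq g" if g: "g \<in> finsupp V" for g
    proof -
      have TF: "T g \<in> finsupp V"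
        unfolding T_def by (intro finsupp_comb g finsupp_kernel_op[OF b])
      define B where "B = kernel_op b"
      define S where "S = {v. g v \<noteq> 0} \<union> {v. B g v \<noteq> 0} \<union> {v. B (B g) v \<noteq> 0}"
      have S: "finite S"
        unfolding S_def B_def
        using g finsupp_kernel_op[OF b g] finsupp_kernel_op[OF b finsupp_kernel_op[OF b g]]
        by (simp add: finsupp_def)
      have fS: "g \<in> funs_on S" "B g \<in> funs_on S" "B (B g) \<in> funs_on S" "T g \<in> funs_on S"
        by (auto simp: funs_on_def S_def T_def B_def)
      have "inner_on S (T g) (T g) = inner_on S g g
         - of_real (1 / K\<^sup>2) * (inner_on S (B (B g)) g + inner_on S g (B (B g)))
         + of_real (1 / K\<^sup>2)^2 * inner_on S (B (B g)) (B (B g))"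
        unfolding T_def B_def[symmetric]
        by (simp only: inner_on_diff_left inner_on_diff_right inner_on_scale_left inner_on_scale_right)
          (simp add: algebra_simps power2_eq_square)
      also have "inner_on S (B (B g)) g = of_real (normsq S (B g))"
        using kernel_op_self_adjoint[OF b S fS(2,1)[unfolded B_def]] by (simp add: inner_on_self B_def)
      also have "inner_on S g (B (B g)) = of_real (normsq S (B g))"
        using kernel_op_self_adjoint[OF b S fS(1,2)[unfolded B_def]] by (simp add: inner_on_self B_def)
      finally have "of_real (normsq S (T g)) = complex_of_real (normsq S g - 1 / K\<^sup>2 * (2 * normsq S (B g))
         + (1 / K\<^sup>2)^2 * normsq S (B (B g)))"
        unfolding inner_on_self by simp
      then have "normsq S (T g) = normsq S g - 1 / K\<^sup>2 * (2 * normsq S (B g)) + (1 / K\<^sup>2)^2 * normsq S (B (B g))"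
        unfolding of_real_eq_iff .
      \<comment> \<open>Half of the negative cross term absorbs the quadratic term by the Schur
        bound; the other half carries \<epsilon>.\<close>
      also have "\<dots> \<le> normsq S g - 1 / K\<^sup>2 * (2 * normsq S (B g)) + (1 / K\<^sup>2)^2 * (K\<^sup>2 * normsq S (B g))"
        using normsq_kernel_op_le[OF b S S fS(2)] unfolding B_def
        by (intro add_left_mono mult_left_mono) auto
      also have "\<dots> = normsq S g - normsq S (B g) / K\<^sup>2"
        using K by (simp add: field_simps power2_eq_square)
      also have "\<dots> \<le> normsq S g - \<epsilon> * normsq S g / K\<^sup>2"
        using bb g K nsq_eq[OF S fS(1)] nsq_eq[OF S fS(2)]
        by (intro diff_left_mono divide_right_mono) (auto simp: bounded_below_def B_def)
      also have "\<dots> = (1 - \<epsilon> / K\<^sup>2) * normsq S g" by (simp add: algebra_simps)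
      also have "\<dots> \<le> q * normsq S g" by (intro mult_right_mono) (auto simp: q_def)
      finally show ?thesis using TF nsq_eq[OF S fS(1)] nsq_eq[OF S fS(4)] by simp
    qed
    moreover have "T g \<in> funs_on V" if "g \<in> ell2 V" for g
      using BV ell2_funs_on[OF that] by (auto simp: T_def funs_on_def)
    ultimately show "T f \<in> ell2 V" "L2 V (T f) \<le> q * L2 V f"
      using local_op_bound[OF lT _ q(1) _ that] by blast+
  qed
  have Tk: "(T ^^ k) f \<in> ell2 V \<and> L2 V ((T ^^ k) f) \<le> q ^ k * L2 V f" if "f \<in> ell2 V" for f k
  proof (induction k)
    case (Suc k)
    have "L2 V (T ((T ^^ k) f)) \<le> q * L2 V ((T ^^ k) f)" using T2 Suc by blast
    also have "\<dots> \<le> q * (q ^ k * L2 V f)" using Suc q by (intro mult_left_mono) auto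
    finally show ?case using T2 Suc by (simp add: mult.assoc)
  qed (use that in auto)
  have Tpt: "sqrt (normsq G ((T ^^ k) f)) \<le> r ^ k * sqrt (L2 V f)" if "f \<in> ell2 V" "finite G" for f k G
  proof -
    have "normsq G ((T ^^ k) f) \<le> q ^ k * L2 V f"
      using Tk[OF that(1), of k] normsq_le_L2[OF _ that(2)] by (meson order_trans)
    then have "sqrt (normsq G ((T ^^ k) f)) \<le> sqrt (q ^ k * L2 V f)" by simp
    then show ?thesis by (simp add: real_sqrt_mult real_sqrt_power r_def)
  qed
  have Tv: "cmod ((T ^^ k) f v) \<le> r ^ k * sqrt (L2 V f)" if "f \<in> ell2 V" for f k v
    using Tpt[OF that, of "{v}" k] by (simp add: normsq_def)
  have Tlin: "(T ^^ k) (\<lambda>v. f v + g v) = (\<lambda>v. (T ^^ k) f v + (T ^^ k) g v)"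
    "(T ^^ k) (\<lambda>v. f v - g v) = (\<lambda>v. (T ^^ k) f v - (T ^^ k) g v)"
    "(T ^^ k) (\<lambda>v. c * f v) = (\<lambda>v. c * (T ^^ k) f v)" for f g c k
    by (induction k) (auto simp: T_def kernel_op_linear algebra_simps)
  have Tcomm: "kernel_op b ((T ^^ k) f) = (T ^^ k) (kernel_op b f)" for f k
  proof (induction k)
    case (Suc k)
    have "kernel_op b (T g) = T (kernel_op b g)" for g by (simp only: T_def kernel_op_linear)
    then show ?case using Suc by simp
  qed simp
  have Tto0: "(\<lambda>k. (T ^^ k) f v) \<longlonglongrightarrow> 0" if "f \<in> ell2 V" for f v
  proof (rule tendsto_norm_zero_cancel, rule tendsto_sandwich[of "\<lambda>_. 0"])
    show "\<forall>\<^sub>F k in sequentially. cmod ((T ^^ k) f v) \<le> r ^ k * sqrt (L2 V f)"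
      using Tv[OF that] by simp
    show "(\<lambda>k. r ^ k * sqrt (L2 V f)) \<longlonglongrightarrow> 0"
      using r by (intro tendsto_mult_left_zero LIMSEQ_power_zero) auto
  qed auto
  define R where "R g = (\<lambda>v. of_real (1 / K\<^sup>2) * (\<Sum>k. (T ^^ k) (kernel_op b g) v))" for g
  have summ: "summable (\<lambda>k. (T ^^ k) f v)" if "f \<in> ell2 V" for f v
  proof (rule summable_comparison_test')
    show "summable (\<lambda>k. r ^ k * sqrt (L2 V f))"
      using r by (intro summable_mult2 summable_geometric) auto
  qed (use Tv[OF that] in auto)
  \<comment> \<open>\<open>1 - T\<close> is the square of \<open>b\<close> divided by
    \<open>K\<^sup>2\<close>, so the partial sums telescope, with a remainder
    \<open>(T ^^ n) f\<close> that tends to 0 pointwise.\<close>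
  have tele: "(\<lambda>n. of_real (1 / K\<^sup>2) * (\<Sum>k<n. (T ^^ k) (kernel_op b (kernel_op b f)) v)) \<longlonglongrightarrow> f v"
    if "f \<in> ell2 V" for f v
  proof -
    have st: "of_real (1 / K\<^sup>2) * (T ^^ k) (kernel_op b (kernel_op b f)) v = (T ^^ k) f v - (T ^^ Suc k) f v" for k
    proof -
      have "(\<lambda>v. of_real (1 / K\<^sup>2) * kernel_op b (kernel_op b f) v) = (\<lambda>v. f v - T f v)"
        by (simp add: T_def)
      then have "(T ^^ k) (\<lambda>v. of_real (1 / K\<^sup>2) * kernel_op b (kernel_op b f) v)
          = (\<lambda>v. (T ^^ k) f v - (T ^^ k) (T f) v)" by (simp only: Tlin(2))
      then show ?thesis unfolding Tlin(3) by (simp add: fun_eq_iff funpow_swap1)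
    qed
    have "of_real (1 / K\<^sup>2) * (\<Sum>k<n. (T ^^ k) (kernel_op b (kernel_op b f)) v) = f v - (T ^^ n) f v" for n
      unfolding sum_distrib_left st by (induction n) auto
    moreover have "(\<lambda>n. f v - (T ^^ n) f v) \<longlonglongrightarrow> f v - 0"
      by (intro tendsto_intros Tto0 that)
    ultimately show ?thesis by simp
  qed
  have Rlim: "(\<lambda>n. of_real (1 / K\<^sup>2) * (\<Sum>k<n. (T ^^ k) (kernel_op b g) v)) \<longlonglongrightarrow> R g v"
    if "g \<in> ell2 V" for g v
    unfolding R_def by (intro tendsto_mult_left summable_LIMSEQ summ B2 that)
  have RB: "R (kernel_op b f) = f" if "f \<in> ell2 V" for f
    using LIMSEQ_unique[OF Rlim[OF B2(1)[OF that]] tele[OF that]] by (simp add: fun_eq_iff)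
  have BR: "kernel_op b (R f) = f" if "f \<in> ell2 V" for f
  proof
    fix v
    \<comment> \<open>Rows are finite, so pointwise convergence suffices to exchange the operator
      with the limit.\<close>
    have "(\<lambda>n. kernel_op b (\<lambda>x. of_real (1 / K\<^sup>2) * (\<Sum>k<n. (T ^^ k) (kernel_op b f) x)) v)
        \<longlonglongrightarrow> kernel_op b (R f) v"
      unfolding kernel_op_def[of _ _ v] by (intro tendsto_sum tendsto_mult_left Rlim that)
    moreover have "kernel_op b (\<lambda>x. of_real (1 / K\<^sup>2) * (\<Sum>k<n. (T ^^ k) (kernel_op b f) x)) v
        = of_real (1 / K\<^sup>2) * (\<Sum>k<n. (T ^^ k) (kernel_op b (kernel_op b f)) v)" for n
      using kernel_op_sum[where a = b and J = "{..<n}" and c = "\<lambda>_. 1" and u = "\<lambda>k. (T ^^ k) (kernel_op b f)"]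
      unfolding kernel_op_linear by (simp add: Tcomm fun_eq_iff)
    ultimately show "kernel_op b (R f) v = f v"
      using tele[OF that, of v] by (simp add: LIMSEQ_unique)
  qed
  \<comment> \<open>The prefactor of the series, times \<open>K\<close> for the inner application of
    \<open>b\<close>, times the geometric sum of \<open>r\<close>. The ratio is the square root of
    \<open>q\<close> because the triangle inequality acts on norms, not on their squares.\<close>
  define C where "C = 1 / K\<^sup>2 * (K / (1 - r))"
  have C: "C \<ge> 0" using K r by (simp add: C_def)
  have RN: "R g \<in> ell2 V" "L2 V (R g) \<le> (C * sqrt (L2 V g))\<^sup>2" if g: "g \<in> ell2 V" for g
  proof -
    have "normsq G (R g) \<le> (C * sqrt (L2 V g))\<^sup>2" if G: "finite G" for G
    proof (rule LIMSEQ_le_const2)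
      define s where "s n = (\<lambda>v. of_real (1 / K\<^sup>2) * (\<Sum>k<n. (T ^^ k) (kernel_op b g) v))" for n
      show "(\<lambda>n. normsq G (s n)) \<longlonglongrightarrow> normsq G (R g)"
        unfolding normsq_def s_def by (intro tendsto_sum tendsto_power tendsto_norm Rlim g)
      have "normsq G (s n) \<le> (C * sqrt (L2 V g))\<^sup>2" for n
      proof -
        have "sqrt (L2 V (kernel_op b g)) \<le> sqrt (K\<^sup>2 * L2 V g)"
          using B2(2)[OF g] by simp
        then have LK: "sqrt (L2 V (kernel_op b g)) \<le> K * sqrt (L2 V g)"
          using K by (simp add: real_sqrt_mult)
        have "sqrt (normsq G (s n)) = 1 / K\<^sup>2 * sqrt (normsq G (\<lambda>v. \<Sum>k<n. (T ^^ k) (kernel_op b g) v))"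
          unfolding s_def normsq_scale using K by (simp add: real_sqrt_mult norm_divide norm_power)
        also have "\<dots> \<le> 1 / K\<^sup>2 * (\<Sum>k<n. r ^ k * (K * sqrt (L2 V g)))"
        proof (intro mult_left_mono order_trans[OF sqrt_normsq_sum_le] sum_mono)
          fix k
          show "sqrt (normsq G ((T ^^ k) (kernel_op b g))) \<le> r ^ k * (K * sqrt (L2 V g))"
            using Tpt[OF B2(1)[OF g] G, of k] LK r
            by (meson order_trans mult_left_mono zero_le_power)
        qed simp
        also have "\<dots> = 1 / K\<^sup>2 * ((\<Sum>k<n. r ^ k) * (K * sqrt (L2 V g)))"
          by (simp add: sum_distrib_right)
        also have "\<dots> \<le> 1 / K\<^sup>2 * ((1 / (1 - r)) * (K * sqrt (L2 V g)))"
        proof (intro mult_left_mono mult_right_mono)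
          show "(\<Sum>k<n. r ^ k) \<le> 1 / (1 - r)"
            using r by (simp add: sum_gp_strict divide_right_mono)
        qed (use K in auto)
        also have "\<dots> = C * sqrt (L2 V g)" by (simp add: C_def)
        finally have "sqrt (normsq G (s n)) \<le> C * sqrt (L2 V g)" .
        then show ?thesis by (metis normsq_nonneg real_sqrt_ge_0_iff power_mono real_sqrt_pow2)
      qed
      then show "\<exists>N. \<forall>n\<ge>N. normsq G (s n) \<le> (C * sqrt (L2 V g))\<^sup>2" by blast
    qed
    moreover have "R g \<in> funs_on V"
    proof -
      have "(T ^^ k) (kernel_op b g) v = 0" if "v \<notin> V" for k v
        using Tk[OF B2(1)[OF g], of k] that ell2_funs_on by (fastforce simp: funs_on_def)
      then show ?thesis by (auto simp: funs_on_def R_def)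
    qed
    ultimately show "R g \<in> ell2 V" "L2 V (R g) \<le> (C * sqrt (L2 V g))\<^sup>2"
      using ell2I[of "R g" V] by blast+
  qed
  have "bounded_operator V R"
    unfolding bounded_operator_def
  proof (intro conjI ballI allI exI[of _ C])
    fix f g :: "'v \<Rightarrow> complex" and c
    assume f: "f \<in> ell2 V"
    show "R f \<in> ell2 V" by (rule RN(1)[OF f])
    show "R (\<lambda>v. c * f v) = (\<lambda>v. c * R f v)"
      unfolding R_def kernel_op_linear Tlin using suminf_mult[OF summ[OF B2(1)[OF f]]]
      by (simp add: mult.left_commute)
    show "ell2_norm V (R f) \<le> C * ell2_norm V f"
      unfolding ell2_norm_eq using RN(2)[OF f] C by (simp add: real_le_lsqrt)
    assume g: "g \<in> ell2 V"
    show "R (\<lambda>v. f v + g v) = (\<lambda>v. R f v + R g v)"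
      unfolding R_def kernel_op_linear Tlin
      by (simp add: suminf_add[OF summ[OF B2(1)[OF f]] summ[OF B2(1)[OF g]], symmetric] add_divide_distrib)
  qed
  then show ?thesis using RB BR by blast
qed

text \<open>The norm bound of the resolvent, applied to the image of \<open>f\<close> under the
  shifted kernel and read backwards, is the lower bound.\<close>

lemma resolvent_bounded_below:
  assumes a: "hermitian_kernel V K a" and A: "\<And>f. f \<in> ell2 V \<Longrightarrow> A f = kernel_op a f"
    and ns: "complex_of_real \<mu> \<notin> ell2_spectrum V A"
  shows "\<exists>\<epsilon>>0. bounded_below V (shift_kernel V a \<mu>) \<epsilon>"
proof -
  obtain R C where R: "\<And>f. f \<in> ell2 V \<Longrightarrow> R (\<lambda>v. A f v - of_real \<mu> * f v) = f"
    and C: "\<And>f. f \<in> ell2 V \<Longrightarrow> ell2_norm V (R f) \<le> C * ell2_norm V f"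
    using ns unfolding ell2_spectrum_def bounded_operator_def by blast
  \<comment> \<open>\<open>C\<close> is not known to be positive; \<open>D\<close> is a larger bound
    that may be divided by.\<close>
  define D where "D = \<bar>C\<bar> + 1"
  have "bounded_below V (shift_kernel V a \<mu>) (1 / D\<^sup>2)"
    unfolding bounded_below_def
  proof
    fix f assume f: "f \<in> finsupp V"
    let ?g = "kernel_op (shift_kernel V a \<mu>) f"
    have g: "?g \<in> finsupp V" by (rule finsupp_kernel_op[OF hermitian_kernel_shift[OF a] f])
    have "R ?g = f"
      using R[OF finsupp_ell2(1)[OF f]] kernel_op_shift[OF a finsuppD(2)[OF f], of \<mu>]
        A[OF finsupp_ell2(1)[OF f]] by simp
    then have "sqrt (nsq f) \<le> C * sqrt (nsq ?g)"
      using C[OF finsupp_ell2(1)[OF g]] by (simp add: ell2_norm_eq finsupp_ell2(2) f g)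
    also have "\<dots> \<le> D * sqrt (nsq ?g)" by (intro mult_right_mono) (auto simp: D_def)
    finally have "(sqrt (nsq f))\<^sup>2 \<le> (D * sqrt (nsq ?g))\<^sup>2" by (intro power_mono) auto
    then have "nsq f \<le> D\<^sup>2 * nsq ?g" by (simp add: power_mult_distrib)
    moreover have "D > 0" by (simp add: D_def)
    ultimately show "1 / D\<^sup>2 * nsq f \<le> nsq ?g" by (simp add: field_simps)
  qed
  moreover have "1 / D\<^sup>2 > 0" by (simp add: D_def add_nonneg_pos)
  ultimately show ?thesis by blast
qed

lemma bounded_below_resolvent:
  assumes a: "hermitian_kernel V K a" and A: "\<And>f. f \<in> ell2 V \<Longrightarrow> A f = kernel_op a f"
    and "\<epsilon> > 0" "bounded_below V (shift_kernel V a \<mu>) \<epsilon>"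
  shows "complex_of_real \<mu> \<notin> ell2_spectrum V A"
proof -
  have h: "hermitian_kernel V (K + \<bar>\<mu>\<bar>) (shift_kernel V a \<mu>)" by (rule hermitian_kernel_shift[OF a])
  obtain R where R: "bounded_operator V R"
    "\<And>f. f \<in> ell2 V \<Longrightarrow> R (kernel_op (shift_kernel V a \<mu>) f) = f"
    "\<And>f. f \<in> ell2 V \<Longrightarrow> kernel_op (shift_kernel V a \<mu>) (R f) = f"
    using bounded_below_invertible[OF hermitian_kernel_mono[OF h] _ assms(3,4), of "K + \<bar>\<mu>\<bar> + 1"]
      hermitian_kernel_nonneg[OF a] by force
  have RE: "R f \<in> ell2 V" if "f \<in> ell2 V" for f using R(1) that by (auto simp: bounded_operator_def)
  have "R (\<lambda>v. A f v - of_real \<mu> * f v) = f \<and> (\<lambda>v. A (R f) v - of_real \<mu> * R f v) = f"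
    if f: "f \<in> ell2 V" for f
    using R(2,3)[OF f] kernel_op_shift[OF a ell2_funs_on[OF f], of \<mu>] A[OF f]
      kernel_op_shift[OF a ell2_funs_on[OF RE[OF f]], of \<mu>] A[OF RE[OF f]] by simp
  then show ?thesis using R(1) by (auto simp: ell2_spectrum_def)
qed

text \<open>From here on a gap is a statement about finitely supported functions at each interior
  point; resolvents no longer appear.\<close>

lemma in_spectral_gap_iff_bounded_below:
  assumes a: "hermitian_kernel V K a" and A: "\<And>f. f \<in> ell2 V \<Longrightarrow> A f = kernel_op a f"
  shows "in_spectral_gap V A lam1 lam2 \<longleftrightarrow>
    (\<forall>\<mu>. lam1 < \<mu> \<and> \<mu> < lam2 \<longrightarrow> (\<exists>\<epsilon>>0. bounded_below V (shift_kernel V a \<mu>) \<epsilon>))"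
proof -
  have "complex_of_real \<mu> \<notin> ell2_spectrum V A \<longleftrightarrow>
      (\<exists>\<epsilon>>0. bounded_below V (shift_kernel V a \<mu>) \<epsilon>)" for \<mu>
    using resolvent_bounded_below[OF a A, where \<mu> = \<mu>] bounded_below_resolvent[OF a A, where \<mu> = \<mu>]
    by blast
  moreover have "in_spectral_gap V A lam1 lam2 \<longleftrightarrow>
      (\<forall>\<mu>. lam1 < \<mu> \<and> \<mu> < lam2 \<longrightarrow> complex_of_real \<mu> \<notin> ell2_spectrum V A)"
    unfolding in_spectral_gap_def disjoint_iff by (auto simp: image_iff)
  ultimately show ?thesis by simp
qed

section \<open>Exhaustions\<close>

text \<open>Parseval in the eigenbasis expresses both squared norms by the same coefficients, so the
  location of eigenvalues is read off from a comparison of the two sums.\<close>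

lemma spectral_combination:
  assumes a: "hermitian_kernel V K a" and V: "finite V" and sb: "spectral_basis V a u d"
    and f: "f \<in> funs_on V"
  shows "normsq V f = (\<Sum>i<card V. (cmod (inner_on V f (u i)))\<^sup>2)"
    and "normsq V (\<lambda>v. kernel_op a f v - of_real \<mu> * f v)
           = (\<Sum>i<card V. (cmod (inner_on V f (u i)))\<^sup>2 * (d i - \<mu>)\<^sup>2)"
proof -
  note P = parseval_on[OF spectral_basisD(1)[OF sb] V finite_lessThan _ _ spectral_basisD(2)[OF sb]]
  show "normsq V f = (\<Sum>i<card V. (cmod (inner_on V f (u i)))\<^sup>2)"
    using f by (intro P) auto
  define g where "g = (\<lambda>v. kernel_op a f v - of_real \<mu> * f v)"
  have "g \<in> funs_on V"
    using f kernel_op_in_funs_on[OF a, of f] by (simp add: g_def funs_on_def)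
  then have "normsq V g = (\<Sum>i<card V. (cmod (inner_on V g (u i)))\<^sup>2)"
    by (intro P) auto
  also have "\<dots> = (\<Sum>i<card V. (cmod (inner_on V f (u i)))\<^sup>2 * (d i - \<mu>)\<^sup>2)"
  proof (intro sum.cong refl)
    fix i assume "i \<in> {..<card V}"
    then have "inner_on V g (u i) = of_real (d i - \<mu>) * inner_on V f (u i)"
      using spectral_basis_eigen_coeff[OF a V sb _ f]
      by (simp add: g_def inner_on_diff_left inner_on_scale_left algebra_simps)
    then show "(cmod (inner_on V g (u i)))\<^sup>2 = (cmod (inner_on V f (u i)))\<^sup>2 * (d i - \<mu>)\<^sup>2"
      by (simp add: norm_mult power_mult_distrib mult.commute del: of_real_diff)
  qed
  finally show "normsq V (\<lambda>v. kernel_op a f v - of_real \<mu> * f v)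
      = (\<Sum>i<card V. (cmod (inner_on V f (u i)))\<^sup>2 * (d i - \<mu>)\<^sup>2)"
    by (simp add: g_def)
qed

text \<open>Greedy choice: pick one index, discard the at most \<open>M\<close> indices whose sets
  meet its own, and recurse. Nonemptiness makes the picked index discard itself, so the recursion
  shrinks.\<close>

lemma ex_pairwise_disjoint_subset:
  fixes B :: "'i \<Rightarrow> 'v set"
  assumes "finite G" and deg: "\<And>g. g \<in> G \<Longrightarrow> card {h\<in>G. B g \<inter> B h \<noteq> {}} \<le> M"
    and ne: "\<And>g. g \<in> G \<Longrightarrow> B g \<noteq> {}"
  shows "\<exists>D\<subseteq>G. (\<forall>g\<in>D. \<forall>h\<in>D. g \<noteq> h \<longrightarrow> B g \<inter> B h = {}) \<and> card G \<le> M * card D"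
  using assms
proof (induction "card G" arbitrary: G rule: less_induct)
  case less
  show ?case
  proof (cases "G = {}")
    case False
    then obtain g where g: "g \<in> G" by blast
    define N where "N = {h\<in>G. B g \<inter> B h \<noteq> {}}"
    have gN: "g \<in> N" using g less.prems(3) by (auto simp: N_def)
    have fin: "finite N" "finite (G - N)" using less.prems(1) by (auto simp: N_def)
    have "card (G - N) < card G"
      using less.prems(1) g gN by (intro psubset_card_mono) auto
    moreover have "card {h\<in>G - N. B x \<inter> B h \<noteq> {}} \<le> M" if "x \<in> G - N" for x
    proof -
      have "card {h\<in>G - N. B x \<inter> B h \<noteq> {}} \<le> card {h\<in>G. B x \<inter> B h \<noteq> {}}"
        using less.prems(1) by (intro card_mono) auto
      then show ?thesis using less.prems(2)[of x] that by simp
    qed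
    ultimately obtain D where D: "D \<subseteq> G - N" "\<forall>g\<in>D. \<forall>h\<in>D. g \<noteq> h \<longrightarrow> B g \<inter> B h = {}"
      "card (G - N) \<le> M * card D"
      using less.hyps[of "G - N", OF _ fin(2)] less.prems(3) by blast
    have Dg: "finite D" "g \<notin> D" using D(1) gN fin(2) finite_subset by blast+
    have "card G = card N + card (G - N)"
    proof -
      have "N \<subseteq> G" by (auto simp: N_def)
      then show ?thesis
        using card_Diff_subset[OF fin(1), of G] card_mono[OF less.prems(1), of N] by simp
    qed
    also have "\<dots> \<le> M * card (insert g D)"
      using D(3) less.prems(2)[OF g] Dg by (simp add: N_def)
    finally have "card G \<le> M * card (insert g D)" .
    moreover have "\<forall>x\<in>insert g D. \<forall>h\<in>insert g D. x \<noteq> h \<longrightarrow> B x \<inter> B h = {}"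
    proof (intro ballI impI)
      fix x h assume xh: "x \<in> insert g D" "h \<in> insert g D" "x \<noteq> h"
      have gd: "B g \<inter> B y = {}" if "y \<in> D" for y using that D(1) by (auto simp: N_def)
      consider "x = g" "h \<in> D" | "h = g" "x \<in> D" | "x \<in> D" "h \<in> D" using xh by blast
      then show "B x \<inter> B h = {}"
      proof cases
        case 2
        then show ?thesis using gd[of x] by (simp add: Int_commute)
      qed (use gd D(2) xh(3) in simp_all)
    qed
    moreover have "insert g D \<subseteq> G" using D(1) g by blast
    ultimately show ?thesis by blast
  qed simp
qed

text \<open>The bare data needed for the main argument. \<open>A m\<close> is the restricted operator, with either
  boundary condition; its rows can differ from those of \<open>a\<close> only at vertices from which some
  element of \<open>H0\<close> leads out of \<open>\<Lambda> m\<close>. \<open>U m\<close> and \<open>D m\<close> are an orthonormal eigenbasis of \<open>A m\<close> and its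
  eigenvalues, and \<open>c m v w z\<close> is the integral coefficient of the root of unity \<open>z\<close> in \<open>A m v w\<close>.\<close>

locale exhausted_kernel = group_action \<Gamma> V \<phi>
  for \<Gamma> :: "('g, 'r) monoid_scheme" (structure) and V :: "'v set" and \<phi> :: "'g \<Rightarrow> 'v \<Rightarrow> 'v" +
  fixes FV :: "'v set" and a :: "'v \<Rightarrow> 'v \<Rightarrow> complex" and K :: real
    and \<Lambda> :: "nat \<Rightarrow> 'g set" and A :: "nat \<Rightarrow> 'v \<Rightarrow> 'v \<Rightarrow> complex"
    and H0 :: "'g set" and U :: "nat \<Rightarrow> nat \<Rightarrow> 'v \<Rightarrow> complex" and D :: "nat \<Rightarrow> nat \<Rightarrow> real"
    and n :: nat and c :: "nat \<Rightarrow> 'v \<Rightarrow> 'v \<Rightarrow> complex \<Rightarrow> int"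
  assumes ker: "hermitian_kernel V K a"
    and free: "\<And>\<gamma> v. \<gamma> \<in> carrier \<Gamma> \<Longrightarrow> v \<in> V \<Longrightarrow> \<phi> \<gamma> v = v \<Longrightarrow> \<gamma> = \<one>"
    and FV: "finite FV" "FV \<subseteq> V"
    and cover: "\<And>v. v \<in> V \<Longrightarrow> \<exists>\<gamma>\<in>carrier \<Gamma>. \<exists>x\<in>FV. v = \<phi> \<gamma> x"
    and FV_unique: "\<And>\<gamma> x y. \<gamma> \<in> carrier \<Gamma> \<Longrightarrow> x \<in> FV \<Longrightarrow> y \<in> FV \<Longrightarrow> \<phi> \<gamma> x = y \<Longrightarrow> x = y"
    and covariant: "\<And>\<gamma>. \<gamma> \<in> carrier \<Gamma> \<Longrightarrow> \<exists>s. (\<forall>v\<in>V. cmod (s v) = 1) \<and>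
          (\<forall>v\<in>V. \<forall>w\<in>V. a (\<phi> \<gamma> v) (\<phi> \<gamma> w) = s v * cnj (s w) * a v w)"
    and Lam: "\<And>m. finite (\<Lambda> m)" "\<And>m. \<Lambda> m \<noteq> {}" "\<And>m. \<Lambda> m \<subseteq> carrier \<Gamma>"
    and folner: "\<And>H. finite H \<Longrightarrow> H \<subseteq> carrier \<Gamma> \<Longrightarrow>
          (\<lambda>m. real (card {\<gamma>\<in>\<Lambda> m. \<exists>\<eta>\<in>H. \<gamma> \<otimes> \<eta> \<notin> \<Lambda> m}) / real (card (\<Lambda> m))) \<longlonglongrightarrow> 0"
    and kerA: "\<And>m. hermitian_kernel (\<Union>\<gamma>\<in>\<Lambda> m. \<phi> \<gamma> ` FV) K (A m)"
    and H0: "finite H0" "H0 \<subseteq> carrier \<Gamma>"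
    and agree: "\<And>m \<gamma> x w. \<gamma> \<in> \<Lambda> m \<Longrightarrow> (\<And>\<eta>. \<eta> \<in> H0 \<Longrightarrow> \<gamma> \<otimes> \<eta> \<in> \<Lambda> m) \<Longrightarrow> x \<in> FV \<Longrightarrow>
          A m (\<phi> \<gamma> x) w = a (\<phi> \<gamma> x) w"
    and basis: "\<And>m. spectral_basis (\<Union>\<gamma>\<in>\<Lambda> m. \<phi> \<gamma> ` FV) (A m) (U m) (D m)"
    and n: "0 < n"
    and rational: "\<And>m v w. A m v w = (\<Sum>z | z ^ n = 1. of_int (c m v w z) * z)"
    and c_sym: "\<And>m v w z. z ^ n = 1 \<Longrightarrow> c m w v (inverse z) = c m v w z"
    and c_le: "\<And>m v. (\<Sum>w\<in>(\<Union>\<gamma>\<in>\<Lambda> m. \<phi> \<gamma> ` FV). \<Sum>z | z ^ n = 1. \<bar>of_int (c m v w z)\<bar>) \<le> K"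
begin

section \<open>Vertex coordinates, bad rows and translations\<close>

sublocale group \<Gamma>
  using group_hom by (simp add: group_hom_def)

definition W :: "nat \<Rightarrow> 'v set" where "W m = (\<Union>\<gamma>\<in>\<Lambda> m. \<phi> \<gamma> ` FV)"

definition bad :: "nat \<Rightarrow> 'v set" where "bad m = {v \<in> W m. \<exists>w. A m v w \<noteq> a v w}"

definition E :: "nat \<Rightarrow> real \<Rightarrow> nat" where "E m r = card {i. i < card (W m) \<and> D m i \<le> r}"

lemmas kerA' = kerA[folded W_def]
lemmas basis' = basis[folded W_def]

lemma act_closed: "\<gamma> \<in> carrier \<Gamma> \<Longrightarrow> v \<in> V \<Longrightarrow> \<phi> \<gamma> v \<in> V"
  using element_image by blast

lemma act_inv: "\<gamma> \<in> carrier \<Gamma> \<Longrightarrow> v \<in> V \<Longrightarrow> \<phi> (inv \<gamma>) (\<phi> \<gamma> v) = v"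
  using orbit_sym_aux by blast

lemma act_inv': "\<gamma> \<in> carrier \<Gamma> \<Longrightarrow> v \<in> V \<Longrightarrow> \<phi> \<gamma> (\<phi> (inv \<gamma>) v) = v"
  using act_inv[of "inv \<gamma>" v] by simp

text \<open>Freeness together with the uniqueness of orbit representatives gives every vertex unique
  coordinates in the group and the fundamental domain.\<close>

lemma act_eq_iff:
  assumes "\<gamma> \<in> carrier \<Gamma>" "\<eta> \<in> carrier \<Gamma>" "x \<in> FV" "y \<in> FV" "\<phi> \<gamma> x = \<phi> \<eta> y"
  shows "\<gamma> = \<eta>" "x = y"
proof -
  have V: "x \<in> V" "y \<in> V" using assms FV by auto
  have "\<phi> (inv \<eta> \<otimes> \<gamma>) x = \<phi> (inv \<eta>) (\<phi> \<eta> y)"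
    using assms V by (simp add: composition_rule)
  also have "\<dots> = y" using assms V by (simp add: act_inv)
  finally have e: "\<phi> (inv \<eta> \<otimes> \<gamma>) x = y" .
  then show xy: "x = y" using FV_unique[of "inv \<eta> \<otimes> \<gamma>" x y] assms by simp
  then have "inv \<eta> \<otimes> \<gamma> = \<one>" using free[of "inv \<eta> \<otimes> \<gamma>" x] e V assms by simp
  then show "\<gamma> = \<eta>" using assms by (metis inv_equality inv_inv inv_closed)
qed

lemma W_finite: "finite (W m)"
  using Lam FV by (auto simp: W_def)

lemma W_subset: "W m \<subseteq> V"
  unfolding W_def using Lam(3) FV(2) act_closed by blast

lemma card_W_le: "card (W m) \<le> card FV * card (\<Lambda> m)"
proof -
  have "card (W m) \<le> (\<Sum>\<gamma>\<in>\<Lambda> m. card (\<phi> \<gamma> ` FV))"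
    unfolding W_def using Lam by (intro card_UN_le) auto
  also have "\<dots> \<le> (\<Sum>\<gamma>\<in>\<Lambda> m. card FV)" using FV by (intro sum_mono card_image_le) auto
  finally show ?thesis by (simp add: mult.commute)
qed

lemma card_Lam_pos: "0 < card (\<Lambda> m)"
  using Lam by (simp add: card_gt_0_iff)

lemma bad_subset: "bad m \<subseteq> (\<Union>\<gamma>\<in>{\<gamma>\<in>\<Lambda> m. \<exists>\<eta>\<in>H0. \<gamma> \<otimes> \<eta> \<notin> \<Lambda> m}. \<phi> \<gamma> ` FV)"
proof
  fix v assume "v \<in> bad m"
  then obtain \<gamma> x w where v: "\<gamma> \<in> \<Lambda> m" "x \<in> FV" "v = \<phi> \<gamma> x" "A m v w \<noteq> a v w"
    by (auto simp: bad_def W_def)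
  then have "\<exists>\<eta>\<in>H0. \<gamma> \<otimes> \<eta> \<notin> \<Lambda> m" using agree[of \<gamma> m x w] by blast
  then show "v \<in> (\<Union>\<gamma>\<in>{\<gamma>\<in>\<Lambda> m. \<exists>\<eta>\<in>H0. \<gamma> \<otimes> \<eta> \<notin> \<Lambda> m}. \<phi> \<gamma> ` FV)" using v by blast
qed

lemma bad_finite: "finite (bad m)"
  by (rule finite_subset[OF _ W_finite[of m]]) (auto simp: bad_def)

lemma bad_ratio: "(\<lambda>m. real (card (bad m)) / real (card (\<Lambda> m))) \<longlonglongrightarrow> 0"
proof (rule tendsto_sandwich[of "\<lambda>_. 0"])
  let ?B = "\<lambda>m. {\<gamma>\<in>\<Lambda> m. \<exists>\<eta>\<in>H0. \<gamma> \<otimes> \<eta> \<notin> \<Lambda> m}"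
  show "(\<lambda>m. real (card FV) * (real (card (?B m)) / real (card (\<Lambda> m)))) \<longlonglongrightarrow> 0"
    using tendsto_mult_left[OF folner[OF H0], of "real (card FV)"] by simp
  have "card (bad m) \<le> card FV * card (?B m)" for m
  proof -
    have "card (bad m) \<le> card (\<Union>\<gamma>\<in>?B m. \<phi> \<gamma> ` FV)"
      using bad_subset Lam(1)[of m] FV by (intro card_mono) auto
    also have "\<dots> \<le> (\<Sum>\<gamma>\<in>?B m. card (\<phi> \<gamma> ` FV))"
      using Lam(1)[of m] by (intro card_UN_le) auto
    also have "\<dots> \<le> (\<Sum>\<gamma>\<in>?B m. card FV)" using FV by (intro sum_mono card_image_le) auto
    finally show ?thesis by (simp add: mult.commute)
  qed
  then have "real (card (bad m)) \<le> real (card FV) * real (card (?B m))" for m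
    by (simp flip: of_nat_mult)
  then show "\<forall>\<^sub>F m in sequentially. real (card (bad m)) / real (card (\<Lambda> m))
      \<le> real (card FV) * (real (card (?B m)) / real (card (\<Lambda> m)))"
    using card_Lam_pos by (simp add: divide_right_mono)
qed auto

lemma eventually_bad_less: "0 < \<eta> \<Longrightarrow> \<forall>\<^sub>F m in sequentially. real (card (bad m)) < \<eta> * real (card (\<Lambda> m))"
  using order_tendstoD(2)[OF bad_ratio, of \<eta>] card_Lam_pos
  by (simp add: field_simps)

text \<open>\<open>bad\<close> is defined by rows. Hermitian symmetry turns agreement of the other
  rows into agreement of the other columns, so a function vanishing on \<open>bad m\<close> is
  treated alike at every vertex, also at bad ones and outside \<open>W m\<close>.\<close>

lemma op_agree:
  assumes f: "f \<in> funs_on (W m)" and z: "\<And>v. v \<in> bad m \<Longrightarrow> f v = 0"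
  shows "kernel_op (A m) f = kernel_op a f"
proof
  fix v
  have fz: "w \<in> W m - bad m" if "f w \<noteq> 0" for w using f z that by (auto simp: funs_on_def)
  have "kernel_op (A m) f v = (\<Sum>w\<in>W m - bad m. A m v w * f w)"
    using W_finite hermitian_kernelD(3)[OF kerA'] fz by (intro kernel_op_eq_sum) auto
  also have "\<dots> = (\<Sum>w\<in>W m - bad m. a v w * f w)"
  proof (intro sum.cong refl)
    fix w assume "w \<in> W m - bad m"
    then have "A m w v = a w v" by (auto simp: bad_def)
    then show "A m v w * f w = a v w * f w"
      using hermitian_kernelD(4)[OF kerA', of m v w] hermitian_kernelD(4)[OF ker, of v w] by simp
  qed
  also have "\<dots> = kernel_op a f v"
    using W_finite hermitian_kernelD(3)[OF ker] fz by (intro kernel_op_eq_sum[symmetric]) auto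
  finally show "kernel_op (A m) f v = kernel_op a f v" .
qed

text \<open>A good row of the full kernel coincides with a restricted row and is therefore supported
  in \<open>W m\<close>; cutting off the function outside \<open>W m\<close> does not change the
  value there.\<close>

lemma good_row:
  assumes "v \<in> W m - bad m"
  shows "kernel_op (A m) (\<lambda>w. if w \<in> W m then f w else 0) v = kernel_op a f v"
proof -
  have e: "A m v w = a v w" for w using assms by (auto simp: bad_def)
  have "kernel_op (A m) (\<lambda>w. if w \<in> W m then f w else 0) v
      = (\<Sum>w | A m v w \<noteq> 0. A m v w * (if w \<in> W m then f w else 0))" by (simp add: kernel_op_def)
  also have "\<dots> = (\<Sum>w | A m v w \<noteq> 0. A m v w * f w)"
    using hermitian_kernelD(2)[OF kerA'] by (intro sum.cong) auto
  finally show ?thesis by (simp add: e kernel_op_def)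
qed

text \<open>Weak invariance makes the kernel covariant only up to phases, so plain translation need
  not commute with it. Multiplying the translate by the phase function \<open>s\<close> repairs
  this. Only moduli are recorded, since later arguments use only norms and the vanishing of
  residuals.\<close>

lemma magnetic_translation:
  assumes g: "\<gamma> \<in> carrier \<Gamma>" and f: "f \<in> funs_on V"
  obtains h where "h \<in> funs_on V" "\<And>v. v \<in> V \<Longrightarrow> cmod (h (\<phi> \<gamma> v)) = cmod (f v)"
    "\<And>v \<mu>. v \<in> V \<Longrightarrow> cmod (kernel_op a h (\<phi> \<gamma> v) - of_real \<mu> * h (\<phi> \<gamma> v))
        = cmod (kernel_op a f v - of_real \<mu> * f v)"
proof -
  obtain s where s: "\<And>v. v \<in> V \<Longrightarrow> cmod (s v) = 1"
    and cov: "\<And>v w. v \<in> V \<Longrightarrow> w \<in> V \<Longrightarrow> a (\<phi> \<gamma> v) (\<phi> \<gamma> w) = s v * cnj (s w) * a v w"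
    using covariant[OF g] by blast
  define h where "h v = (if v \<in> V then s (\<phi> (inv \<gamma>) v) * f (\<phi> (inv \<gamma>) v) else 0)" for v
  have hv: "h (\<phi> \<gamma> v) = s v * f v" if "v \<in> V" for v
    using that g by (simp add: h_def act_closed act_inv)
  have op: "kernel_op a h (\<phi> \<gamma> v) = s v * kernel_op a f v" if v: "v \<in> V" for v
  proof -
    have nz: "a (\<phi> \<gamma> v) (\<phi> \<gamma> w) \<noteq> 0 \<longleftrightarrow> a v w \<noteq> 0" if "w \<in> V" for w
      using cov[OF v that] s[OF v] s[OF that] by (metis complex_cnj_zero_iff mult_eq_0_iff norm_zero zero_neq_one)
    have "bij_betw (\<phi> \<gamma>) {w. a v w \<noteq> 0} {w. a (\<phi> \<gamma> v) w \<noteq> 0}"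
    proof (rule bij_betwI[where g = "\<phi> (inv \<gamma>)"])
      show "\<phi> \<gamma> \<in> {w. a v w \<noteq> 0} \<rightarrow> {w. a (\<phi> \<gamma> v) w \<noteq> 0}"
        using nz hermitian_kernelD(2)[OF ker] by auto
      show "\<phi> (inv \<gamma>) \<in> {w. a (\<phi> \<gamma> v) w \<noteq> 0} \<rightarrow> {w. a v w \<noteq> 0}"
      proof safe
        fix w assume w: "a (\<phi> \<gamma> v) w \<noteq> 0" "a v (\<phi> (inv \<gamma>) w) = 0"
        then have "w \<in> V" using hermitian_kernelD(2)[OF ker] by blast
        then show False using nz[of "\<phi> (inv \<gamma>) w"] w g by (simp add: act_closed act_inv')
      qed
    qed (use hermitian_kernelD(2)[OF ker] g in \<open>auto simp: act_inv act_inv'\<close>)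
    then have "kernel_op a h (\<phi> \<gamma> v) = (\<Sum>w | a v w \<noteq> 0. a (\<phi> \<gamma> v) (\<phi> \<gamma> w) * h (\<phi> \<gamma> w))"
      unfolding kernel_op_def by (rule sum.reindex_bij_betw[symmetric])
    also have "\<dots> = (\<Sum>w | a v w \<noteq> 0. s v * (a v w * f w))"
    proof (intro sum.cong refl)
      fix w assume "w \<in> {w. a v w \<noteq> 0}"
      then have w: "w \<in> V" using hermitian_kernelD(2)[OF ker] by blast
      have "a (\<phi> \<gamma> v) (\<phi> \<gamma> w) * h (\<phi> \<gamma> w) = (s w * cnj (s w)) * (s v * (a v w * f w))"
        by (simp only: cov[OF v w] hv[OF w] mult_ac)
      moreover have "s w * cnj (s w) = 1" using s[OF w] complex_norm_square[of "s w"] by simp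
      ultimately show "a (\<phi> \<gamma> v) (\<phi> \<gamma> w) * h (\<phi> \<gamma> w) = s v * (a v w * f w)" by simp
    qed
    finally show ?thesis by (simp add: kernel_op_def sum_distrib_left)
  qed
  show ?thesis
  proof (rule that[of h])
    show "h \<in> funs_on V" by (simp add: funs_on_def h_def)
    show "cmod (h (\<phi> \<gamma> v)) = cmod (f v)" if "v \<in> V" for v
      using that s by (simp add: hv norm_mult)
    show "cmod (kernel_op a h (\<phi> \<gamma> v) - of_real \<mu> * h (\<phi> \<gamma> v))
        = cmod (kernel_op a f v - of_real \<mu> * f v)" if "v \<in> V" for v \<mu>
    proof -
      have "kernel_op a h (\<phi> \<gamma> v) - of_real \<mu> * h (\<phi> \<gamma> v) = s v * (kernel_op a f v - of_real \<mu> * f v)"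
        using that by (simp add: hv op algebra_simps)
      then show ?thesis using s[OF that] by (simp add: norm_mult)
    qed
  qed
qed

lemma normsq_image:
  assumes "\<gamma> \<in> carrier \<Gamma>" "G \<subseteq> V" "\<And>v. v \<in> V \<Longrightarrow> cmod (h (\<phi> \<gamma> v)) = cmod (f v)"
  shows "normsq (\<phi> \<gamma> ` G) h = normsq G f"
  unfolding normsq_def
  using inj_on_subset[OF inj_prop[OF assms(1)] assms(2)] assms(2,3)
  by (subst sum.reindex) (auto intro!: sum.cong)

text \<open>With more eigenvectors than bad vertices, a nonzero combination vanishes on
  \<open>bad m\<close>, and on it \<open>A m\<close> may be replaced by the full kernel. Its
  eigenvalues deviate from the midpoint by at most \<open>r - e\<close>, which contradicts the lower
  bound \<open>r\<close> given by the gap.\<close>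

lemma interior_count_le_bad:
  assumes bb: "bounded_below V (shift_kernel V a ((lam1 + lam2) / 2)) (((lam2 - lam1) / 2)\<^sup>2)"
    and e: "0 < e" and lt: "lam1 < lam2"
  shows "card {i. i < card (W m) \<and> lam1 + e \<le> D m i \<and> D m i \<le> lam2 - e} \<le> card (bad m)"
proof (rule ccontr)
  define I where "I = {i. i < card (W m) \<and> lam1 + e \<le> D m i \<and> D m i \<le> lam2 - e}"
  define mid where "mid = (lam1 + lam2) / 2"
  define r where "r = (lam2 - lam1) / 2"
  assume "\<not> ?thesis"
  then have "card (bad m) < card I" by (simp add: I_def)
  moreover have I: "finite I" "I \<subseteq> {..<card (W m)}" by (auto simp: I_def)
  ultimately obtain x where x: "\<exists>j\<in>I. x j \<noteq> 0" "\<forall>v\<in>bad m. (\<Sum>j\<in>I. U m j v * x j) = 0"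
    using homogeneous_system_nontrivial[OF bad_finite, of I m "\<lambda>v j. U m j v"] by blast
  define f where "f = (\<lambda>v. \<Sum>j\<in>I. x j * U m j v)"
  have on: "orthonormal_on (W m) I (U m)"
    by (rule orthonormal_on_subset[OF spectral_basisD(1)[OF basis'] I(2)])
  have fW: "f \<in> funs_on (W m)"
    using spectral_basisD(2)[OF basis'] I by (auto simp: f_def funs_on_def intro!: sum.neutral)
  have f0: "f v = 0" if "v \<in> bad m" for v using x(2) that by (simp add: f_def mult.commute)
  have nf: "normsq (W m) f = (\<Sum>j\<in>I. (cmod (x j))\<^sup>2)"
    unfolding f_def by (rule orthonormal_normsq_sum[OF on I(1)])
  have "0 < normsq (W m) f"
  proof -
    obtain j where "j \<in> I" "x j \<noteq> 0" using x(1) by blast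
    then have "0 < (cmod (x j))\<^sup>2" "(cmod (x j))\<^sup>2 \<le> normsq (W m) f"
      unfolding nf using I(1) by (auto intro!: member_le_sum[of _ _ "\<lambda>j. (cmod (x j))\<^sup>2"])
    then show ?thesis by linarith
  qed
  have fV: "f \<in> funs_on V" using funs_on_mono[OF W_subset fW] .
  have ff: "f \<in> finsupp V"
    using fV finite_subset[OF _ W_finite[of m], of "{v. f v \<noteq> 0}"] fW by (auto simp: finsupp_def funs_on_def)
  define g where "g = (\<lambda>v. \<Sum>j\<in>I. (of_real (D m j - mid) * x j) * U m j v)"
  have "kernel_op (shift_kernel V a mid) f = (\<lambda>v. kernel_op (A m) f v - of_real mid * f v)"
    using kernel_op_shift[OF ker fV] op_agree[OF fW f0] by simp
  also have "\<dots> = g"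
    unfolding f_def g_def kernel_op_sum sum_distrib_left sum_subtractf[symmetric]
    using spectral_basisD(3)[OF basis'] I by (intro ext sum.cong) (auto simp: algebra_simps)
  finally have opg: "kernel_op (shift_kernel V a mid) f = g" .
  have gW: "g \<in> funs_on (W m)"
    using spectral_basisD(2)[OF basis'] I by (auto simp: g_def funs_on_def intro!: sum.neutral)
  have "r\<^sup>2 * normsq (W m) f \<le> normsq (W m) g"
    using bb ff nsq_eq[OF W_finite fW] nsq_eq[OF W_finite gW] opg
    by (auto simp: bounded_below_def mid_def r_def)
  also have "normsq (W m) g = (\<Sum>j\<in>I. (cmod (of_real (D m j - mid) * x j))\<^sup>2)"
    unfolding g_def by (rule orthonormal_normsq_sum[OF on I(1)])
  also have "\<dots> = (\<Sum>j\<in>I. (D m j - mid)\<^sup>2 * (cmod (x j))\<^sup>2)"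
    by (simp add: norm_mult power_mult_distrib del: of_real_diff)
  also have "\<dots> \<le> (\<Sum>j\<in>I. (r - e)\<^sup>2 * (cmod (x j))\<^sup>2)"
  proof (intro sum_mono mult_right_mono)
    fix j assume "j \<in> I"
    then have "\<bar>D m j - mid\<bar> \<le> r - e" by (auto simp: I_def mid_def r_def abs_le_iff field_simps)
    then show "(D m j - mid)\<^sup>2 \<le> (r - e)\<^sup>2" by (metis abs_ge_zero power2_abs power_mono)
  qed simp
  also have "\<dots> = (r - e)\<^sup>2 * normsq (W m) f" by (simp add: nf sum_distrib_left)
  finally have "r\<^sup>2 \<le> (r - e)\<^sup>2" using \<open>0 < normsq (W m) f\<close> by simp
  \<comment> \<open>Strictness after squaring needs \<open>e \<le> r\<close>, which holds because
    the index set is nonempty.\<close>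
  moreover have "(r - e)\<^sup>2 < r\<^sup>2"
  proof -
    obtain j where "j \<in> I" using x(1) by blast
    then have "e \<le> r" by (auto simp: I_def r_def field_simps)
    then show ?thesis using e by (intro power_strict_mono) auto
  qed
  ultimately show False by simp
qed

end

section \<open>Dimension counts for subspaces\<close>

definition subspace_on :: "'v set \<Rightarrow> ('v \<Rightarrow> complex) set \<Rightarrow> bool" where
  "subspace_on S Z \<longleftrightarrow> Z \<subseteq> funs_on S \<and>
     (\<forall>f\<in>Z. \<forall>c. (\<lambda>v. c * f v) \<in> Z) \<and> (\<forall>f\<in>Z. \<forall>g\<in>Z. (\<lambda>v. f v + g v) \<in> Z) \<and> (\<lambda>_. 0) \<in> Z"

lemma subspace_onD:
  assumes "subspace_on S Z" "f \<in> Z"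
  shows "f \<in> funs_on S" "(\<lambda>v. c * f v) \<in> Z" "g \<in> Z \<Longrightarrow> (\<lambda>v. f v + g v) \<in> Z"
  using assms unfolding subspace_on_def by blast+

lemma subspace_on_sum:
  assumes "subspace_on S Z" "\<And>j. j \<in> J \<Longrightarrow> u j \<in> Z"
  shows "(\<lambda>v. \<Sum>j\<in>J. c j * u j v) \<in> Z"
  using assms(2)
proof (induction J rule: infinite_finite_induct)
  case (insert j J)
  then show ?case using assms(1) by (simp add: subspace_on_def)
qed (use assms in \<open>auto simp: subspace_on_def\<close>)

text \<open>Gram-Schmidt with the choice left to the caller: a nonzero vector of \<open>Z\<close>
  orthogonal to the earlier ones suffices, and such vectors come from counting equations, so the
  dimension of \<open>Z\<close> itself is never computed.\<close>

lemma orthonormal_family_exists: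
  fixes k :: nat
  assumes S: "finite S" and Z: "subspace_on S Z"
    and ext: "\<And>j w. j < k \<Longrightarrow> (\<And>i. i < j \<Longrightarrow> w i \<in> Z) \<Longrightarrow>
      \<exists>f\<in>Z. (\<exists>v. f v \<noteq> 0) \<and> (\<forall>i<j. inner_on S f (w i) = 0)"
  shows "\<exists>w. orthonormal_on S {..<k} w \<and> (\<forall>i<k. w i \<in> Z)"
proof -
  have "\<exists>w. orthonormal_on S {..<j} w \<and> (\<forall>i<j. w i \<in> Z)" if "j \<le> k" for j
    using that
  proof (induction j)
    case 0
    then show ?case by (simp add: orthonormal_on_def)
  next
    case (Suc j)
    then obtain w where w: "orthonormal_on S {..<j} w" "\<And>i. i < j \<Longrightarrow> w i \<in> Z" by auto
    obtain f v where f: "f \<in> Z" "f v \<noteq> 0" "\<And>i. i < j \<Longrightarrow> inner_on S f (w i) = 0"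
      using ext[of j w] w(2) Suc.prems by auto
    define x where "x = (\<lambda>v. of_real (1 / sqrt (normsq S f)) * f v)"
    have "f \<in> funs_on S" using f(1) Z by (auto simp: subspace_on_def)
    then have on: "orthonormal_on S {..<Suc j} (w(j := x))"
      unfolding x_def using orthonormal_extend[OF w(1) S _ f(2,3)] by blast
    have "x \<in> Z" unfolding x_def by (rule subspace_onD(2)[OF Z f(1)])
    then have "(w(j := x)) i \<in> Z" if "i < Suc j" for i using w(2) that by (auto simp: less_Suc_eq)
    with on show ?case by blast
  qed
  then show ?thesis by blast
qed

text \<open>The diagonal of the projection onto \<open>Z\<close> bounds the mass at each point and sums to \<open>dim Z\<close>.\<close>

lemma subspace_mass_le:
  assumes S: "finite S" and Z: "subspace_on S Z"
    and B: "\<And>k w. orthonormal_on S {..<k::nat} w \<Longrightarrow> (\<And>i. i < k \<Longrightarrow> w i \<in> Z) \<Longrightarrow> k \<le> B"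
    and P: "finite P" "inj_on p P" "p ` P \<subseteq> S"
    and h: "\<And>x. x \<in> P \<Longrightarrow> h x \<in> Z" "\<And>x. x \<in> P \<Longrightarrow> t * normsq S (h x) \<le> (cmod (h x (p x)))\<^sup>2"
      "\<And>x. x \<in> P \<Longrightarrow> 0 < normsq S (h x)"
  shows "t * real (card P) \<le> real B"
proof -
  define Q where "Q k \<longleftrightarrow> (\<exists>w. orthonormal_on S {..<k} w \<and> (\<forall>i<k. w i \<in> Z))" for k :: nat
  \<comment> \<open>The maximal size of an orthonormal family in \<open>Z\<close>, that is, its
    dimension; maximality is what makes the family span \<open>Z\<close> in
    \<open>expand\<close>.\<close>
  define k where "k = Greatest Q"
  have Q0: "Q 0" by (simp add: Q_def orthonormal_on_def)
  have QB: "j \<le> B" if "Q j" for j using that B unfolding Q_def by blast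
  have "Q k" unfolding k_def by (rule GreatestI_nat[where P = Q, OF Q0 QB])
  then obtain w where w: "orthonormal_on S {..<k} w" "\<And>i. i < k \<Longrightarrow> w i \<in> Z"
    unfolding Q_def by blast
  have max: "j \<le> k" if "orthonormal_on S {..<j} w'" "\<And>i. i < j \<Longrightarrow> w' i \<in> Z" for j w'
    unfolding k_def by (rule Greatest_le_nat[where P = Q, OF _ QB]) (use that in \<open>auto simp: Q_def\<close>)
  have ZS: "f \<in> funs_on S" if "f \<in> Z" for f using that Z by (auto simp: subspace_on_def)
  have expand: "f = (\<lambda>v. \<Sum>j<k. inner_on S f (w j) * w j v)" if f: "f \<in> Z" for f
  proof (rule ccontr)
    define g where "g = (\<lambda>v. f v + (-1) * (\<Sum>j<k. inner_on S f (w j) * w j v))"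
    assume "\<not> ?thesis"
    then obtain v where v: "g v \<noteq> 0" by (auto simp: g_def fun_eq_iff)
    have gZ: "g \<in> Z"
    proof -
      have "(\<lambda>v. \<Sum>j<k. inner_on S f (w j) * w j v) \<in> Z" using w(2) by (intro subspace_on_sum[OF Z]) auto
      from subspace_onD(3)[OF Z f subspace_onD(2)[OF Z this, of "-1"]] show ?thesis by (simp add: g_def)
    qed
    have "inner_on S g (w i) = 0" if "i < k" for i
      using orthonormal_inner_sum[OF w(1), of i "\<lambda>j. inner_on S f (w j)"] that inner_on_diff_left[of S f]
      by (simp add: g_def)
    from orthonormal_extend[OF w(1) S ZS[OF gZ] v this]
    have on: "orthonormal_on S {..<Suc k} (w(k := \<lambda>v. of_real (1 / sqrt (normsq S g)) * g v))" .
    have "(\<lambda>v. of_real (1 / sqrt (normsq S g)) * g v) \<in> Z" by (rule subspace_onD(2)[OF Z gZ])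
    then have "Suc k \<le> k" using w(2) by (intro max[OF on]) (auto simp: less_Suc_eq)
    then show False by simp
  qed
  \<comment> \<open>Cauchy-Schwarz in the expansion: the diagonal entry of the projection at
    \<open>p x\<close> dominates the share of the mass of \<open>h x\<close> located there.\<close>
  have pt: "t \<le> (\<Sum>j<k. (cmod (w j (p x)))\<^sup>2)" if x: "x \<in> P" for x
  proof -
    let ?f = "h x"
    have nf: "normsq S ?f = (\<Sum>j<k. (cmod (inner_on S ?f (w j)))\<^sup>2)"
      using orthonormal_normsq_sum[OF w(1), of "\<lambda>j. inner_on S ?f (w j)"] expand[OF h(1)[OF x]] by simp
    have "cmod (?f (p x)) \<le> (\<Sum>j<k. cmod (inner_on S ?f (w j)) * cmod (w j (p x)))"
      by (subst expand[OF h(1)[OF x]]) (auto intro!: sum_norm_le simp: norm_mult)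
    then have "(cmod (?f (p x)))\<^sup>2 \<le> (\<Sum>j<k. cmod (inner_on S ?f (w j)) * cmod (w j (p x)))\<^sup>2"
      by (intro power_mono) auto
    also have "\<dots> \<le> normsq S ?f * (\<Sum>j<k. (cmod (w j (p x)))\<^sup>2)"
      unfolding nf by (rule Cauchy_Schwarz_ineq_sum)
    finally have "t * normsq S ?f \<le> (\<Sum>j<k. (cmod (w j (p x)))\<^sup>2) * normsq S ?f"
      using h(2)[OF x] by (simp add: mult.commute)
    then show ?thesis using h(3)[OF x] by simp
  qed
  have "t * real (card P) = (\<Sum>x\<in>P. t)" by simp
  also have "\<dots> \<le> (\<Sum>x\<in>P. \<Sum>j<k. (cmod (w j (p x)))\<^sup>2)" by (intro sum_mono pt)
  also have "\<dots> = (\<Sum>v\<in>p ` P. \<Sum>j<k. (cmod (w j v))\<^sup>2)" using P(2) by (simp add: sum.reindex)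
  also have "\<dots> \<le> (\<Sum>v\<in>S. \<Sum>j<k. (cmod (w j v))\<^sup>2)"
    using S P(3) by (intro sum_mono2) (auto intro: sum_nonneg)
  also have "\<dots> = (\<Sum>j<k. normsq S (w j))" unfolding normsq_def by (rule sum.swap)
  also have "\<dots> = real k"
    using orthonormal_normsq[OF w(1)] by simp
  also have "\<dots> \<le> real B" using B[OF w] by simp
  finally show ?thesis .
qed

context exhausted_kernel
begin

lemma cover_W: "v \<in> W m \<Longrightarrow> \<exists>\<gamma>\<in>\<Lambda> m. \<exists>x\<in>FV. v = \<phi> \<gamma> x"
  by (auto simp: W_def)

lemma LamD: "\<gamma> \<in> \<Lambda> m \<Longrightarrow> \<gamma> \<in> carrier \<Gamma>"
  using Lam(3) by blast

lemma FVD: "x \<in> FV \<Longrightarrow> x \<in> V"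
  using FV by blast

lemma normsq_translate:
  assumes g: "\<gamma> \<in> carrier \<Gamma>" and G: "G \<subseteq> V"
    and h: "\<And>v. v \<in> V \<Longrightarrow> cmod (h (\<phi> \<gamma> v)) = cmod (f v)"
  shows "normsq G h = normsq (\<phi> (inv \<gamma>) ` G) f"
proof -
  have sub: "\<phi> (inv \<gamma>) ` G \<subseteq> V" using g G act_closed by blast
  have "\<phi> \<gamma> (\<phi> (inv \<gamma>) v) = v" if "v \<in> G" for v using that G g by (auto intro: act_inv')
  then have "\<phi> \<gamma> ` (\<phi> (inv \<gamma>) ` G) = G" by (simp add: image_image)
  then show ?thesis using normsq_image[where h = h and f = f, OF g sub h] by simp
qed

text \<open>Obtained from a concentrated vector in the span of the eigenvectors near \<open>\<nu>\<close>, cut down to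
  vectors vanishing on \<open>bad m\<close>, by translating into the fundamental domain.\<close>

lemma localized_almost_eigenvector:
  assumes e: "0 < e" and eta: "0 < \<eta>"
    and m: "\<eta> * real (card (\<Lambda> m)) < real (card {i. i < card (W m) \<and> \<bar>D m i - \<nu>\<bar> \<le> e})"
    and b: "real (card (bad m)) < \<eta> / 2 * real (card (\<Lambda> m))"
  shows "\<exists>g. g \<in> funs_on V \<and> (\<forall>G. finite G \<longrightarrow> G \<subseteq> V \<longrightarrow> normsq G g \<le> 1) \<and>
    \<eta> / (2 * real (card FV)) \<le> (\<Sum>x\<in>FV. cmod (g x)) \<and>
    (\<forall>v\<in>V. cmod (kernel_op a g v - of_real \<nu> * g v) \<le> e)"
proof -
  define I where "I = {i. i < card (W m) \<and> \<bar>D m i - \<nu>\<bar> \<le> e}"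
  have I: "finite I" "I \<subseteq> {..<card (W m)}" by (auto simp: I_def)
  \<comment> \<open>The span of the eigenvectors with index in \<open>I\<close>, described by
    orthogonality to the others so that closure under combinations is immediate, cut down by
    vanishing on \<open>bad m\<close>.\<close>
  define Z where "Z = {f \<in> funs_on (W m). (\<forall>i<card (W m). i \<notin> I \<longrightarrow> inner_on (W m) f (U m i) = 0)
     \<and> (\<forall>v\<in>bad m. f v = 0)}"
  have Z: "subspace_on (W m) Z"
    by (auto simp: subspace_on_def Z_def funs_on_def inner_on_scale_left)
      (simp_all add: inner_on_def distrib_right sum.distrib)
  define k where "k = card I - card (bad m)"
  have kI: "\<eta> / 2 * real (card (\<Lambda> m)) < real k" and bI: "card (bad m) < card I"
    using m b by (auto simp: k_def I_def[symmetric] of_nat_diff field_simps)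
  have "\<exists>w. orthonormal_on (W m) {..<k} w \<and> (\<forall>i<k. w i \<in> Z)"
  proof (rule orthonormal_family_exists[OF W_finite Z])
    fix j and w :: "nat \<Rightarrow> 'v \<Rightarrow> complex" assume j: "j < k"
    \<comment> \<open>One equation for each bad vertex and one for each vector already chosen,
      together fewer than \<open>card I\<close>.\<close>
    define M where "M s i = (case s of Inl v \<Rightarrow> U m i v | Inr l \<Rightarrow> inner_on (W m) (U m i) (w l))" for s i
    have "card (bad m <+> {..<j}) < card I" using j by (simp add: card_Plus bad_finite k_def)
    then obtain x where x: "\<exists>i\<in>I. x i \<noteq> 0" "\<forall>s\<in>bad m <+> {..<j}. (\<Sum>i\<in>I. M s i * x i) = 0"
      using homogeneous_system_nontrivial[of "bad m <+> {..<j}" I M] I(1) bad_finite by auto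
    define f where "f = (\<lambda>v. \<Sum>i\<in>I. x i * U m i v)"
    have on: "orthonormal_on (W m) I (U m)"
      by (rule orthonormal_on_subset[OF spectral_basisD(1)[OF basis'] I(2)])
    have "f \<in> funs_on (W m)"
      using spectral_basisD(2)[OF basis'] I by (auto simp: f_def funs_on_def intro!: sum.neutral)
    moreover have "inner_on (W m) f (U m i) = 0" if "i < card (W m)" "i \<notin> I" for i
    proof -
      have "inner_on (W m) (U m j) (U m i) = 0" if "j \<in> I" for j
        using spectral_basisD(1)[OF basis', of m] that I(2) \<open>i < card (W m)\<close> \<open>i \<notin> I\<close>
        unfolding orthonormal_on_def by (metis lessThan_iff subsetD)
      then show ?thesis unfolding f_def inner_on_sum_left by (intro sum.neutral) simp
    qed
    moreover have "f v = 0" if "v \<in> bad m" for v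
      using bspec[OF x(2) InlI[OF that]] by (simp add: M_def f_def mult.commute)
    ultimately have "f \<in> Z" by (simp add: Z_def)
    moreover have "inner_on (W m) f (w l) = 0" if "l < j" for l
      using bspec[OF x(2) InrI, of l] that by (simp add: M_def f_def inner_on_sum_left mult.commute)
    moreover have "\<exists>v. f v \<noteq> 0"
    proof (rule ccontr)
      assume "\<not> ?thesis"
      then have "inner_on (W m) f (U m i) = 0" for i by (simp add: inner_on_def)
      then show False using x(1) orthonormal_inner_sum[OF on I(1), of _ x] by (auto simp: f_def)
    qed
    ultimately show "\<exists>f\<in>Z. (\<exists>v. f v \<noteq> 0) \<and> (\<forall>i<j. inner_on (W m) f (w i) = 0)" by blast
  qed
  then obtain w where w: "orthonormal_on (W m) {..<k} w" "\<And>i. i < k \<Longrightarrow> w i \<in> Z" by blast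
  have "0 < \<eta> / 2 * real (card (\<Lambda> m))" using eta card_Lam_pos[of m] by simp
  then have "0 < k" using kI by linarith
  from orthonormal_concentrated_vector[OF w(1) W_finite this]
  obtain v x where v: "v \<in> W m" "normsq (W m) (\<lambda>v. \<Sum>j<k. x j * w j v) \<le> 1"
    "real k / real (card (W m)) \<le> cmod (\<Sum>j<k. x j * w j v)" by blast
  define f where "f = (\<lambda>v. \<Sum>j<k. x j * w j v)"
  have fZ: "f \<in> Z" unfolding f_def using w(2) by (intro subspace_on_sum[OF Z]) auto
  have fn: "normsq (W m) f \<le> 1" using v(2) by (simp add: f_def)
  have fW: "f \<in> funs_on (W m)" and fbad: "\<And>v. v \<in> bad m \<Longrightarrow> f v = 0"
    and fI: "\<And>i. i < card (W m) \<Longrightarrow> i \<notin> I \<Longrightarrow> inner_on (W m) f (U m i) = 0"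
    using fZ by (auto simp: Z_def)
  have fV: "f \<in> funs_on V" by (rule funs_on_mono[OF W_subset fW])
  obtain \<gamma> y where y: "\<gamma> \<in> \<Lambda> m" "y \<in> FV" "v = \<phi> \<gamma> y" using cover_W[OF v(1)] by blast
  have FVne: "0 < card FV" using y(2) FV by (auto simp: card_gt_0_iff)
  have lower: "\<eta> / (2 * real (card FV)) \<le> cmod (f v)"
  proof -
    have cW: "0 < card (W m)" using v(1) W_finite by (auto simp: card_gt_0_iff)
    have "real (card (W m)) \<le> real (card FV) * real (card (\<Lambda> m))"
      using card_W_le[of m] by (simp flip: of_nat_mult)
    then have "\<eta> / (2 * real (card FV)) * real (card (W m))
        \<le> \<eta> / (2 * real (card FV)) * (real (card FV) * real (card (\<Lambda> m)))"
      using eta by (intro mult_left_mono) auto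
    also have "\<dots> = \<eta> / 2 * real (card (\<Lambda> m))" using FVne by simp
    also have "\<dots> \<le> real k" using kI by simp
    finally have "\<eta> / (2 * real (card FV)) \<le> real k / real (card (W m))"
      using cW by (simp add: pos_le_divide_eq)
    then show ?thesis using v(3) by (simp add: f_def)
  qed
  define r where "r = (\<lambda>v. kernel_op a f v - of_real \<nu> * f v)"
  have rW: "r = (\<lambda>v. kernel_op (A m) f v - of_real \<nu> * f v)"
    using op_agree[OF fW fbad] by (simp add: r_def)
  have "normsq (W m) r = (\<Sum>i<card (W m). (cmod (inner_on (W m) f (U m i)))\<^sup>2 * (D m i - \<nu>)\<^sup>2)"
    unfolding rW by (rule spectral_combination(2)[OF kerA' W_finite basis' fW])
  also have "\<dots> \<le> (\<Sum>i<card (W m). (cmod (inner_on (W m) f (U m i)))\<^sup>2 * e\<^sup>2)"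
  proof (rule sum_mono)
    fix i assume i: "i \<in> {..<card (W m)}"
    show "(cmod (inner_on (W m) f (U m i)))\<^sup>2 * (D m i - \<nu>)\<^sup>2 \<le> (cmod (inner_on (W m) f (U m i)))\<^sup>2 * e\<^sup>2"
    proof (cases "i \<in> I")
      case True
      then have "\<bar>D m i - \<nu>\<bar> \<le> e" by (simp add: I_def)
      then have "(D m i - \<nu>)\<^sup>2 \<le> e\<^sup>2" by (metis abs_ge_zero power2_abs power_mono)
      then show ?thesis by (simp add: mult_left_mono)
    next
      case False
      then show ?thesis using fI i by simp
    qed
  qed
  also have "\<dots> = e\<^sup>2 * normsq (W m) f"
    unfolding spectral_combination(1)[OF kerA' W_finite basis' fW] sum_distrib_left by (simp add: mult.commute)
  also have "\<dots> \<le> e\<^sup>2" using fn by (simp add: mult_left_le)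
  finally have rn: "normsq (W m) r \<le> e\<^sup>2" .
  have rfun: "r \<in> funs_on (W m)"
    unfolding rW using fW kernel_op_in_funs_on[OF kerA', of m f] by (auto simp: funs_on_def)
  have rpt: "cmod (r v) \<le> e" for v
  proof (cases "v \<in> W m")
    case True
    then have "(cmod (r v))\<^sup>2 \<le> e\<^sup>2" using cmod_le_normsq[OF W_finite True, of r] rn by linarith
    then show ?thesis using e by (simp add: power2_le_iff_abs_le)
  qed (use e rfun in \<open>auto simp: funs_on_def\<close>)
  have \<gamma>: "inv \<gamma> \<in> carrier \<Gamma>" using LamD[OF y(1)] by simp
  \<comment> \<open>The translate that carries \<open>v\<close> to its representative
    \<open>y\<close> in the fundamental domain, so that the mass stays in a fixed finite set for all
    \<open>m\<close>.\<close>
  obtain g where g: "g \<in> funs_on V" "\<And>v. v \<in> V \<Longrightarrow> cmod (g (\<phi> (inv \<gamma>) v)) = cmod (f v)"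
    "\<And>v \<mu>. v \<in> V \<Longrightarrow> cmod (kernel_op a g (\<phi> (inv \<gamma>) v) - of_real \<mu> * g (\<phi> (inv \<gamma>) v))
        = cmod (kernel_op a f v - of_real \<mu> * f v)"
    by (rule magnetic_translation[OF \<gamma> fV]) blast
  have "normsq G g \<le> 1" if G: "finite G" "G \<subseteq> V" for G
  proof -
    have "normsq G g = normsq (\<phi> \<gamma> ` G) f"
      using normsq_translate[where h = g and f = f, OF \<gamma> G(2) g(2)] LamD[OF y(1)] by simp
    also have "\<dots> \<le> normsq (\<phi> \<gamma> ` G \<union> W m) f" using G(1) W_finite by (intro normsq_mono) auto
    also have "\<dots> = normsq (W m) f" using G(1) W_finite fW by (intro normsq_superset) auto
    finally show ?thesis using fn by simp
  qed
  moreover have "\<eta> / (2 * real (card FV)) \<le> (\<Sum>x\<in>FV. cmod (g x))"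
  proof -
    have "\<phi> (inv \<gamma>) v = y" using y LamD FVD by (simp add: act_inv)
    then have "cmod (g y) = cmod (f v)" using g(2)[of v] v(1) W_subset by auto
    moreover have "cmod (g y) \<le> (\<Sum>x\<in>FV. cmod (g x))"
      using y(2) FV by (intro member_le_sum) auto
    ultimately show ?thesis using lower by simp
  qed
  moreover have "cmod (kernel_op a g v - of_real \<nu> * g v) \<le> e" if "v \<in> V" for v
    using g(3)[of "\<phi> \<gamma> v" \<nu>] that LamD[OF y(1)] rpt[of "\<phi> \<gamma> v"] by (simp add: act_inv act_closed r_def)
  ultimately show ?thesis using g(1) by blast
qed

text \<open>If positive density persisted in arbitrarily small windows, the sets \<open>KK e\<close>
  of almost eigenfunctions of norm at most 1, with mass at least \<open>c'\<close> on the
  fundamental domain, would be nonempty, nested and closed under pointwise convergence. A common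
  point is an l2-eigenfunction, and the mass condition prevents it from being zero.\<close>

lemma near_count_small:
  assumes ne: "\<And>g. g \<in> ell2 V \<Longrightarrow> kernel_op a g = (\<lambda>v. of_real \<nu> * g v) \<Longrightarrow> g = (\<lambda>_. 0)"
    and eta: "0 < \<eta>"
  shows "\<exists>e>0. \<forall>\<^sub>F m in sequentially.
    real (card {i. i < card (W m) \<and> \<bar>D m i - \<nu>\<bar> \<le> e}) \<le> \<eta> * real (card (\<Lambda> m))"
proof (rule ccontr)
  assume neg: "\<not> ?thesis"
  define c' where "c' = \<eta> / (2 * real (card FV))"
  define KK where "KK e = funs_on V \<inter> {g. \<forall>G. finite G \<longrightarrow> G \<subseteq> V \<longrightarrow> normsq G g \<le> 1} \<inter>
     {g. c' \<le> (\<Sum>x\<in>FV. cmod (g x))} \<inter> {g. \<forall>v\<in>V. cmod (kernel_op a g v - of_real \<nu> * g v) \<le> e}"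
    for e :: real
  have KKne: "KK e \<noteq> {}" if e: "e > 0" for e
  proof -
    have "\<exists>\<^sub>F m in sequentially. \<eta> * real (card (\<Lambda> m)) < real (card {i. i < card (W m) \<and> \<bar>D m i - \<nu>\<bar> \<le> e})"
      using neg e by (auto simp: not_eventually not_le)
    moreover have "\<forall>\<^sub>F m in sequentially. real (card (bad m)) < \<eta> / 2 * real (card (\<Lambda> m))"
      using eta by (intro eventually_bad_less) simp
    ultimately obtain m where
      "\<eta> * real (card (\<Lambda> m)) < real (card {i. i < card (W m) \<and> \<bar>D m i - \<nu>\<bar> \<le> e})"
      "real (card (bad m)) < \<eta> / 2 * real (card (\<Lambda> m))"
      using frequently_eventually_frequently frequently_ex by (smt (verit, best))
    from localized_almost_eigenvector[OF e eta this] show ?thesis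
      by (auto simp: KK_def c'_def)
  qed
  have cl: "closed (KK e)" for e
  proof -
    have "funs_on V = (\<Inter>v\<in>-V. {f. f v = 0})" by (auto simp: funs_on_def)
    moreover have "closed {f :: 'v \<Rightarrow> complex. f v = 0}" for v
      by (intro closed_Collect_eq_const continuous_intros)
    ultimately have 1: "closed (funs_on V)" by auto
    have "{g. \<forall>G. finite G \<longrightarrow> G \<subseteq> V \<longrightarrow> normsq G g \<le> 1}
        = (\<Inter>G\<in>{G. finite G \<and> G \<subseteq> V}. {g. normsq G g \<le> 1})" by auto
    moreover have "closed {g :: 'v \<Rightarrow> complex. normsq G g \<le> 1}" for G
      unfolding normsq_def by (intro closed_Collect_le continuous_intros)
    ultimately have 2: "closed {g. \<forall>G. finite G \<longrightarrow> G \<subseteq> V \<longrightarrow> normsq G g \<le> 1}" by auto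
    have 3: "closed {g :: 'v \<Rightarrow> complex. c' \<le> (\<Sum>x\<in>FV. cmod (g x))}"
      by (intro closed_Collect_le continuous_intros)
    have "{g. \<forall>v\<in>V. cmod (kernel_op a g v - of_real \<nu> * g v) \<le> e}
        = (\<Inter>v\<in>V. {g. cmod (kernel_op a g v - of_real \<nu> * g v) \<le> e})" by auto
    moreover have "closed {g. cmod (kernel_op a g v - of_real \<nu> * g v) \<le> e}" for v
      by (intro closed_Collect_le continuous_intros)
    ultimately have 4: "closed {g. \<forall>v\<in>V. cmod (kernel_op a g v - of_real \<nu> * g v) \<le> e}" by auto
    show ?thesis unfolding KK_def by (intro closed_Int 1 2 3 4)
  qed
  have bd: "KK e \<subseteq> {f. \<forall>v. cmod (f v) \<le> 1}" for e
  proof safe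
    fix f v assume f: "f \<in> KK e"
    show "cmod (f v) \<le> 1"
    proof (cases "v \<in> V")
      case True
      then have "normsq {v} f \<le> 1" using f by (auto simp: KK_def)
      then show ?thesis by (simp add: normsq_def abs_square_le_1)
    qed (use f in \<open>auto simp: KK_def funs_on_def\<close>)
  qed
  have mono: "KK e \<subseteq> KK e'" if "e \<le> e'" for e e'
    using that by (auto simp: KK_def intro: order_trans)
  \<comment> \<open>The finite intersection property reduces to a single window because the sets are
    nested.\<close>
  have "{f. \<forall>v. cmod (f v) \<le> 1} \<inter> (\<Inter>i\<in>UNIV. KK (inverse (real (Suc i)))) \<noteq> {}"
  proof (rule compact_imp_fip_image[OF compact_unit_functions cl])
    fix I' :: "nat set" assume fin: "finite I'"
    define j where "j = Max (insert 0 I')"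
    have "KK (inverse (real (Suc j))) \<subseteq> KK (inverse (real (Suc i)))" if "i \<in> I'" for i
      using fin that by (intro mono) (auto simp: j_def)
    moreover have "KK (inverse (real (Suc j))) \<noteq> {}" by (rule KKne) simp
    ultimately show "{f. \<forall>v. cmod (f v) \<le> 1} \<inter> (\<Inter>i\<in>I'. KK (inverse (real (Suc i)))) \<noteq> {}"
      using bd by blast
  qed
  then obtain g where g: "\<And>i. g \<in> KK (inverse (real (Suc i)))" by blast
  have gV: "g \<in> funs_on V" using g[of 0] by (simp add: KK_def)
  have "g \<in> ell2 V" using g[of 0] by (intro ell2I(1)[OF gV, of 1]) (auto simp: KK_def)
  moreover have "kernel_op a g = (\<lambda>v. of_real \<nu> * g v)"
  proof
    fix v
    show "kernel_op a g v = of_real \<nu> * g v"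
    proof (cases "v \<in> V")
      case True
      have "cmod (kernel_op a g v - of_real \<nu> * g v) \<le> inverse (real (Suc i))" for i
        using g[of i] True by (simp add: KK_def)
      then have "cmod (kernel_op a g v - of_real \<nu> * g v) \<le> 0"
        by (intro LIMSEQ_le_const[OF LIMSEQ_inverse_real_of_nat]) auto
      then show ?thesis by simp
    next
      case False
      then show ?thesis using gV kernel_op_in_funs_on[OF ker, of g] by (auto simp: funs_on_def)
    qed
  qed
  ultimately have "g = (\<lambda>_. 0)" by (rule ne)
  then have "c' \<le> 0" using g[of 0] by (simp add: KK_def)
  \<comment> \<open>For empty \<open>FV\<close> division by zero would make \<open>c'\<close>
    vanish, so nonemptiness is obtained from the existence of eigenvalues.\<close>
  moreover have "FV \<noteq> {}"
    using g[of 0] KKne[of 1] localized_almost_eigenvector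
  proof -
    have "\<exists>\<^sub>F m in sequentially. \<eta> * real (card (\<Lambda> m)) < real (card {i. i < card (W m) \<and> \<bar>D m i - \<nu>\<bar> \<le> 1})"
      using neg by (auto simp: not_eventually not_le dest!: spec[of _ 1])
    then obtain m where "\<eta> * real (card (\<Lambda> m)) < real (card {i. i < card (W m) \<and> \<bar>D m i - \<nu>\<bar> \<le> 1})"
      using frequently_ex by blast
    moreover have "0 \<le> \<eta> * real (card (\<Lambda> m))" using eta by simp
    ultimately have "0 < card {i. i < card (W m) \<and> \<bar>D m i - \<nu>\<bar> \<le> 1}" by linarith
    then have "0 < card (W m)" by (auto simp: card_gt_0_iff W_finite)
    then show ?thesis by (auto simp: W_def)
  qed
  ultimately show False using eta FV by (simp add: c'_def card_gt_0_iff divide_le_0_iff)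
qed

end

context exhausted_kernel
begin

text \<open>The restrictions to \<open>W m\<close> of the translates of an \<open>\<ell>\<^sup>2\<close>-eigenfunction span a space whose
  dimension grows like \<open>card (\<Lambda> m)\<close>, and on it \<open>A m - \<nu>\<close> takes values supported on the small
  set \<open>bad m\<close>.\<close>

lemma ell2_eigenvalue_of_restriction:
  assumes f: "f \<in> ell2 V" "kernel_op a f = (\<lambda>v. of_real \<nu> * f v)" "f y \<noteq> 0"
  shows "\<exists>m i. i < card (W m) \<and> D m i = \<nu>"
proof (rule ccontr)
  assume "\<not> ?thesis"
  then have ne: "D m i \<noteq> \<nu>" if "i < card (W m)" for m i using that by blast
  have fV: "f \<in> funs_on V" by (rule ell2_funs_on[OF f(1)])
  have y: "y \<in> V" using fV f(3) by (auto simp: funs_on_def)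
  then obtain \<gamma>0 x0 where x0: "\<gamma>0 \<in> carrier \<Gamma>" "x0 \<in> FV" "y = \<phi> \<gamma>0 x0" using cover by blast
  have L: "(cmod (f y))\<^sup>2 \<le> L2 V f" using normsq_le_L2[OF f(1), of "{y}"] by (simp add: normsq_def)
  moreover have "0 < (cmod (f y))\<^sup>2" using f(3) by simp
  ultimately have Lp: "0 < L2 V f" by linarith
  \<comment> \<open>The share of the total mass of \<open>f\<close> sitting at \<open>y\<close>;
    magnetic translation carries it to each \<open>\<phi> \<gamma> x0\<close>, and truncation to
    \<open>W m\<close> can only increase the share.\<close>
  define t where "t = (cmod (f y))\<^sup>2 / L2 V f"
  have t: "0 < t" using Lp f(3) by (simp add: t_def)
  obtain m where m: "real (card (bad m)) < t * real (card (\<Lambda> m))"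
    using eventually_happens[OF eventually_bad_less[OF t]] by auto
  define Z where "Z = {h \<in> funs_on (W m). \<forall>v\<in>W m - bad m. kernel_op (A m) h v = of_real \<nu> * h v}"
  have Z: "subspace_on (W m) Z"
    by (auto simp: subspace_on_def Z_def funs_on_def kernel_op_linear algebra_simps)
      (simp add: kernel_op_def)
  have "\<exists>h. h \<in> Z \<and> t * normsq (W m) h \<le> (cmod (h (\<phi> \<gamma> x0)))\<^sup>2 \<and> 0 < normsq (W m) h"
    if \<gamma>: "\<gamma> \<in> \<Lambda> m" for \<gamma>
  proof -
    define \<tau> where "\<tau> = \<gamma> \<otimes> inv \<gamma>0"
    have \<tau>: "\<tau> \<in> carrier \<Gamma>" using LamD[OF \<gamma>] x0 by (simp add: \<tau>_def)
    have \<tau>y: "\<phi> \<tau> y = \<phi> \<gamma> x0"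
      using LamD[OF \<gamma>] x0 FVD[OF x0(2)] y by (simp add: \<tau>_def composition_rule act_inv)
    obtain g where g: "g \<in> funs_on V" "\<And>v. v \<in> V \<Longrightarrow> cmod (g (\<phi> \<tau> v)) = cmod (f v)"
      "\<And>v \<mu>. v \<in> V \<Longrightarrow> cmod (kernel_op a g (\<phi> \<tau> v) - of_real \<mu> * g (\<phi> \<tau> v))
        = cmod (kernel_op a f v - of_real \<mu> * f v)"
      by (rule magnetic_translation[OF \<tau> fV]) blast
    have ge: "kernel_op a g v = of_real \<nu> * g v" if "v \<in> V" for v
      using g(3)[of "\<phi> (inv \<tau>) v" \<nu>] that \<tau> f(2) by (simp add: act_closed act_inv')
    define h where "h = (\<lambda>w. if w \<in> W m then g w else 0)"
    have mem: "\<phi> \<gamma> x0 \<in> W m" using \<gamma> x0 by (auto simp: W_def)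
    have hy: "cmod (h (\<phi> \<gamma> x0)) = cmod (f y)" using mem g(2)[OF y] by (simp add: h_def \<tau>y)
    have "h \<in> Z"
      using good_row[of _ m g] ge W_subset by (auto simp: Z_def funs_on_def h_def)
    moreover have "normsq (W m) h \<le> L2 V f"
    proof -
      have "normsq (W m) h = normsq (W m) g" by (simp add: normsq_def h_def)
      also have "\<dots> = normsq (\<phi> (inv \<tau>) ` W m) f" by (rule normsq_translate[where h = g and f = f, OF \<tau> W_subset g(2)])
      also have "\<dots> \<le> L2 V f" using W_finite by (intro normsq_le_L2 f) auto
      finally show ?thesis .
    qed
    then have "t * normsq (W m) h \<le> t * L2 V f" using t by (intro mult_left_mono) auto
    then have "t * normsq (W m) h \<le> (cmod (h (\<phi> \<gamma> x0)))\<^sup>2" using Lp by (simp add: hy t_def)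
    moreover have "0 < normsq (W m) h"
    proof -
      have "0 < (cmod (h (\<phi> \<gamma> x0)))\<^sup>2" using f(3) hy by simp
      then show ?thesis using cmod_le_normsq[OF W_finite mem, of h] by linarith
    qed
    ultimately show ?thesis by blast
  qed
  then obtain h where h: "\<And>\<gamma>. \<gamma> \<in> \<Lambda> m \<Longrightarrow> h \<gamma> \<in> Z"
    "\<And>\<gamma>. \<gamma> \<in> \<Lambda> m \<Longrightarrow> t * normsq (W m) (h \<gamma>) \<le> (cmod (h \<gamma> (\<phi> \<gamma> x0)))\<^sup>2"
    "\<And>\<gamma>. \<gamma> \<in> \<Lambda> m \<Longrightarrow> 0 < normsq (W m) (h \<gamma>)"
    by metis
  have "t * real (card (\<Lambda> m)) \<le> real (card (bad m))"
  proof (rule subspace_mass_le[OF W_finite Z _ Lam(1), where p = "\<lambda>\<gamma>. \<phi> \<gamma> x0" and h = h])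
    show "inj_on (\<lambda>\<gamma>. \<phi> \<gamma> x0) (\<Lambda> m)" using act_eq_iff(1) LamD x0(2) by (intro inj_onI) blast
    show "(\<lambda>\<gamma>. \<phi> \<gamma> x0) ` \<Lambda> m \<subseteq> W m" using x0 by (auto simp: W_def)
    fix k and w :: "nat \<Rightarrow> 'v \<Rightarrow> complex"
    assume on: "orthonormal_on (W m) {..<k} w" and wZ: "\<And>i. i < k \<Longrightarrow> w i \<in> Z"
    \<comment> \<open>\<nu> is assumed not to be an eigenvalue of \<open>A m\<close>, so
      \<open>A m - \<nu>\<close> is injective; a larger family would have a nontrivial combination
      whose image vanishes also on \<open>bad m\<close>.\<close>
    show "k \<le> card (bad m)"
    proof (rule ccontr)
      assume "\<not> k \<le> card (bad m)"
      then obtain x where x: "\<exists>j\<in>{..<k}. x j \<noteq> 0"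
        "\<forall>v\<in>bad m. (\<Sum>j<k. (kernel_op (A m) (w j) v - of_real \<nu> * w j v) * x j) = 0"
        using homogeneous_system_nontrivial[OF bad_finite, of "{..<k}" m
            "\<lambda>v j. kernel_op (A m) (w j) v - of_real \<nu> * w j v"] by auto
      define q where "q = (\<lambda>v. \<Sum>j<k. x j * w j v)"
      have qZ: "q \<in> Z" unfolding q_def using wZ by (intro subspace_on_sum[OF Z]) auto
      then have qW: "q \<in> funs_on (W m)" by (simp add: Z_def)
      have "kernel_op (A m) q v - of_real \<nu> * q v = 0" if "v \<in> W m" for v
      proof (cases "v \<in> bad m")
        case True
        have "kernel_op (A m) q v - of_real \<nu> * q v
            = (\<Sum>j<k. (kernel_op (A m) (w j) v - of_real \<nu> * w j v) * x j)"
          unfolding q_def kernel_op_sum sum_distrib_left sum_subtractf[symmetric]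
          by (intro sum.cong) (auto simp: algebra_simps)
        then show ?thesis using x(2) True by simp
      next
        case False
        then show ?thesis using qZ that by (simp add: Z_def)
      qed
      then have "normsq (W m) (\<lambda>v. kernel_op (A m) q v - of_real \<nu> * q v) = 0"
        by (simp add: normsq_def)
      then have sq: "(cmod (inner_on (W m) q (U m i)))\<^sup>2 * (D m i - \<nu>)\<^sup>2 = 0" if "i < card (W m)" for i
        unfolding spectral_combination(2)[OF kerA' W_finite basis' qW]
        using that by (subst (asm) sum_nonneg_eq_0_iff) auto
      have "inner_on (W m) q (U m i) = 0" if "i < card (W m)" for i
        using sq[OF that] ne[OF that] by simp
      then have "normsq (W m) q = 0"
        unfolding spectral_combination(1)[OF kerA' W_finite basis' qW] by simp
      then have "(\<Sum>j<k. (cmod (x j))\<^sup>2) = 0"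
        unfolding q_def by (subst (asm) orthonormal_normsq_sum[OF on]) auto
      then show False using x(1) by (auto simp: sum_nonneg_eq_0_iff)
    qed
  qed (use h in auto)
  then show False using m by simp
qed

section \<open>The covering by roots of unity\<close>

definition R :: "complex set" where "R = {z. z ^ n = 1}"

lemma R_finite: "finite R"
  unfolding R_def using n by (intro finite_roots_unity) simp

lemma R_div: "x \<in> R \<Longrightarrow> y \<in> R \<Longrightarrow> y / x \<in> R" and R_mult: "x \<in> R \<Longrightarrow> y \<in> R \<Longrightarrow> y * x \<in> R"
  and R_one: "1 \<in> R" and R_nz: "x \<in> R \<Longrightarrow> x \<noteq> 0"
  using n by (auto simp: R_def power_divide power_mult_distrib power_0_left)

text \<open>Multiplication by \<open>x\<close> permutes \<open>R\<close>: in the covering, the row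
  at fibre coordinate \<open>x\<close> is a relabelling of the row at 1.\<close>

lemma sum_R_shift: "x \<in> R \<Longrightarrow> (\<Sum>y\<in>R. g (y / x)) = (\<Sum>z\<in>R. g z)"
  by (rule sum.reindex_bij_witness[where i = "\<lambda>z. z * x" and j = "\<lambda>y. y / x"])
    (auto simp: R_div R_mult R_nz)

text \<open>The integral kernel of the covering with group \<open>R\<close>, on which the weight becomes trivial.
  The characters of \<open>R\<close> split its operator, and the inclusion \<open>R \<subseteq> \<complex>\<close> gives the original one.\<close>

lemma integral_cover:
  defines "X \<equiv> \<lambda>m. W m \<times> R"
  obtains u d where "orthonormal_on (X m) {..<card (X m)} u"
    "\<And>i p. i < card (X m) \<Longrightarrow> p \<in> X m \<Longrightarrow>
      (\<Sum>q\<in>X m. of_int (c m (fst p) (fst q) (snd q / snd p)) * u i q) = of_real (d i) * u i p"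
    "\<And>i. i < card (X m) \<Longrightarrow> \<bar>d i\<bar> \<le> K"
    "\<And>J. card {i. i < card (W m) \<and> D m i \<in> J} \<le> card {i. i < card (X m) \<and> d i \<in> J}"
proof -
  \<comment> \<open>An edge of weight \<open>z\<close> connects fibre coordinates with quotient
    \<open>z\<close>, so an entry depends only on the quotient of the coordinates.\<close>
  define t where "t p q = c m (fst p) (fst q) (snd q / snd p)" for p q
  define b where "b p q = (if p \<in> X m \<and> q \<in> X m then complex_of_int (t p q) else 0)" for p q
  have Xf: "finite (X m)" using W_finite R_finite by (simp add: X_def)
  note K0 = hermitian_kernel_nonneg[OF ker]
  have b: "hermitian_kernel (X m) K b"
    unfolding hermitian_kernel_def
  proof (intro conjI allI impI)
    fix p q
    show "p \<in> X m" "q \<in> X m" if "b p q \<noteq> 0" using that by (auto simp: b_def split: if_splits)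
    show "finite {q. b p q \<noteq> 0}" by (rule finite_subset[OF _ Xf]) (auto simp: b_def)
    have "t q p = t p q" if "p \<in> X m" "q \<in> X m"
    proof -
      have "(snd q / snd p) ^ n = 1" using that R_div[of "snd p" "snd q"] by (auto simp: X_def R_def)
      then show ?thesis using c_sym[of "snd q / snd p" m "fst q" "fst p"] by (simp add: t_def)
    qed
    then show "b q p = cnj (b p q)" by (auto simp: b_def)
    show "(\<Sum>q | b p q \<noteq> 0. cmod (b p q)) \<le> K"
    proof (cases "p \<in> X m")
      case True
      have "(\<Sum>q | b p q \<noteq> 0. cmod (b p q)) = (\<Sum>q\<in>X m. cmod (b p q))"
        using Xf by (intro sum.mono_neutral_left) (auto simp: b_def)
      also have "\<dots> = (\<Sum>w\<in>W m. \<Sum>y\<in>R. \<bar>of_int (c m (fst p) w (y / snd p))\<bar>)"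
        unfolding X_def sum.cartesian_product'
        using True by (intro sum.cong refl) (auto simp: b_def t_def X_def)
      also have "\<dots> = (\<Sum>w\<in>W m. \<Sum>z\<in>R. \<bar>of_int (c m (fst p) w z)\<bar>)"
        using True by (intro sum.cong refl sum_R_shift) (auto simp: X_def)
      also have "\<dots> \<le> K" using c_le[of m "fst p"] by (simp add: W_def R_def)
      finally show ?thesis .
    next
      case False
      then show ?thesis using K0 by (simp add: b_def)
    qed
  qed
  obtain u d where ud: "spectral_basis (X m) b u d" by (rule hermitian_spectral_theorem[OF b Xf])
  note on = spectral_basisD(1)[OF ud]
  \<comment> \<open>Functions on the covering that transform by the inclusion of \<open>R\<close> in
    the complex numbers; on them the coefficient of \<open>z\<close> is weighted by
    \<open>z\<close>, which rebuilds \<open>A m\<close>.\<close>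
  define lift where "lift f = (\<lambda>(v, x). if x \<in> R then f v * x else 0)" for f :: "'v \<Rightarrow> complex"
  have lX: "lift f \<in> funs_on (X m)" if "f \<in> funs_on (W m)" for f
    using that by (auto simp: lift_def funs_on_def X_def)
  have op: "kernel_op b (lift f) = lift (kernel_op (A m) f)" if f: "f \<in> funs_on (W m)" for f
  proof
    fix p :: "'v \<times> complex"
    obtain v x where p: "p = (v, x)" by (cases p)
    show "kernel_op b (lift f) p = lift (kernel_op (A m) f) p"
    proof (cases "p \<in> X m")
      case True
      then have vx: "v \<in> W m" "x \<in> R" by (auto simp: p X_def)
      have "kernel_op b (lift f) p = (\<Sum>q\<in>X m. b p q * lift f q)"
        by (rule kernel_op_finite[OF b Xf])
      also have "\<dots> = (\<Sum>w\<in>W m. \<Sum>y\<in>R. of_int (c m v w (y / x)) * (f w * ((y / x) * x)))"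
        unfolding X_def sum.cartesian_product'
        using vx by (intro sum.cong refl) (auto simp: b_def t_def X_def p lift_def R_nz)
      also have "\<dots> = (\<Sum>w\<in>W m. \<Sum>z\<in>R. of_int (c m v w z) * (f w * (z * x)))"
        by (rule sum.cong[OF refl])
          (rule sum_R_shift[OF vx(2), where g = "\<lambda>z. of_int (c m v w z) * (f w * (z * x))" for w])
      also have "\<dots> = (\<Sum>w\<in>W m. A m v w * f w) * x"
        unfolding rational R_def[symmetric] sum_distrib_right by (intro sum.cong refl) (auto simp: mult_ac)
      also have "(\<Sum>w\<in>W m. A m v w * f w) = kernel_op (A m) f v"
        by (rule kernel_op_finite[OF kerA' W_finite, symmetric])
      finally show ?thesis using vx by (simp add: p lift_def)
    next
      case False
      then have "lift (kernel_op (A m) f) p = 0"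
        using kernel_op_in_funs_on[OF kerA', of m f] by (auto simp: p X_def lift_def funs_on_def)
      then show ?thesis using False kernel_op_in_funs_on[OF b, of "lift f"] unfolding funs_on_def by (simp add: p)
    qed
  qed
  have sums: "(\<Sum>q\<in>X m. of_int (t p q) * u i q) = of_real (d i) * u i p"
    if "i < card (X m)" "p \<in> X m" for i p
  proof -
    have "(\<Sum>q\<in>X m. of_int (t p q) * u i q) = (\<Sum>q\<in>X m. b p q * u i q)"
      using that by (intro sum.cong) (auto simp: b_def)
    also have "\<dots> = kernel_op b (u i) p" by (rule kernel_op_finite[OF b Xf, symmetric])
    finally show ?thesis using spectral_basisD(3)[OF ud that(1)] by simp
  qed
  have dK: "\<bar>d i\<bar> \<le> K" if "i < card (X m)" for i
  proof -
    have "normsq (X m) (u i) = 1" using orthonormal_normsq[OF on] that by simp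
    then have "(d i)\<^sup>2 \<le> K\<^sup>2"
      using normsq_kernel_op_le[OF b Xf Xf spectral_basisD(2)[OF ud that]] spectral_basisD(3)[OF ud that]
      by (simp add: normsq_scale)
    then show ?thesis using K0 by (simp add: power2_le_iff_abs_le)
  qed
  \<comment> \<open>Lifting is injective and intertwines the operators, so multiplicities can only
    grow. A surplus of indices would give a nonzero lift orthogonal to the whole eigenbasis.\<close>
  have cnt: "card {i. i < card (W m) \<and> D m i \<in> J} \<le> card {i. i < card (X m) \<and> d i \<in> J}" for J
  proof (rule ccontr)
    define I where "I = {i. i < card (W m) \<and> D m i \<in> J}"
    define I' where "I' = {i. i < card (X m) \<and> d i \<in> J}"
    have I: "finite I" "I \<subseteq> {..<card (W m)}" "finite I'" by (auto simp: I_def I'_def)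
    assume "\<not> card {i. i < card (W m) \<and> D m i \<in> J} \<le> card {i. i < card (X m) \<and> d i \<in> J}"
    then have "card I' < card I" by (simp add: I_def I'_def)
    then obtain x where x: "\<exists>i\<in>I. x i \<noteq> 0"
      "\<forall>j\<in>I'. (\<Sum>i\<in>I. inner_on (X m) (lift (U m i)) (u j) * x i) = 0"
      using homogeneous_system_nontrivial[OF I(3,1), of "\<lambda>j i. inner_on (X m) (lift (U m i)) (u j)"] by blast
    define f where "f = (\<lambda>v. \<Sum>i\<in>I. x i * U m i v)"
    have fW: "f \<in> funs_on (W m)"
      using spectral_basisD(2)[OF basis'] I by (auto simp: f_def funs_on_def intro!: sum.neutral)
    have lf: "lift f = (\<lambda>p. \<Sum>i\<in>I. x i * lift (U m i) p)"
      by (auto simp: lift_def f_def sum_distrib_right mult.assoc)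
    have "inner_on (X m) (lift f) (u j) = 0" if j: "j < card (X m)" for j
    proof (cases "j \<in> I'")
      case True
      then show ?thesis using x(2) by (simp add: lf inner_on_sum_left mult.commute)
    next
      case False
      have "inner_on (X m) (lift (U m i)) (u j) = 0" if i: "i \<in> I" for i
      proof -
        have i': "i < card (W m)" using i I by auto
        have "kernel_op b (lift (U m i)) = (\<lambda>p. of_real (D m i) * lift (U m i) p)"
          unfolding op[OF spectral_basisD(2)[OF basis' i']] spectral_basisD(3)[OF basis' i']
          by (auto simp: lift_def mult.assoc)
        then have "of_real (D m i) * inner_on (X m) (lift (U m i)) (u j)
            = of_real (d j) * inner_on (X m) (lift (U m i)) (u j)"
          using spectral_basis_eigen_coeff[OF b Xf ud j lX[OF spectral_basisD(2)[OF basis' i']]]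
          by (simp add: inner_on_scale_left)
        moreover have "D m i \<noteq> d j" using i False j by (auto simp: I_def I'_def)
        ultimately show ?thesis by simp
      qed
      then show ?thesis by (simp add: lf inner_on_sum_left)
    qed
    then have "lift f = (\<lambda>_. 0)"
      using orthonormal_basis_expansion[OF on Xf finite_lessThan _ lX[OF fW] spectral_basisD(2)[OF ud]] by simp
    then have "f v = 0" for v
      by (drule_tac x = "(v, 1)" in fun_cong) (simp add: lift_def R_one)
    then have "inner_on (W m) f (U m i) = 0" for i by (simp add: inner_on_def)
    moreover have "inner_on (W m) f (U m i) = x i" if "i \<in> I" for i
      unfolding f_def using orthonormal_on_subset[OF spectral_basisD(1)[OF basis'] I(2)] I(1) that
      by (rule orthonormal_inner_sum)
    ultimately show False using x(1) by auto
  qed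
  show ?thesis using that on sums dK cnt unfolding t_def by blast
qed

end

section \<open>Eigenvalues just to the right of a point\<close>

lemma poly_small_right_of_root:
  fixes P :: "real poly"
  assumes P: "P \<noteq> 0" "poly P x = 0" and \<delta>: "0 < \<delta>"
  shows "\<exists>e>0. \<forall>y. x < y \<and> y \<le> x + e \<longrightarrow> poly P y \<noteq> 0 \<and> \<bar>poly P y\<bar> \<le> \<delta>"
proof -
  obtain e1 where e1: "e1 > 0" "\<forall>r\<in>{r. poly P r = 0}. r \<noteq> x \<longrightarrow> e1 \<le> dist x r"
    using finite_set_avoid[OF poly_roots_finite[OF P(1)], of x] by blast
  have "isCont (poly P) x" by simp
  then obtain e2 where e2: "e2 > 0" "\<And>y. dist y x < e2 \<Longrightarrow> dist (poly P y) (poly P x) < \<delta>"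
    using \<delta> unfolding continuous_at_eps_delta by blast
  define e where "e = min e1 e2 / 2"
  have e: "0 < e" "e < e1" "e < e2" using e1(1) e2(1) by (auto simp: e_def)
  have "poly P y \<noteq> 0 \<and> \<bar>poly P y\<bar> \<le> \<delta>" if "x < y" "y \<le> x + e" for y
  proof
    show "poly P y \<noteq> 0"
    proof
      assume "poly P y = 0"
      then have "e1 \<le> dist x y" using e1(2) that by auto
      then show False using that e by (simp add: dist_real_def)
    qed
    show "\<bar>poly P y\<bar> \<le> \<delta>" using e2(2)[of y] that e P(2) by (simp add: dist_real_def)
  qed
  then show ?thesis using e by blast
qed

context exhausted_kernel
begin

text \<open>\<nu> is a root of the characteristic polynomial \<open>p\<close> of the integral
  covering of the restriction \<open>m0\<close>. The same \<open>p\<close> takes small nonzero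
  values at eigenvalues of the other coverings just right of \<nu>, and integrality makes these
  rare. Eigenvalues equal to \<nu> become zeros of \<open>p\<close> and drop out of the
  product.\<close>

lemma right_count_small_of_eigenvalue:
  assumes eig: "i0 < card (W m0)" "D m0 i0 = \<nu>" and eta: "0 < \<eta>"
  shows "\<exists>e>0. \<forall>m. real (card {i. i < card (W m) \<and> \<nu> < D m i \<and> D m i \<le> \<nu> + e}) \<le> \<eta> * real (card (\<Lambda> m))"
proof -
  let ?X = "\<lambda>m. W m \<times> R"
  have Xf: "finite (?X m)" for m using W_finite R_finite by simp
  obtain p :: "int poly" where p0: "p \<noteq> 0" and pr: "poly (of_int_poly p) \<nu> = 0"
  proof -
    obtain u d where u: "orthonormal_on (?X m0) {..<card (?X m0)} u"
      "\<And>i q. i < card (?X m0) \<Longrightarrow> q \<in> ?X m0 \<Longrightarrow>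
        (\<Sum>q'\<in>?X m0. of_int (c m0 (fst q) (fst q') (snd q' / snd q)) * u i q') = of_real (d i) * u i q"
      "\<And>i. i < card (?X m0) \<Longrightarrow> \<bar>d i\<bar> \<le> K"
      "\<And>J. card {i. i < card (W m0) \<and> D m0 i \<in> J} \<le> card {i. i < card (?X m0) \<and> d i \<in> J}"
      by (rule integral_cover[of m0]) blast
    obtain p :: "int poly" where p: "of_int_poly p = (\<Prod>i<card (?X m0). [:- complex_of_real (d i), 1:])"
      by (rule integer_charpoly_of_eigenbasis[OF Xf u(1,2)])
    have "0 < card {i. i < card (W m0) \<and> D m0 i \<in> {\<nu>}}"
      using eig by (auto simp: card_gt_0_iff)
    then have "0 < card {i. i < card (?X m0) \<and> d i \<in> {\<nu>}}" using u(4)[of "{\<nu>}"] by linarith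
    then obtain j where j: "j < card (?X m0)" "d j = \<nu>" by (auto simp: card_gt_0_iff)
    have "poly (of_int_poly p) (complex_of_real \<nu>) = 0"
      unfolding p poly_prod using j by (intro prod_zero) auto
    moreover have "poly (of_int_poly p) (complex_of_real \<nu>) = of_real (poly (of_int_poly p) \<nu>)"
      by (simp add: poly_altdef)
    ultimately have "poly (of_int_poly p) \<nu> = 0" by simp
    moreover have "p \<noteq> 0"
    proof
      assume "p = 0"
      then have "(\<Prod>i<card (?X m0). [:- complex_of_real (d i), 1:]) = 0" using p by simp
      then show False by simp
    qed
    ultimately show ?thesis using that by blast
  qed
  define P :: "real poly" where "P = of_int_poly p"
  have P: "P \<noteq> 0" "poly P \<nu> = 0" using p0 pr by (auto simp: P_def)
  have "bounded (poly P ` {-K..K})"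
    by (intro compact_imp_bounded compact_continuous_image continuous_intros) auto
  then obtain B where B: "\<And>x. \<bar>x\<bar> \<le> K \<Longrightarrow> \<bar>poly P x\<bar> \<le> B"
    unfolding bounded_iff by (force simp: abs_le_iff)
  \<comment> \<open>A bound for \<open>P\<close> on the interval containing all spectra, raised to
    at least 1 so that \<open>ln L\<close> is nonnegative.\<close>
  define L where "L = max 1 B"
  define M where "M = real (card FV) * real (card R) * ln L"
  have M: "0 \<le> M" by (simp add: M_def L_def)
  \<comment> \<open>Chosen so that \<open>M / ln (1 / \<delta>)\<close> lies below \<eta>. As
    \<open>M\<close> bounds the logarithmic total per element of \<open>\<Lambda> m\<close>,
    \<delta> is independent of \<open>m\<close>.\<close>
  define \<delta> where "\<delta> = exp (- (M / \<eta> + 1))"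
  have \<delta>: "0 < \<delta>" "\<delta> < 1" "ln (1 / \<delta>) = M / \<eta> + 1"
  proof -
    have "0 \<le> M / \<eta>" using M eta by simp
    then show "0 < \<delta>" "\<delta> < 1" "ln (1 / \<delta>) = M / \<eta> + 1"
      by (simp_all add: \<delta>_def ln_div)
  qed
  obtain e where e: "e > 0" "\<And>y. \<nu> < y \<Longrightarrow> y \<le> \<nu> + e \<Longrightarrow> poly P y \<noteq> 0 \<and> \<bar>poly P y\<bar> \<le> \<delta>"
    using poly_small_right_of_root[OF P \<delta>(1)] by blast
  have "real (card {i. i < card (W m) \<and> \<nu> < D m i \<and> D m i \<le> \<nu> + e}) \<le> \<eta> * real (card (\<Lambda> m))" for m
  proof -
    obtain u d where u: "orthonormal_on (?X m) {..<card (?X m)} u"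
      "\<And>i q. i < card (?X m) \<Longrightarrow> q \<in> ?X m \<Longrightarrow>
        (\<Sum>q'\<in>?X m. of_int (c m (fst q) (fst q') (snd q' / snd q)) * u i q') = of_real (d i) * u i q"
      "\<And>i. i < card (?X m) \<Longrightarrow> \<bar>d i\<bar> \<le> K"
      "\<And>J. card {i. i < card (W m) \<and> D m i \<in> J} \<le> card {i. i < card (?X m) \<and> d i \<in> J}"
      by (rule integral_cover[of m]) blast
    let ?N = "{i. i < card (W m) \<and> \<nu> < D m i \<and> D m i \<le> \<nu> + e}"
    let ?Q = "{i. i < card (?X m) \<and> poly P (d i) \<noteq> 0 \<and> \<bar>poly P (d i)\<bar> \<le> \<delta>}"
    have "card ?N \<le> card {i. i < card (?X m) \<and> d i \<in> {\<nu><..\<nu> + e}}"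
      using u(4)[of "{\<nu><..\<nu> + e}"] by simp
    also have "\<dots> \<le> card ?Q" using e(2) by (intro card_mono) auto
    finally have 1: "card ?N \<le> card ?Q" .
    have "real (card ?Q) * ln (1 / \<delta>) \<le> real (card (?X m)) * ln L"
      unfolding P_def
    proof (rule card_small_polynomial_values_le[OF Xf u(1,2) _ _ \<delta>(1,2)])
      show "\<bar>poly (of_int_poly p) (d i)\<bar> \<le> L" if "i < card (?X m)" for i
        using B[OF u(3)[OF that]] by (auto simp: L_def P_def)
    qed (auto simp: L_def)
    also have "\<dots> \<le> real (card FV * card (\<Lambda> m) * card R) * ln L"
    proof -
      have "card (?X m) \<le> card FV * card (\<Lambda> m) * card R"
        unfolding card_cartesian_product by (intro mult_right_mono card_W_le) simp
      then show ?thesis by (intro mult_right_mono) (auto simp: L_def simp flip: of_nat_mult)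
    qed
    also have "\<dots> = M * real (card (\<Lambda> m))" by (simp add: M_def)
    finally have "real (card ?Q) * (M / \<eta> + 1) \<le> M * real (card (\<Lambda> m))" unfolding \<delta>(3) .
    then have "real (card ?Q) * (M + \<eta>) \<le> \<eta> * M * real (card (\<Lambda> m))"
      using eta by (simp add: field_simps)
    also have "\<dots> \<le> \<eta> * real (card (\<Lambda> m)) * (M + \<eta>)"
      using eta by (simp add: algebra_simps)
    finally have "real (card ?Q) \<le> \<eta> * real (card (\<Lambda> m))"
      using M eta by (simp add: mult_le_cancel_right)
    then show ?thesis using 1 by linarith
  qed
  then show ?thesis using e(1) by blast
qed

text \<open>Without an l2-eigenfunction at \<nu>, compactness handles even two-sided windows. An
  l2-eigenfunction makes \<nu> an eigenvalue of some restriction, to which the arithmetic estimate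
  applies.\<close>

lemma right_count_small:
  assumes eta: "0 < \<eta>"
  shows "\<exists>e>0. \<forall>\<^sub>F m in sequentially.
    real (card {i. i < card (W m) \<and> \<nu> < D m i \<and> D m i \<le> \<nu> + e}) \<le> \<eta> * real (card (\<Lambda> m))"
proof (cases "\<exists>f y. f \<in> ell2 V \<and> kernel_op a f = (\<lambda>v. of_real \<nu> * f v) \<and> f y \<noteq> 0")
  case True
  then obtain m i where "i < card (W m)" "D m i = \<nu>" using ell2_eigenvalue_of_restriction by blast
  from right_count_small_of_eigenvalue[OF this eta] show ?thesis by (auto intro: always_eventually)
next
  case False
  then have "g = (\<lambda>_. 0)" if "g \<in> ell2 V" "kernel_op a g = (\<lambda>v. of_real \<nu> * g v)" for g
    using that by blast
  from near_count_small[OF this eta] obtain e where e: "e > 0"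
    "\<forall>\<^sub>F m in sequentially. real (card {i. i < card (W m) \<and> \<bar>D m i - \<nu>\<bar> \<le> e}) \<le> \<eta> * real (card (\<Lambda> m))"
    by blast
  have "card {i. i < card (W m) \<and> \<nu> < D m i \<and> D m i \<le> \<nu> + e} \<le> card {i. i < card (W m) \<and> \<bar>D m i - \<nu>\<bar> \<le> e}" for m
    by (intro card_mono) auto
  then have le: "real (card {i. i < card (W m) \<and> \<nu> < D m i \<and> D m i \<le> \<nu> + e})
      \<le> real (card {i. i < card (W m) \<and> \<bar>D m i - \<nu>\<bar> \<le> e})" for m by simp
  have "\<forall>\<^sub>F m in sequentially.
      real (card {i. i < card (W m) \<and> \<nu> < D m i \<and> D m i \<le> \<nu> + e}) \<le> \<eta> * real (card (\<Lambda> m))"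
    using e(2) by (rule eventually_mono) (rule order_trans[OF le])
  then show ?thesis using e(1) by blast
qed

section \<open>The two implications\<close>

lemma E_diff:
  assumes "lam1 \<le> lam2"
  shows "real (E m lam2) - real (E m lam1) = real (card {i. i < card (W m) \<and> lam1 < D m i \<and> D m i \<le> lam2})"
proof -
  let ?A = "{i. i < card (W m) \<and> D m i \<le> lam1}"
  let ?B = "{i. i < card (W m) \<and> lam1 < D m i \<and> D m i \<le> lam2}"
  have "{i. i < card (W m) \<and> D m i \<le> lam2} = ?A \<union> ?B" using assms by auto
  moreover have "card (?A \<union> ?B) = card ?A + card ?B" by (rule card_Un_disjoint) auto
  ultimately have "E m lam2 = E m lam1 + card ?B" by (simp add: E_def)
  then show ?thesis by simp
qed

theorem gap_imp_limit:
  assumes lt: "lam1 < lam2"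
    and gap: "\<And>\<mu>. lam1 < \<mu> \<Longrightarrow> \<mu> < lam2 \<Longrightarrow> \<exists>\<epsilon>>0. bounded_below V (shift_kernel V a \<mu>) \<epsilon>"
    and ne: "\<And>g. g \<in> ell2 V \<Longrightarrow> kernel_op a g = (\<lambda>v. of_real lam2 * g v) \<Longrightarrow> g = (\<lambda>_. 0)"
  shows "(\<lambda>m. (real (E m lam2) - real (E m lam1)) / real (card (\<Lambda> m))) \<longlonglongrightarrow> 0"
proof (rule order_tendstoI)
  fix x :: real assume "x < 0"
  then show "\<forall>\<^sub>F m in sequentially. x < (real (E m lam2) - real (E m lam1)) / real (card (\<Lambda> m))"
    using lt by (intro always_eventually allI) (simp add: E_diff less_le_trans)
next
  fix x :: real assume x: "0 < x"
  \<comment> \<open>The half-open interval splits into the part just above \<open>lam1\<close>, the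
    interior and the window at \<open>lam2\<close>, each bounded by \<eta> per group element; the
    fourth quarter leaves a strict inequality.\<close>
  define \<eta> where "\<eta> = x / 4"
  have eta: "0 < \<eta>" using x by (simp add: \<eta>_def)
  obtain e1 where e1: "e1 > 0" "\<forall>\<^sub>F m in sequentially.
      real (card {i. i < card (W m) \<and> lam1 < D m i \<and> D m i \<le> lam1 + e1}) \<le> \<eta> * real (card (\<Lambda> m))"
    using right_count_small[OF eta] by blast
  obtain e2 where e2: "e2 > 0" "\<forall>\<^sub>F m in sequentially.
      real (card {i. i < card (W m) \<and> \<bar>D m i - lam2\<bar> \<le> e2}) \<le> \<eta> * real (card (\<Lambda> m))"
    using near_count_small[OF ne eta] by blast
  define e where "e = min e1 e2"
  have e: "0 < e" "e \<le> e1" "e \<le> e2" using e1(1) e2(1) by (auto simp: e_def)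
  note bb = gap_bounded_below[OF ker lt gap]
  show "\<forall>\<^sub>F m in sequentially. (real (E m lam2) - real (E m lam1)) / real (card (\<Lambda> m)) < x"
    using e1(2) e2(2) eventually_bad_less[OF eta]
  proof eventually_elim
    fix m
    let ?A = "{i. i < card (W m) \<and> lam1 < D m i \<and> D m i \<le> lam1 + e1}"
    let ?B = "{i. i < card (W m) \<and> \<bar>D m i - lam2\<bar> \<le> e2}"
    let ?C = "{i. i < card (W m) \<and> lam1 + e \<le> D m i \<and> D m i \<le> lam2 - e}"
    assume b: "real (card ?A) \<le> \<eta> * real (card (\<Lambda> m))" "real (card ?B) \<le> \<eta> * real (card (\<Lambda> m))"
      "real (card (bad m)) < \<eta> * real (card (\<Lambda> m))"
    have "{i. i < card (W m) \<and> lam1 < D m i \<and> D m i \<le> lam2} \<subseteq> ?A \<union> ?B \<union> ?C" using e by auto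
    then have "card {i. i < card (W m) \<and> lam1 < D m i \<and> D m i \<le> lam2} \<le> card (?A \<union> ?B \<union> ?C)"
      by (intro card_mono) auto
    also have "\<dots> \<le> card ?A + card ?B + card ?C"
      using card_Un_le[of "?A \<union> ?B" ?C] card_Un_le[of ?A ?B] by linarith
    also have "\<dots> \<le> card ?A + card ?B + card (bad m)"
      using interior_count_le_bad[OF bb e(1) lt, of m] by simp
    finally have "real (E m lam2) - real (E m lam1) \<le> real (card ?A) + real (card ?B) + real (card (bad m))"
      using lt by (simp add: E_diff)
    also have "\<dots> < 4 * \<eta> * real (card (\<Lambda> m))" using b eta card_Lam_pos[of m] by linarith
    finally show "(real (E m lam2) - real (E m lam1)) / real (card (\<Lambda> m)) < x"
      using card_Lam_pos[of m] by (simp add: \<eta>_def field_simps)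
  qed
qed

text \<open>Disjoint translates of a finitely supported approximate eigenvector force a positive
  density of eigenvalues near \<open>\<mu>\<close>.\<close>

lemma approximate_eigenvector_count:
  assumes f: "f \<in> finsupp V" "nsq (kernel_op (shift_kernel V a \<mu>) f) < \<rho>\<^sup>2 * nsq f" and \<rho>: "0 < \<rho>"
  shows "\<exists>\<kappa>>0. \<forall>\<^sub>F m in sequentially.
    \<kappa> * real (card (\<Lambda> m)) \<le> real (card {i. i < card (W m) \<and> \<bar>D m i - \<mu>\<bar> < \<rho>})"
proof -
  define r where "r = kernel_op (shift_kernel V a \<mu>) f"
  have fV: "f \<in> funs_on V" by (rule finsuppD(2)[OF f(1)])
  have r: "r = (\<lambda>v. kernel_op a f v - of_real \<mu> * f v)" unfolding r_def by (rule kernel_op_shift[OF ker fV])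
  have rF: "r \<in> finsupp V" unfolding r_def by (rule finsupp_kernel_op[OF hermitian_kernel_shift[OF ker] f(1)])
  define S where "S = {v. f v \<noteq> 0} \<union> {v. r v \<noteq> 0}"
  have S: "finite S" "S \<subseteq> V"
    using finsuppD[OF f(1)] finsuppD[OF rF] by (auto simp: S_def funs_on_def)
  have fS: "f \<in> funs_on S" "r \<in> funs_on S" by (auto simp: S_def funs_on_def)
  have nS: "normsq S r < \<rho>\<^sup>2 * normsq S f"
    using f(2) nsq_eq[OF S(1) fS(1)] nsq_eq[OF S(1) fS(2)] by (simp add: r_def)
  then have Sne: "S \<noteq> {}" by (auto simp: normsq_def)
  have "\<forall>v\<in>S. \<exists>q. q \<in> carrier \<Gamma> \<and> (\<exists>x\<in>FV. v = \<phi> q x)" using S(2) cover by blast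
  then obtain q where q: "\<And>v. v \<in> S \<Longrightarrow> q v \<in> carrier \<Gamma>" "\<And>v. v \<in> S \<Longrightarrow> \<exists>x\<in>FV. v = \<phi> (q v) x"
    by metis
  define Q where "Q = q ` S"
  have Q: "finite Q" "Q \<subseteq> carrier \<Gamma>" "Q \<noteq> {}" using S(1) Sne q(1) by (auto simp: Q_def)
  \<comment> \<open>\<open>Q\<close> holds the group coordinates of the support; the products with
    \<open>H0\<close> ensure that a translate by \<open>G m\<close> lies not only in
    \<open>W m\<close> but also away from \<open>bad m\<close>.\<close>
  define H where "H = Q \<union> (\<lambda>(x, y). x \<otimes> y) ` (Q \<times> H0)"
  have H: "finite H" "H \<subseteq> carrier \<Gamma>" using Q H0 by (auto simp: H_def)
  define G where "G m = {\<gamma>\<in>\<Lambda> m. \<forall>\<eta>\<in>H. \<gamma> \<otimes> \<eta> \<in> \<Lambda> m}" for m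
  have Gf: "finite (G m)" for m using Lam(1)[of m] by (simp add: G_def)
  have GL: "\<gamma> \<in> carrier \<Gamma>" if "\<gamma> \<in> G m" for \<gamma> m using that LamD by (auto simp: G_def)
  define B where "B \<gamma> = \<phi> \<gamma> ` S" for \<gamma>
  have Bsub: "B \<gamma> \<subseteq> W m - bad m" if \<gamma>: "\<gamma> \<in> G m" for \<gamma> m
  proof
    fix w assume "w \<in> B \<gamma>"
    then obtain v where v: "v \<in> S" "w = \<phi> \<gamma> v" by (auto simp: B_def)
    obtain x where x: "x \<in> FV" "v = \<phi> (q v) x" using q(2)[OF v(1)] by blast
    have w: "w = \<phi> (\<gamma> \<otimes> q v) x"
      using v x q(1)[OF v(1)] GL[OF \<gamma>] FVD[OF x(1)] by (simp add: composition_rule)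
    have qQ: "q v \<in> Q" using v(1) by (simp add: Q_def)
    have in\<Lambda>: "\<gamma> \<otimes> q v \<in> \<Lambda> m" using \<gamma> qQ by (simp add: G_def H_def)
    have "\<gamma> \<otimes> q v \<otimes> \<eta> \<in> \<Lambda> m" if "\<eta> \<in> H0" for \<eta>
    proof -
      have "q v \<otimes> \<eta> \<in> H" using qQ that by (force simp: H_def)
      then have "\<gamma> \<otimes> (q v \<otimes> \<eta>) \<in> \<Lambda> m" using \<gamma> by (simp add: G_def)
      then show ?thesis using q(1)[OF v(1)] GL[OF \<gamma>] that H0 by (simp add: m_assoc subset_iff)
    qed
    then have "A m w z = a w z" for z using agree[OF in\<Lambda> _ x(1)] by (simp add: w)
    moreover have "w \<in> W m" using in\<Lambda> x(1) by (auto simp: w W_def)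
    ultimately show "w \<in> W m - bad m" by (simp add: bad_def)
  qed
  \<comment> \<open>Two translates meet only if their group elements differ by a quotient of
    elements of \<open>Q\<close>, which bounds the overlaps uniformly in \<open>m\<close>.\<close>
  have deg: "card {\<eta>\<in>G m. B \<gamma> \<inter> B \<eta> \<noteq> {}} \<le> card Q * card Q" if \<gamma>: "\<gamma> \<in> G m" for \<gamma> m
  proof -
    have "{\<eta>\<in>G m. B \<gamma> \<inter> B \<eta> \<noteq> {}} \<subseteq> (\<lambda>(x, y). \<gamma> \<otimes> x \<otimes> inv y) ` (Q \<times> Q)"
    proof
      fix \<eta> assume "\<eta> \<in> {\<eta>\<in>G m. B \<gamma> \<inter> B \<eta> \<noteq> {}}"
      then obtain v w where e: "\<eta> \<in> G m" "v \<in> S" "w \<in> S" "\<phi> \<gamma> v = \<phi> \<eta> w" by (auto simp: B_def)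
      obtain x y where xy: "x \<in> FV" "v = \<phi> (q v) x" "y \<in> FV" "w = \<phi> (q w) y" using q(2) e(2,3) by blast
      note C = GL[OF \<gamma>] GL[OF e(1)] q(1)[OF e(2)] q(1)[OF e(3)]
      have "\<phi> (\<gamma> \<otimes> q v) x = \<phi> \<gamma> v" using C xy(1,2) FVD by (simp add: composition_rule)
      moreover have "\<phi> (\<eta> \<otimes> q w) y = \<phi> \<eta> w" using C xy(3,4) FVD by (simp add: composition_rule)
      ultimately have "\<gamma> \<otimes> q v = \<eta> \<otimes> q w"
        using C xy e(4) by (intro act_eq_iff(1)[of _ _ x y]) auto
      then have "\<eta> = \<gamma> \<otimes> q v \<otimes> inv (q w)" using C by (simp add: m_assoc)
      then show "\<eta> \<in> (\<lambda>(x, y). \<gamma> \<otimes> x \<otimes> inv y) ` (Q \<times> Q)" using e(2,3) by (force simp: Q_def)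
    qed
    then have "card {\<eta>\<in>G m. B \<gamma> \<inter> B \<eta> \<noteq> {}} \<le> card ((\<lambda>(x, y). \<gamma> \<otimes> x \<otimes> inv y) ` (Q \<times> Q))"
      using Q(1) by (intro card_mono) auto
    also have "\<dots> \<le> card (Q \<times> Q)" using Q(1) by (intro card_image_le) auto
    finally show ?thesis by (simp add: card_cartesian_product)
  qed
  have main: "card (G m) \<le> card Q * card Q * card {i. i < card (W m) \<and> \<bar>D m i - \<mu>\<bar> < \<rho>}" for m
  proof -
    obtain P where P: "P \<subseteq> G m" "\<forall>g\<in>P. \<forall>h\<in>P. g \<noteq> h \<longrightarrow> B g \<inter> B h = {}" "card (G m) \<le> card Q * card Q * card P"
      using ex_pairwise_disjoint_subset[where B = B and G = "G m", OF Gf deg] Sne by (auto simp: B_def)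
    have Pf: "finite P" using P(1) Gf finite_subset by blast
    define N where "N = {i. i < card (W m) \<and> \<bar>D m i - \<mu>\<bar> < \<rho>}"
    define good where "good \<gamma> h \<longleftrightarrow> h \<in> funs_on (B \<gamma>) \<and>
        (\<lambda>v. kernel_op a h v - of_real \<mu> * h v) \<in> funs_on (B \<gamma>) \<and> normsq (W m) h = normsq S f \<and>
        normsq (W m) (\<lambda>v. kernel_op a h v - of_real \<mu> * h v) = normsq S r" for \<gamma> h
    have "\<exists>h. good \<gamma> h" if \<gamma>: "\<gamma> \<in> P" for \<gamma>
    proof -
      have \<gamma>G: "\<gamma> \<in> G m" and \<gamma>c: "\<gamma> \<in> carrier \<Gamma>" using \<gamma> P(1) GL by auto
      obtain h where h: "h \<in> funs_on V" "\<And>v. v \<in> V \<Longrightarrow> cmod (h (\<phi> \<gamma> v)) = cmod (f v)"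
        "\<And>v \<mu>. v \<in> V \<Longrightarrow> cmod (kernel_op a h (\<phi> \<gamma> v) - of_real \<mu> * h (\<phi> \<gamma> v))
          = cmod (kernel_op a f v - of_real \<mu> * f v)"
        by (rule magnetic_translation[OF \<gamma>c fV]) blast
      define k where "k = (\<lambda>v. kernel_op a h v - of_real \<mu> * h v)"
      have hk: "cmod (k (\<phi> \<gamma> v)) = cmod (r v)" if "v \<in> V" for v using h(3)[OF that] by (simp add: k_def r)
      have kV: "k \<in> funs_on V"
        using h(1) kernel_op_in_funs_on[OF ker, of h] by (auto simp: k_def funs_on_def)
      have supp: "g' \<in> funs_on (B \<gamma>)"
        if g': "g' \<in> funs_on V" "\<And>v. v \<in> V \<Longrightarrow> cmod (g' (\<phi> \<gamma> v)) = cmod (g v)" "g \<in> funs_on S" for g' g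
        unfolding funs_on_def
      proof (intro CollectI allI impI)
        fix v assume v: "v \<notin> B \<gamma>"
        show "g' v = 0"
        proof (cases "v \<in> V")
          case True
          have "\<phi> (inv \<gamma>) v \<notin> S"
          proof
            assume "\<phi> (inv \<gamma>) v \<in> S"
            then have "\<phi> \<gamma> (\<phi> (inv \<gamma>) v) \<in> B \<gamma>" unfolding B_def by (rule imageI)
            then show False using v act_inv'[OF \<gamma>c True] by simp
          qed
          then have "g (\<phi> (inv \<gamma>) v) = 0" using g'(3) by (simp add: funs_on_def)
          then show ?thesis
            using g'(2)[of "\<phi> (inv \<gamma>) v"] True \<gamma>c act_inv'[OF \<gamma>c True] by (simp add: act_closed)
        qed (use g'(1) in \<open>simp add: funs_on_def\<close>)
      qed
      have hB: "h \<in> funs_on (B \<gamma>)" by (rule supp[OF h(1,2) fS(1)])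
      have kB: "k \<in> funs_on (B \<gamma>)" by (rule supp[OF kV hk fS(2)])
      have BW: "B \<gamma> \<subseteq> W m" using Bsub[OF \<gamma>G] by blast
      have "normsq (W m) h = normsq S f"
        using normsq_superset[OF W_finite BW hB] normsq_image[where h = h and f = f, OF \<gamma>c S(2) h(2)]
        by (simp add: B_def)
      moreover have "normsq (W m) k = normsq S r"
        using normsq_superset[OF W_finite BW kB] normsq_image[where h = k and f = r, OF \<gamma>c S(2) hk]
        by (simp add: B_def)
      ultimately have "good \<gamma> h" using hB kB unfolding k_def good_def by blast
      then show ?thesis by blast
    qed
    then obtain h where gd: "\<And>\<gamma>. \<gamma> \<in> P \<Longrightarrow> good \<gamma> (h \<gamma>)" by metis
    have h: "\<And>\<gamma>. \<gamma> \<in> P \<Longrightarrow> h \<gamma> \<in> funs_on (B \<gamma>)"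
      "\<And>\<gamma>. \<gamma> \<in> P \<Longrightarrow> (\<lambda>v. kernel_op a (h \<gamma>) v - of_real \<mu> * h \<gamma> v) \<in> funs_on (B \<gamma>)"
      "\<And>\<gamma>. \<gamma> \<in> P \<Longrightarrow> normsq (W m) (h \<gamma>) = normsq S f"
      "\<And>\<gamma>. \<gamma> \<in> P \<Longrightarrow> normsq (W m) (\<lambda>v. kernel_op a (h \<gamma>) v - of_real \<mu> * h \<gamma> v) = normsq S r"
      using gd unfolding good_def by blast+
    define k where "k \<gamma> = (\<lambda>v. kernel_op a (h \<gamma>) v - of_real \<mu> * h \<gamma> v)" for \<gamma>
    have orth: "inner_on (W m) (g \<gamma>) (g \<eta>) = 0"
      if "\<gamma> \<in> P" "\<eta> \<in> P" "\<gamma> \<noteq> \<eta>" "\<And>\<gamma>. \<gamma> \<in> P \<Longrightarrow> g \<gamma> \<in> funs_on (B \<gamma>)" for g \<gamma> \<eta>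
    proof -
      have "g \<gamma> v * cnj (g \<eta> v) = 0" for v
      proof -
        have "v \<notin> B \<gamma> \<or> v \<notin> B \<eta>" using P(2) that(1-3) by blast
        then show ?thesis
          using that(4)[OF that(1)] that(4)[OF that(2)] by (auto simp: funs_on_def)
      qed
      then show ?thesis unfolding inner_on_def by (intro sum.neutral ballI)
    qed
    have oh: "inner_on (W m) (h \<gamma>) (h \<eta>) = 0" and ok: "inner_on (W m) (k \<gamma>) (k \<eta>) = 0"
      if "\<gamma> \<in> P" "\<eta> \<in> P" "\<gamma> \<noteq> \<eta>" for \<gamma> \<eta>
      using orth[where g = h, OF that h(1)] orth[where g = k, OF that] h(2) by (simp_all add: k_def)
    \<comment> \<open>The disjoint translates are orthogonal, and so are their residuals, so the
      strict inequality for \<open>f\<close> passes to every nontrivial combination. With more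
      translates than eigenvalues in the window, some combination would be orthogonal to all window
      eigenvectors and satisfy the opposite inequality.\<close>
    have "card P \<le> card N"
    proof (rule ccontr)
      assume "\<not> card P \<le> card N"
      moreover have Nf: "finite N" by (simp add: N_def)
      ultimately obtain x where x: "\<exists>\<gamma>\<in>P. x \<gamma> \<noteq> 0" "\<forall>i\<in>N. (\<Sum>\<gamma>\<in>P. inner_on (W m) (h \<gamma>) (U m i) * x \<gamma>) = 0"
        using homogeneous_system_nontrivial[OF Nf Pf, of "\<lambda>i \<gamma>. inner_on (W m) (h \<gamma>) (U m i)"] by auto
      define F where "F = (\<lambda>v. \<Sum>\<gamma>\<in>P. x \<gamma> * h \<gamma> v)"
      have FB: "F v = 0" if "v \<notin> W m - bad m" for v
      proof -
        have "h \<gamma> v = 0" if "\<gamma> \<in> P" for \<gamma>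
        proof -
          have "v \<notin> B \<gamma>" using Bsub[of \<gamma> m] P(1) that \<open>v \<notin> W m - bad m\<close> by blast
          then show ?thesis using h(1)[OF that] by (simp add: funs_on_def)
        qed
        then show ?thesis by (simp add: F_def)
      qed
      have FW: "F \<in> funs_on (W m)" using FB by (simp add: funs_on_def)
      have "(\<lambda>v. kernel_op (A m) F v - of_real \<mu> * F v) = (\<lambda>v. kernel_op a F v - of_real \<mu> * F v)"
        using op_agree[OF FW] FB by simp
      also have "\<dots> = (\<lambda>v. \<Sum>\<gamma>\<in>P. x \<gamma> * k \<gamma> v)"
        unfolding F_def kernel_op_sum k_def sum_distrib_left sum_subtractf[symmetric]
        by (intro ext sum.cong) (auto simp: algebra_simps)
      finally have kF: "(\<lambda>v. kernel_op (A m) F v - of_real \<mu> * F v) = (\<lambda>v. \<Sum>\<gamma>\<in>P. x \<gamma> * k \<gamma> v)" .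
      have nF: "normsq (W m) F = (\<Sum>\<gamma>\<in>P. (cmod (x \<gamma>))\<^sup>2 * normsq S f)"
        unfolding F_def by (subst orthogonal_normsq_sum[OF Pf oh]) (use h in auto)
      have nk: "normsq (W m) (\<lambda>v. \<Sum>\<gamma>\<in>P. x \<gamma> * k \<gamma> v) = (\<Sum>\<gamma>\<in>P. (cmod (x \<gamma>))\<^sup>2 * normsq S r)"
        by (subst orthogonal_normsq_sum[OF Pf ok]) (use h in \<open>auto simp: k_def\<close>)
      have "\<rho>\<^sup>2 * normsq (W m) F = (\<Sum>i<card (W m). (cmod (inner_on (W m) F (U m i)))\<^sup>2 * \<rho>\<^sup>2)"
        unfolding spectral_combination(1)[OF kerA' W_finite basis' FW] sum_distrib_left by (simp add: mult.commute)
      also have "\<dots> \<le> (\<Sum>i<card (W m). (cmod (inner_on (W m) F (U m i)))\<^sup>2 * (D m i - \<mu>)\<^sup>2)"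
      proof (rule sum_mono)
        fix i assume i: "i \<in> {..<card (W m)}"
        show "(cmod (inner_on (W m) F (U m i)))\<^sup>2 * \<rho>\<^sup>2 \<le> (cmod (inner_on (W m) F (U m i)))\<^sup>2 * (D m i - \<mu>)\<^sup>2"
        proof (cases "i \<in> N")
          case True
          then have "inner_on (W m) F (U m i) = 0"
            using x(2) by (simp add: F_def inner_on_sum_left mult.commute)
          then show ?thesis by simp
        next
          case False
          then have "\<rho> \<le> \<bar>D m i - \<mu>\<bar>" using i by (auto simp: N_def)
          then have "\<rho>\<^sup>2 \<le> \<bar>D m i - \<mu>\<bar>\<^sup>2" using \<rho> by (intro power_mono) auto
          then show ?thesis by (simp add: mult_left_mono)
        qed
      qed
      also have "\<dots> = (\<Sum>\<gamma>\<in>P. (cmod (x \<gamma>))\<^sup>2 * normsq S r)"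
        unfolding spectral_combination(2)[OF kerA' W_finite basis' FW, symmetric] kF nk ..
      finally have "\<rho>\<^sup>2 * normsq S f * (\<Sum>\<gamma>\<in>P. (cmod (x \<gamma>))\<^sup>2) \<le> normsq S r * (\<Sum>\<gamma>\<in>P. (cmod (x \<gamma>))\<^sup>2)"
        unfolding nF sum_distrib_right[symmetric] by (simp add: mult_ac)
      moreover have "0 < (\<Sum>\<gamma>\<in>P. (cmod (x \<gamma>))\<^sup>2)"
        using x(1) Pf by (auto intro: sum_pos2)
      ultimately show False using nS by simp
    qed
    then have "card Q * card Q * card P \<le> card Q * card Q * card N" by simp
    then show ?thesis using P(3) unfolding N_def by linarith
  qed
  \<comment> \<open>Eventually at least half of \<open>\<Lambda> m\<close> lies in
    \<open>G m\<close>, and the disjoint selection keeps a fraction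
    \<open>1 / (card Q)\<^sup>2\<close> of it.\<close>
  define \<kappa> where "\<kappa> = 1 / (2 * (real (card Q))\<^sup>2)"
  have cQ: "0 < card Q" using Q by (simp add: card_gt_0_iff)
  have \<kappa>0: "\<kappa> > 0" using cQ by (simp add: \<kappa>_def)
  have half: "\<forall>\<^sub>F m in sequentially.
      real (card {\<gamma>\<in>\<Lambda> m. \<exists>\<eta>\<in>H. \<gamma> \<otimes> \<eta> \<notin> \<Lambda> m}) / real (card (\<Lambda> m)) < 1 / 2"
    by (rule order_tendstoD(2)[OF folner[OF H]]) simp
  have "\<forall>\<^sub>F m in sequentially.
    \<kappa> * real (card (\<Lambda> m)) \<le> real (card {i. i < card (W m) \<and> \<bar>D m i - \<mu>\<bar> < \<rho>})"
    using half
  proof eventually_elim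
    fix m
    let ?B = "{\<gamma>\<in>\<Lambda> m. \<exists>\<eta>\<in>H. \<gamma> \<otimes> \<eta> \<notin> \<Lambda> m}"
    let ?N = "{i. i < card (W m) \<and> \<bar>D m i - \<mu>\<bar> < \<rho>}"
    assume "real (card ?B) / real (card (\<Lambda> m)) < 1 / 2"
    then have b: "real (card ?B) * 2 < real (card (\<Lambda> m))" using card_Lam_pos[of m] by (simp add: field_simps)
    have "\<Lambda> m = G m \<union> ?B" by (auto simp: G_def)
    then have "card (\<Lambda> m) = card (G m \<union> ?B)" by (rule arg_cong)
    then have "card (\<Lambda> m) \<le> card (G m) + card ?B" using card_Un_le[of "G m" ?B] by linarith
    then have "real (card (\<Lambda> m)) \<le> 2 * real (card (G m))" using b by linarith
    also have "real (card (G m)) \<le> (real (card Q))\<^sup>2 * real (card ?N)"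
      using main[of m] by (simp add: power2_eq_square flip: of_nat_mult)
    finally have "real (card (\<Lambda> m)) \<le> 2 * ((real (card Q))\<^sup>2 * real (card ?N))" by simp
    then show "\<kappa> * real (card (\<Lambda> m)) \<le> real (card ?N)"
      using cQ by (simp add: \<kappa>_def field_simps)
  qed
  then show ?thesis using \<kappa>0 by blast
qed

text \<open>\<rho> is the distance from \<mu> to the ends. If even \<open>\<rho>\<^sup>2\<close>
  fails as a lower bound at \<mu>, the witness is an approximate eigenvector whose window stays
  inside the interval, and the positive density it forces contradicts the limit.\<close>

theorem limit_imp_gap:
  assumes lim: "(\<lambda>m. (real (E m lam2) - real (E m lam1)) / real (card (\<Lambda> m))) \<longlonglongrightarrow> 0"
    and \<mu>: "lam1 < \<mu>" "\<mu> < lam2"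
  shows "\<exists>\<epsilon>>0. bounded_below V (shift_kernel V a \<mu>) \<epsilon>"
proof (rule ccontr)
  assume neg: "\<not> ?thesis"
  define \<rho> where "\<rho> = min (\<mu> - lam1) (lam2 - \<mu>)"
  have \<rho>: "0 < \<rho>" using \<mu> by (simp add: \<rho>_def)
  then have "\<not> bounded_below V (shift_kernel V a \<mu>) (\<rho>\<^sup>2)" using neg by auto
  then obtain f where "f \<in> finsupp V" "nsq (kernel_op (shift_kernel V a \<mu>) f) < \<rho>\<^sup>2 * nsq f"
    by (auto simp: bounded_below_def not_le)
  from approximate_eigenvector_count[OF this \<rho>] obtain \<kappa> where \<kappa>: "\<kappa> > 0"
    "\<forall>\<^sub>F m in sequentially. \<kappa> * real (card (\<Lambda> m)) \<le> real (card {i. i < card (W m) \<and> \<bar>D m i - \<mu>\<bar> < \<rho>})"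
    by blast
  have "\<forall>\<^sub>F m in sequentially. False"
    using \<kappa>(2) order_tendstoD(2)[OF lim \<kappa>(1)]
  proof eventually_elim
    fix m
    assume 1: "\<kappa> * real (card (\<Lambda> m)) \<le> real (card {i. i < card (W m) \<and> \<bar>D m i - \<mu>\<bar> < \<rho>})"
      and 2: "(real (E m lam2) - real (E m lam1)) / real (card (\<Lambda> m)) < \<kappa>"
    have "card {i. i < card (W m) \<and> \<bar>D m i - \<mu>\<bar> < \<rho>} \<le> card {i. i < card (W m) \<and> lam1 < D m i \<and> D m i \<le> lam2}"
      by (intro card_mono) (auto simp: \<rho>_def)
    then have "\<kappa> * real (card (\<Lambda> m)) \<le> real (E m lam2) - real (E m lam1)"
      using 1 \<mu> E_diff[of lam1 lam2 m] by simp
    then show False using 2 card_Lam_pos[of m] by (simp add: field_simps)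
  qed
  then show False by simp
qed

end

section \<open>Word metrics\<close>

lemma word_length_one: "word_length G S \<one>\<^bsub>G\<^esub> = 0"
  unfolding word_length_def by (rule Least_equality) auto

lemma generate_word:
  assumes G: "group G" and S: "S \<subseteq> carrier G" and x: "x \<in> generate G S"
  shows "\<exists>ws. set ws \<subseteq> S \<union> m_inv G ` S \<and> x = foldr (\<otimes>\<^bsub>G\<^esub>) ws \<one>\<^bsub>G\<^esub>"
proof -
  interpret group G by fact
  let ?T = "S \<union> m_inv G ` S"
  have T: "?T \<subseteq> carrier G" using S by auto
  have closed: "foldr (\<otimes>\<^bsub>G\<^esub>) ws \<one>\<^bsub>G\<^esub> \<in> carrier G" if "set ws \<subseteq> ?T" for ws
    using that T by (induction ws) auto
  have app: "foldr (\<otimes>\<^bsub>G\<^esub>) (ws @ ws') \<one>\<^bsub>G\<^esub> = foldr (\<otimes>\<^bsub>G\<^esub>) ws \<one>\<^bsub>G\<^esub> \<otimes>\<^bsub>G\<^esub> foldr (\<otimes>\<^bsub>G\<^esub>) ws' \<one>\<^bsub>G\<^esub>"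
    if "set ws \<subseteq> ?T" "set ws' \<subseteq> ?T" for ws ws'
    using that(1)
  proof (induction ws)
    case Nil
    then show ?case using closed[OF that(2)] by simp
  next
    case (Cons y ws)
    then have "y \<in> carrier G" "set ws \<subseteq> ?T" using T by auto
    then show ?case using Cons.IH closed that(2) by (simp add: m_assoc)
  qed
  show ?thesis
    using x
  proof (induction rule: generate.induct)
    case one
    show ?case by (rule exI[of _ "[]"]) simp
  next
    case (incl h)
    then show ?case using S by (intro exI[of _ "[h]"]) auto
  next
    case (inv h)
    then show ?case using S by (intro exI[of _ "[inv\<^bsub>G\<^esub> h]"]) auto
  next
    case (eng h1 h2)
    then obtain ws ws' where "set ws \<subseteq> ?T" "h1 = foldr (\<otimes>\<^bsub>G\<^esub>) ws \<one>\<^bsub>G\<^esub>"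
      "set ws' \<subseteq> ?T" "h2 = foldr (\<otimes>\<^bsub>G\<^esub>) ws' \<one>\<^bsub>G\<^esub>" by blast
    then show ?case using app by (intro exI[of _ "ws @ ws'"]) auto
  qed
qed

lemma finite_word_ball:
  assumes G: "group G" and S: "finite S" "S \<subseteq> carrier G" "generate G S = carrier G"
  shows "finite {x \<in> carrier G. real (word_length G S x) < r}"
proof -
  let ?T = "S \<union> m_inv G ` S"
  have "{x \<in> carrier G. real (word_length G S x) < r}
      \<subseteq> (\<lambda>ws. foldr (\<otimes>\<^bsub>G\<^esub>) ws \<one>\<^bsub>G\<^esub>) ` {ws. set ws \<subseteq> ?T \<and> length ws \<le> nat \<lceil>r\<rceil>}"
  proof safe
    fix x assume x: "x \<in> carrier G" "real (word_length G S x) < r"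
    then obtain ws0 where "set ws0 \<subseteq> ?T" "x = foldr (\<otimes>\<^bsub>G\<^esub>) ws0 \<one>\<^bsub>G\<^esub>"
      using generate_word[OF G S(2), of x] S(3) by auto
    then have "\<exists>n ws. length ws = n \<and> set ws \<subseteq> ?T \<and> x = foldr (\<otimes>\<^bsub>G\<^esub>) ws \<one>\<^bsub>G\<^esub>" by blast
    from LeastI_ex[OF this] obtain ws where "length ws = word_length G S x" "set ws \<subseteq> ?T"
      "x = foldr (\<otimes>\<^bsub>G\<^esub>) ws \<one>\<^bsub>G\<^esub>" by (auto simp: word_length_def)
    moreover have "word_length G S x \<le> nat \<lceil>r\<rceil>" using x(2) by linarith
    ultimately show "x \<in> (\<lambda>ws. foldr (\<otimes>\<^bsub>G\<^esub>) ws \<one>\<^bsub>G\<^esub>) ` {ws. set ws \<subseteq> ?T \<and> length ws \<le> nat \<lceil>r\<rceil>}"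
      by auto
  qed
  moreover have "finite {ws. set ws \<subseteq> ?T \<and> length ws \<le> nat \<lceil>r\<rceil>}"
    using S(1) by (intro finite_lists_length_le) auto
  ultimately show ?thesis using finite_surj by blast
qed

text \<open>Needed for comparing cardinalities, since an infinite boundary would have
  \<open>card\<close> equal to 0. It rests on the finiteness of balls in the word metric.\<close>

lemma finite_group_boundary:
  assumes G: "group G" and S: "finite S" "S \<subseteq> carrier G" "generate G S = carrier G"
    and A: "finite A" "A \<subseteq> carrier G"
  shows "finite (group_boundary G S r A)"
proof -
  interpret group G by fact
  have "group_boundary G S r A
      \<subseteq> (\<lambda>(\<eta>, x). \<eta> \<otimes>\<^bsub>G\<^esub> inv\<^bsub>G\<^esub> x) ` (A \<times> {x \<in> carrier G. real (word_length G S x) < r})"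
  proof
    fix \<gamma> assume "\<gamma> \<in> group_boundary G S r A"
    then obtain \<eta> where e: "\<gamma> \<in> carrier G" "\<eta> \<in> A" "word_dist G S \<gamma> \<eta> < r"
      by (auto simp: group_boundary_def)
    then have "\<gamma> = \<eta> \<otimes>\<^bsub>G\<^esub> inv\<^bsub>G\<^esub> (inv\<^bsub>G\<^esub> \<gamma> \<otimes>\<^bsub>G\<^esub> \<eta>)"
      using A(2) by (simp add: inv_mult_group m_assoc[symmetric] subset_iff)
    then show "\<gamma> \<in> (\<lambda>(\<eta>, x). \<eta> \<otimes>\<^bsub>G\<^esub> inv\<^bsub>G\<^esub> x) ` (A \<times> {x \<in> carrier G. real (word_length G S x) < r})"
      using e A(2) by (intro image_eqI[of _ _ "(\<eta>, inv\<^bsub>G\<^esub> \<gamma> \<otimes>\<^bsub>G\<^esub> \<eta>)"]) (auto simp: word_dist_def)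
  qed
  then show ?thesis
    by (rule finite_subset) (use A(1) finite_word_ball[OF G S, of r] in auto)
qed

text \<open>Right multiplication by \<eta> moves a point by the word length of \<eta>, so an element
  of \<open>\<Lambda> m\<close> that leaves it in this way belongs to the boundary of width
  \<delta>. One plus the sum of all lengths is a strict bound for each of them.\<close>

lemma regular_exhaustion_folner:
  assumes G: "group G" and S: "finite S" "S \<subseteq> carrier G" "generate G S = carrier G"
    and reg: "regular_exhaustion G S \<Lambda>" and H: "finite H" "H \<subseteq> carrier G"
  shows "(\<lambda>m. real (card {\<gamma>\<in>\<Lambda> m. \<exists>\<eta>\<in>H. \<gamma> \<otimes>\<^bsub>G\<^esub> \<eta> \<notin> \<Lambda> m}) / real (card (\<Lambda> m))) \<longlonglongrightarrow> 0"
proof -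
  interpret group G by fact
  define \<delta> where "\<delta> = 1 + real (\<Sum>\<eta>\<in>H. word_length G S \<eta>)"
  have \<delta>: "0 < \<delta>" by (simp add: \<delta>_def add_pos_nonneg sum_nonneg)
  have L: "finite (\<Lambda> m)" "\<Lambda> m \<subseteq> carrier G" for m
    using reg by (auto simp: regular_exhaustion_def)
  have lim: "(\<lambda>m. real (card (group_boundary G S \<delta> (\<Lambda> m))) / real (card (\<Lambda> m))) \<longlonglongrightarrow> 0"
    using reg \<delta> by (auto simp: regular_exhaustion_def)
  have small: "word_dist G S \<gamma> (\<gamma> \<otimes>\<^bsub>G\<^esub> \<eta>) < \<delta>" if "\<gamma> \<in> carrier G" "\<eta> \<in> H" for \<gamma> \<eta>
  proof -
    have e: "inv\<^bsub>G\<^esub> \<gamma> \<otimes>\<^bsub>G\<^esub> (\<gamma> \<otimes>\<^bsub>G\<^esub> \<eta>) = \<eta>" using that H by (simp add: m_assoc[symmetric] subset_iff)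
    have "word_length G S \<eta> \<le> (\<Sum>\<eta>\<in>H. word_length G S \<eta>)"
      using that H by (intro member_le_sum) auto
    then have "real (word_length G S \<eta>) \<le> real (\<Sum>\<eta>\<in>H. word_length G S \<eta>)"
      by (simp only: of_nat_le_iff)
    then show ?thesis by (simp add: e word_dist_def \<delta>_def del: of_nat_sum)
  qed
  have self: "word_dist G S \<gamma> \<gamma> < \<delta>" if "\<gamma> \<in> carrier G" for \<gamma>
    using that \<delta> by (simp add: word_dist_def word_length_one)
  have sub: "{\<gamma>\<in>\<Lambda> m. \<exists>\<eta>\<in>H. \<gamma> \<otimes>\<^bsub>G\<^esub> \<eta> \<notin> \<Lambda> m} \<subseteq> group_boundary G S \<delta> (\<Lambda> m)" for m
  proof
    fix \<gamma> assume "\<gamma> \<in> {\<gamma>\<in>\<Lambda> m. \<exists>\<eta>\<in>H. \<gamma> \<otimes>\<^bsub>G\<^esub> \<eta> \<notin> \<Lambda> m}"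
    then obtain \<eta> where e: "\<gamma> \<in> \<Lambda> m" "\<eta> \<in> H" "\<gamma> \<otimes>\<^bsub>G\<^esub> \<eta> \<notin> \<Lambda> m" by blast
    have c: "\<gamma> \<in> carrier G" "\<gamma> \<otimes>\<^bsub>G\<^esub> \<eta> \<in> carrier G - \<Lambda> m" using e L(2)[of m] H by auto
    then show "\<gamma> \<in> group_boundary G S \<delta> (\<Lambda> m)"
      unfolding group_boundary_def using self[OF c(1)] small[OF c(1) e(2)] e(1) by blast
  qed
  show ?thesis
  proof (rule tendsto_sandwich[OF _ _ tendsto_const lim])
    show "\<forall>\<^sub>F m in sequentially. real (card {\<gamma>\<in>\<Lambda> m. \<exists>\<eta>\<in>H. \<gamma> \<otimes>\<^bsub>G\<^esub> \<eta> \<notin> \<Lambda> m}) / real (card (\<Lambda> m))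
        \<le> real (card (group_boundary G S \<delta> (\<Lambda> m))) / real (card (\<Lambda> m))"
      using card_mono[OF finite_group_boundary[OF G S L] sub]
      by (intro always_eventually allI divide_right_mono) auto
  qed auto
qed

section \<open>Magnetic Laplacians\<close>

locale weighted_action = free_graph_action \<Gamma> X arev \<phi> \<psi>
  for \<Gamma> :: "('g, 'r) monoid_scheme" (structure) and X :: "('v, 'e) pre_digraph" and arev \<phi> \<psi> +
  fixes FV :: "'v set" and FE :: "'e set set" and \<sigma> :: "'e \<Rightarrow> complex" and n :: nat
  assumes dom: "fundamental_domain \<Gamma> X arev \<phi> \<psi> FV FE"
    and weight: "weight_function X arev \<sigma>"
    and winv: "weakly_invariant \<Gamma> X \<psi> \<sigma>"
    and n: "0 < n" and root: "\<And>e. e \<in> arcs X \<Longrightarrow> \<sigma> e ^ n = 1"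
begin

lemma FV: "finite FV" "FV \<subseteq> verts X"
  using dom by (auto simp: fundamental_domain_def)

lemma FE_arcs: "\<Union>FE \<subseteq> arcs X"
  using dom by (auto simp: fundamental_domain_def uedges_def)

lemma FE_finite: "finite (\<Union>FE)"
  using dom by (intro finite_Union) (auto simp: fundamental_domain_def uedges_def)

lemma group_Gamma: "group \<Gamma>"
  using V.group_hom by (simp add: group_hom_def)

lemma vert_cover: "v \<in> verts X \<Longrightarrow> \<exists>\<gamma>\<in>carrier \<Gamma>. \<exists>x\<in>FV. v = \<phi> \<gamma> x"
proof -
  interpret group \<Gamma> by (rule group_Gamma)
  assume v: "v \<in> verts X"
  then obtain x where "x \<in> FV" "x \<in> Group_Action.orbit \<Gamma> \<phi> v"
    using dom by (auto simp: fundamental_domain_def)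
  then obtain \<gamma> where g: "\<gamma> \<in> carrier \<Gamma>" "x = \<phi> \<gamma> v" by (auto simp: Group_Action.orbit_def)
  then have "v = \<phi> (inv \<gamma>) x" using V.orbit_sym_aux[OF g(1) v] by simp
  then show ?thesis using g \<open>x \<in> FV\<close> by (intro bexI[of _ "inv \<gamma>"] bexI[of _ x]) auto
qed

lemma FV_unique:
  assumes "\<gamma> \<in> carrier \<Gamma>" "x \<in> FV" "y \<in> FV" "\<phi> \<gamma> x = y"
  shows "x = y"
proof -
  have x: "x \<in> verts X" using assms FV by auto
  have "x \<in> FV \<inter> Group_Action.orbit \<Gamma> \<phi> x" "y \<in> FV \<inter> Group_Action.orbit \<Gamma> \<phi> x"
    using assms V.orbit_refl[OF x] by (auto simp: Group_Action.orbit_def)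
  then show ?thesis using dom x unfolding fundamental_domain_def by blast
qed

lemma arc_cover:
  assumes e: "e \<in> arcs X"
  shows "\<exists>\<gamma>\<in>carrier \<Gamma>. \<exists>e0\<in>\<Union>FE. e = \<psi> \<gamma> e0"
proof -
  interpret group \<Gamma> by (rule group_Gamma)
  have "{e, arev e} \<in> uedges X arev" using e by (auto simp: uedges_def)
  moreover have "\<forall>u\<in>uedges X arev. \<exists>!u'. u' \<in> FE \<inter> Group_Action.orbit \<Gamma> (\<lambda>\<gamma>. image (\<psi> \<gamma>)) u"
    using dom by (simp add: fundamental_domain_def)
  ultimately obtain u where "u \<in> FE" "u \<in> Group_Action.orbit \<Gamma> (\<lambda>\<gamma>. image (\<psi> \<gamma>)) {e, arev e}"
    by (meson IntD1 IntD2 ex1_implies_ex)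
  then obtain \<gamma> where g: "\<gamma> \<in> carrier \<Gamma>" "u = \<psi> \<gamma> ` {e, arev e}" by (auto simp: Group_Action.orbit_def)
  then have "\<psi> \<gamma> e \<in> \<Union>FE" using \<open>u \<in> FE\<close> by blast
  moreover have "e = \<psi> (inv \<gamma>) (\<psi> \<gamma> e)" using E.orbit_sym_aux[OF g(1) e refl] by simp
  ultimately show ?thesis using g by (intro bexI[of _ "inv \<gamma>"] bexI[of _ "\<psi> \<gamma> e"]) auto
qed

lemma vert_act_eq:
  assumes "\<gamma> \<in> carrier \<Gamma>" "\<eta> \<in> carrier \<Gamma>" "v \<in> verts X" "\<phi> \<gamma> v = \<phi> \<eta> v"
  shows "\<gamma> = \<eta>"
proof -
  interpret group \<Gamma> by (rule group_Gamma)
  have "\<phi> (inv \<eta> \<otimes> \<gamma>) v = v"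
    using assms V.composition_rule V.orbit_sym_aux[of \<eta> v] by simp
  then have "inv \<eta> \<otimes> \<gamma> = \<one>" using free_verts assms by simp
  then show ?thesis using assms by (metis inv_equality inv_inv inv_closed)
qed

text \<open>A uniform bound for the valences. The degree and the incident edges together bound all
  absolute row sums by \<open>2 * N\<close>, for the full graph and for every restriction.\<close>

definition N :: nat where "N = card (\<Union>FE)"

text \<open>Freeness on the vertices makes \<open>e \<mapsto> e\<^sub>0\<close> injective on the edges ending in \<open>v\<close>.\<close>

lemma in_arcs_bound: "finite (in_arcs X v)" "card (in_arcs X v) \<le> N"
proof -
  define sel where "sel e = (SOME e0. e0 \<in> \<Union>FE \<and> (\<exists>\<gamma>\<in>carrier \<Gamma>. e = \<psi> \<gamma> e0))" for e
  have sel: "sel e \<in> \<Union>FE \<and> (\<exists>\<gamma>\<in>carrier \<Gamma>. e = \<psi> \<gamma> (sel e))" if "e \<in> arcs X" for e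
    unfolding sel_def by (rule someI_ex) (use arc_cover[OF that] in blast)
  have inj: "inj_on sel (in_arcs X v)"
  proof (rule inj_onI)
    fix e e' assume e: "e \<in> in_arcs X v" "e' \<in> in_arcs X v" "sel e = sel e'"
    have eX: "e \<in> arcs X" "e' \<in> arcs X" using e by auto
    obtain \<gamma> \<eta> where g: "\<gamma> \<in> carrier \<Gamma>" "e = \<psi> \<gamma> (sel e)" "\<eta> \<in> carrier \<Gamma>" "e' = \<psi> \<eta> (sel e)"
      using sel[OF eX(1)] sel[OF eX(2)] unfolding e(3) by blast
    have s: "sel e \<in> arcs X" using sel[of e] e(1) FE_arcs by auto
    have "\<phi> \<gamma> (head X (sel e)) = \<phi> \<eta> (head X (sel e))"
      using head_act[OF g(1) s] head_act[OF g(3) s] g e(1,2) by (metis in_in_arcs_conv)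
    then have "\<gamma> = \<eta>" using s by (intro vert_act_eq[OF g(1,3), of "head X (sel e)"]) auto
    then show "e = e'" using g by metis
  qed
  have im: "sel ` in_arcs X v \<subseteq> \<Union>FE" using sel by auto
  show "finite (in_arcs X v)" using inj_on_finite[OF inj im FE_finite] .
  show "card (in_arcs X v) \<le> N" unfolding N_def by (rule card_inj_on_le[OF inj im FE_finite])
qed

section \<open>Kernels of weighted subgraphs\<close>

definition graph_kernel :: "'v set \<Rightarrow> ('v \<Rightarrow> nat) \<Rightarrow> 'e set \<Rightarrow> 'v \<Rightarrow> 'v \<Rightarrow> complex" where
  "graph_kernel W d Y v w = (if v = w \<and> v \<in> W then of_nat (d v) else 0)
     - (\<Sum>e | e \<in> Y \<and> head X e = v \<and> tail X e = w. \<sigma> e)"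

text \<open>Edges are counted by their weight, and the diagonal degree belongs to
  \<open>z = 1\<close>. Roots of unity satisfy integral linear relations, so the kernel entry alone
  does not determine these counts.\<close>

definition graph_coeff :: "'v set \<Rightarrow> ('v \<Rightarrow> nat) \<Rightarrow> 'e set \<Rightarrow> 'v \<Rightarrow> 'v \<Rightarrow> complex \<Rightarrow> int" where
  "graph_coeff W d Y v w z = (if v = w \<and> v \<in> W \<and> z = 1 then int (d v) else 0)
     - int (card {e. e \<in> Y \<and> head X e = v \<and> tail X e = w \<and> \<sigma> e = z})"

text \<open>One set of conditions for the full graph and both restrictions. \<open>d\<close> is a
  separate parameter because the Dirichlet restriction drops edges but keeps the valences of the
  whole graph.\<close>

definition admissible :: "'v set \<Rightarrow> ('v \<Rightarrow> nat) \<Rightarrow> 'e set \<Rightarrow> bool" where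
  "admissible W d Y \<longleftrightarrow> Y \<subseteq> arcs X \<and> (\<forall>e\<in>Y. arev e \<in> Y) \<and> (\<forall>e\<in>Y. head X e \<in> W \<and> tail X e \<in> W) \<and>
     (\<forall>v. d v \<le> N)"

lemma roots_finite: "finite {z::complex. z ^ n = 1}"
  using n by (intro finite_roots_unity) simp

lemma in_Y:
  assumes "admissible W d Y"
  shows "finite {e \<in> Y. head X e = v}" "card {e \<in> Y. head X e = v} \<le> N"
proof -
  have sub: "{e \<in> Y. head X e = v} \<subseteq> in_arcs X v"
    using assms by (auto simp: admissible_def)
  show "finite {e \<in> Y. head X e = v}" using finite_subset[OF sub in_arcs_bound(1)] .
  show "card {e \<in> Y. head X e = v} \<le> N"
    using card_mono[OF in_arcs_bound(1) sub] in_arcs_bound(2)[of v] by linarith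
qed

lemma graph_kernel_coeff:
  assumes Y: "admissible W d Y"
  shows "graph_kernel W d Y v w = (\<Sum>z | z ^ n = 1. of_int (graph_coeff W d Y v w z) * z)"
proof -
  let ?S = "{e. e \<in> Y \<and> head X e = v \<and> tail X e = w}"
  have S: "finite ?S" by (rule finite_subset[OF _ in_Y(1)[OF Y, of v]]) auto
  have "(\<Sum>z | z ^ n = 1. of_int (graph_coeff W d Y v w z) * z)
      = (\<Sum>z::complex | z ^ n = 1. (if z = 1 then (if v = w \<and> v \<in> W then of_nat (d v) else 0) else 0))
        - (\<Sum>z | z ^ n = 1. of_nat (card {e\<in>?S. \<sigma> e = z}) * z)"
    unfolding sum_subtractf[symmetric]
    by (intro sum.cong) (auto simp: graph_coeff_def algebra_simps)
  also have "(\<Sum>z::complex | z ^ n = 1. (if z = 1 then (if v = w \<and> v \<in> W then of_nat (d v) else 0) else 0))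
      = (if v = w \<and> v \<in> W then complex_of_nat (d v) else 0)"
    using roots_finite by simp
  also have "(\<Sum>z | z ^ n = 1. of_nat (card {e\<in>?S. \<sigma> e = z}) * z)
      = (\<Sum>z | z ^ n = 1. \<Sum>e | e \<in> ?S \<and> \<sigma> e = z. \<sigma> e)"
    by (intro sum.cong) auto
  also have "\<dots> = (\<Sum>e\<in>?S. \<sigma> e)"
    by (rule sum.group[OF S roots_finite]) (use Y root in \<open>auto simp: admissible_def\<close>)
  finally show ?thesis by (simp add: graph_kernel_def)
qed

text \<open>Edge reversal exchanges head and tail and inverts the weight.\<close>

lemma graph_coeff_sym:
  assumes Y: "admissible W d Y" and z: "z ^ n = 1"
  shows "graph_coeff W d Y w v (inverse z) = graph_coeff W d Y v w z"
proof -
  have w: "\<sigma> (arev e) = inverse (\<sigma> e)" if "e \<in> Y" for e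
    using weight that Y by (auto simp: weight_function_def admissible_def)
  have YX: "e \<in> arcs X" "arev e \<in> Y" if "e \<in> Y" for e using that Y by (auto simp: admissible_def)
  have "bij_betw arev {e. e \<in> Y \<and> head X e = v \<and> tail X e = w \<and> \<sigma> e = z}
      {e. e \<in> Y \<and> head X e = w \<and> tail X e = v \<and> \<sigma> e = inverse z}"
    by (rule bij_betwI[where g = arev]) (use w YX in auto)
  then have "card {e. e \<in> Y \<and> head X e = w \<and> tail X e = v \<and> \<sigma> e = inverse z}
      = card {e. e \<in> Y \<and> head X e = v \<and> tail X e = w \<and> \<sigma> e = z}"
    by (simp add: bij_betw_same_card)
  then show ?thesis by (auto simp: graph_coeff_def)
qed

text \<open>The edges ending in \<open>v\<close> are divided into disjoint classes by origin and
  weight, so the counts add up to at most the valence; the diagonal contributes the other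
  \<open>N\<close>.\<close>

lemma graph_coeff_le:
  assumes Y: "admissible W d Y" and T: "finite T"
  shows "(\<Sum>w\<in>T. \<Sum>z | z ^ n = 1. \<bar>of_int (graph_coeff W d Y v w z)\<bar>) \<le> real (2 * N)"
proof -
  let ?R = "{z::complex. z ^ n = 1}"
  let ?S = "{e\<in>Y. head X e = v}"
  let ?P = "\<lambda>w z. {e\<in>?S. (tail X e, \<sigma> e) = (w, z)}"
  have "(\<Sum>w\<in>T. \<Sum>z\<in>?R. \<bar>real_of_int (graph_coeff W d Y v w z)\<bar>)
      \<le> (\<Sum>w\<in>T. \<Sum>z\<in>?R. (if w = v then (if z = 1 then real (d v) else 0) else 0) + real (card (?P w z)))"
  proof (intro sum_mono)
    fix w z
    have "{e. e \<in> Y \<and> head X e = v \<and> tail X e = w \<and> \<sigma> e = z} = ?P w z" by auto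
    then show "\<bar>real_of_int (graph_coeff W d Y v w z)\<bar>
        \<le> (if w = v then (if z = 1 then real (d v) else 0) else 0) + real (card (?P w z))"
      by (auto simp: graph_coeff_def)
  qed
  also have "\<dots> = (\<Sum>w\<in>T. if w = v then (\<Sum>z\<in>?R. if z = 1 then real (d v) else 0) else 0)
      + (\<Sum>w\<in>T. \<Sum>z\<in>?R. real (card (?P w z)))"
    by (simp add: sum.distrib if_distrib[of "\<lambda>f. sum f _"] cong: if_cong)
      (auto intro!: sum.cong)
  also have "(\<Sum>w\<in>T. if w = v then (\<Sum>z\<in>?R. if z = 1 then real (d v) else 0) else 0) \<le> real (d v)"
    using T roots_finite by simp
  also have "(\<Sum>w\<in>T. \<Sum>z\<in>?R. real (card (?P w z))) = real (card (\<Union>p\<in>T \<times> ?R. {e\<in>?S. (tail X e, \<sigma> e) = p}))"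
  proof -
    have "card (\<Union>p\<in>T \<times> ?R. {e\<in>?S. (tail X e, \<sigma> e) = p}) = (\<Sum>p\<in>T \<times> ?R. card {e\<in>?S. (tail X e, \<sigma> e) = p})"
      using T roots_finite
      by (intro card_UN_disjoint) (auto intro: finite_subset[OF _ in_Y(1)[OF Y, of v]])
    then show ?thesis unfolding sum.cartesian_product' by simp
  qed
  also have "card (\<Union>p\<in>T \<times> ?R. {e\<in>?S. (tail X e, \<sigma> e) = p}) \<le> card ?S"
    using in_Y(1)[OF Y, of v] by (intro card_mono) auto
  finally have "(\<Sum>w\<in>T. \<Sum>z\<in>?R. \<bar>real_of_int (graph_coeff W d Y v w z)\<bar>) \<le> real (d v) + real (card ?S)"
    by simp
  also have "\<dots> \<le> real (2 * N)"
  proof -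
    have "d v \<le> N" using Y by (simp add: admissible_def)
    then show ?thesis using in_Y(2)[OF Y, of v] by linarith
  qed
  finally show ?thesis .
qed

lemma graph_kernel_nonzero:
  assumes "graph_kernel W d Y v w \<noteq> 0"
  shows "v = w \<and> v \<in> W \<or> (\<exists>e\<in>Y. head X e = v \<and> tail X e = w)"
proof (rule ccontr)
  assume neg: "\<not> ?thesis"
  have "(\<Sum>e | e \<in> Y \<and> head X e = v \<and> tail X e = w. \<sigma> e) = 0"
    by (rule sum.neutral) (use neg in blast)
  then have "graph_kernel W d Y v w = (if v = w \<and> v \<in> W then of_nat (d v) else 0)"
    unfolding graph_kernel_def by simp
  then show False using neg assms by (simp split: if_splits)
qed

lemma graph_kernel_support:
  assumes Y: "admissible W d Y"
  shows "{w. graph_kernel W d Y v w \<noteq> 0} \<subseteq> insert v (tail X ` {e\<in>Y. head X e = v})"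
    and "finite {w. graph_kernel W d Y v w \<noteq> 0}"
proof -
  show sub: "{w. graph_kernel W d Y v w \<noteq> 0} \<subseteq> insert v (tail X ` {e\<in>Y. head X e = v})"
  proof
    fix w assume "w \<in> {w. graph_kernel W d Y v w \<noteq> 0}"
    then have "graph_kernel W d Y v w \<noteq> 0" by simp
    from graph_kernel_nonzero[OF this] show "w \<in> insert v (tail X ` {e\<in>Y. head X e = v})" by auto
  qed
  show "finite {w. graph_kernel W d Y v w \<noteq> 0}"
    using in_Y(1)[OF Y] by (intro finite_subset[OF sub]) auto
qed

text \<open>Symmetry and row bound are both inherited from the integral coefficients, since roots of
  unity have modulus 1 and conjugation inverts them.\<close>

lemma graph_kernel_hermitian:
  assumes Y: "admissible W d Y"
  shows "hermitian_kernel W (real (2 * N)) (graph_kernel W d Y)"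
  unfolding hermitian_kernel_def
proof (intro conjI allI impI)
  fix v w
  show "finite {w. graph_kernel W d Y v w \<noteq> 0}" by (rule graph_kernel_support(2)[OF Y])
  have "v \<in> W \<and> w \<in> W" if "graph_kernel W d Y v w \<noteq> 0"
    using graph_kernel_nonzero[OF that] Y by (auto simp: admissible_def)
  then show "graph_kernel W d Y v w \<noteq> 0 \<Longrightarrow> v \<in> W" "graph_kernel W d Y v w \<noteq> 0 \<Longrightarrow> w \<in> W" by auto
  have cnj: "cnj z = inverse z" if "z ^ n = 1" for z :: complex
  proof -
    have "cmod z ^ n = 1" using that by (metis norm_one norm_power)
    then have "cmod z = 1" using n power_eq_imp_eq_base[of "cmod z" n 1] by simp
    then have "z * cnj z = 1" using complex_norm_square[of z] by simp
    then show ?thesis by (metis inverse_unique)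
  qed
  have "graph_kernel W d Y w v = (\<Sum>z | z ^ n = 1. of_int (graph_coeff W d Y w v z) * z)"
    by (rule graph_kernel_coeff[OF Y])
  also have "\<dots> = (\<Sum>z | z ^ n = 1. of_int (graph_coeff W d Y w v (inverse z)) * inverse z)"
    by (rule sum.reindex_bij_witness[where i = inverse and j = inverse]) (auto simp: power_inverse)
  also have "\<dots> = (\<Sum>z | z ^ n = 1. cnj (of_int (graph_coeff W d Y v w z) * z))"
    using graph_coeff_sym[OF Y] cnj by (intro sum.cong) auto
  also have "\<dots> = cnj (graph_kernel W d Y v w)"
    unfolding graph_kernel_coeff[OF Y] by simp
  finally show "graph_kernel W d Y w v = cnj (graph_kernel W d Y v w)" .
  have "(\<Sum>w | graph_kernel W d Y v w \<noteq> 0. cmod (graph_kernel W d Y v w))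
      \<le> (\<Sum>w | graph_kernel W d Y v w \<noteq> 0. \<Sum>z | z ^ n = 1. \<bar>of_int (graph_coeff W d Y v w z)\<bar>)"
  proof (intro sum_mono)
    fix w
    have "cmod z = 1" if "z ^ n = 1" for z :: complex
    proof -
      have "cmod z ^ n = 1" using that by (metis norm_one norm_power)
      then show ?thesis using n power_eq_imp_eq_base[of "cmod z" n 1] by simp
    qed
    then show "cmod (graph_kernel W d Y v w) \<le> (\<Sum>z | z ^ n = 1. \<bar>of_int (graph_coeff W d Y v w z)\<bar>)"
      unfolding graph_kernel_coeff[OF Y] by (intro sum_norm_le) (auto simp: norm_mult)
  qed
  also have "\<dots> \<le> real (2 * N)" by (rule graph_coeff_le[OF Y graph_kernel_support(2)[OF Y]])
  finally show "(\<Sum>w | graph_kernel W d Y v w \<noteq> 0. cmod (graph_kernel W d Y v w)) \<le> real (2 * N)" .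
qed

lemma graph_kernel_op:
  assumes Y: "admissible W d Y"
  shows "kernel_op (graph_kernel W d Y) f v
    = (if v \<in> W then of_nat (d v) * f v else 0) - (\<Sum>e | e \<in> Y \<and> head X e = v. \<sigma> e * f (tail X e))"
proof -
  let ?S = "{e\<in>Y. head X e = v}"
  let ?T = "insert v (tail X ` ?S)"
  have fin: "finite ?S" "finite ?T" using in_Y(1)[OF Y, of v] by auto
  have "kernel_op (graph_kernel W d Y) f v = (\<Sum>w\<in>?T. graph_kernel W d Y v w * f w)"
    using graph_kernel_support[OF Y, of v] fin(2) by (intro kernel_op_eq_sum) auto
  also have "\<dots> = (\<Sum>w\<in>?T. if w = v then (if v \<in> W then of_nat (d v) * f v else 0) else 0)
      - (\<Sum>w\<in>?T. \<Sum>e | e \<in> ?S \<and> tail X e = w. \<sigma> e * f (tail X e))"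
    unfolding sum_subtractf[symmetric]
  proof (intro sum.cong refl)
    fix w
    have "(\<Sum>e | e \<in> Y \<and> head X e = v \<and> tail X e = w. \<sigma> e) * f w
        = (\<Sum>e | e \<in> ?S \<and> tail X e = w. \<sigma> e * f (tail X e))"
      unfolding sum_distrib_right by (intro sum.cong) auto
    then show "graph_kernel W d Y v w * f w = (if w = v then (if v \<in> W then of_nat (d v) * f v else 0) else 0)
        - (\<Sum>e | e \<in> ?S \<and> tail X e = w. \<sigma> e * f (tail X e))"
      by (auto simp: graph_kernel_def left_diff_distrib)
  qed
  also have "(\<Sum>w\<in>?T. \<Sum>e | e \<in> ?S \<and> tail X e = w. \<sigma> e * f (tail X e)) = (\<Sum>e\<in>?S. \<sigma> e * f (tail X e))"
    by (rule sum.group[OF fin]) auto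
  also have "(\<Sum>w\<in>?T. if w = v then (if v \<in> W then of_nat (d v) * f v else 0) else 0)
      = (if v \<in> W then of_nat (d v) * f v else 0)"
    using fin(2) by (subst sum.delta) auto
  finally show ?thesis by simp
qed

text \<open>Reversal sends the edges of \<open>Ep\<close> leaving \<open>v\<close> to the edges
  outside \<open>Ep\<close> entering \<open>v\<close> and conjugates the weight, so the two sums
  merge into one over all entering edges and the orientation disappears. A loop enters through both
  of its orientations.\<close>

lemma dml_eq:
  assumes Ep: "orientation X arev Ep" and Y: "tail Y = tail X" "head Y = head X" "arcs Y \<subseteq> arcs X"
    "\<And>e. e \<in> arcs Y \<Longrightarrow> arev e \<in> arcs Y"
  shows "dml Y Ep \<sigma> f v = (if v \<in> verts Y then of_nat (in_degree Y v) * f v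
           - (\<Sum>e | e \<in> arcs Y \<and> head X e = v. \<sigma> e * f (tail X e)) else 0)"
proof -
  let ?S = "{e. e \<in> arcs Y \<and> head X e = v}"
  have ori: "(e \<in> Ep) \<noteq> (arev e \<in> Ep)" if "e \<in> arcs X" for e
    using Ep that unfolding orientation_def by blast
  have fin: "finite ?S"
    by (rule finite_subset[OF _ in_arcs_bound(1)[of v]]) (use Y in auto)
  have "(\<Sum>e\<in>?S. \<sigma> e * f (tail X e))
      = (\<Sum>e\<in>?S \<inter> Ep. \<sigma> e * f (tail X e)) + (\<Sum>e\<in>?S - Ep. \<sigma> e * f (tail X e))"
    using sum.Int_Diff[OF fin] by blast
  also have "?S \<inter> Ep = Ep \<inter> in_arcs Y v" using Y by auto
  also have "(\<Sum>e\<in>Ep \<inter> in_arcs Y v. \<sigma> e * f (tail X e)) = (\<Sum>e\<in>Ep \<inter> in_arcs Y v. \<sigma> e * f (tail Y e))"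
    using Y by simp
  also have "(\<Sum>e\<in>?S - Ep. \<sigma> e * f (tail X e)) = (\<Sum>e\<in>Ep \<inter> out_arcs Y v. cnj (\<sigma> e) * f (head Y e))"
  proof (rule sum.reindex_bij_witness[where i = arev and j = arev])
    fix e assume e: "e \<in> ?S - Ep"
    then have eX: "e \<in> arcs X" using Y by auto
    show "arev (arev e) = e" by simp
    have "arev e \<in> Ep" using ori[OF eX] e by blast
    moreover have "arev e \<in> out_arcs Y v" using e eX Y(4)[of e] by (simp add: Y(1))
    ultimately show "arev e \<in> Ep \<inter> out_arcs Y v" by blast
    have "cmod (\<sigma> e) = 1" using weight eX by (simp add: weight_function_def)
    then have "\<sigma> e * cnj (\<sigma> e) = 1" using complex_norm_square[of "\<sigma> e"] by simp
    then have "inverse (\<sigma> e) = cnj (\<sigma> e)" by (rule inverse_unique)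
    then have ci: "cnj (inverse (\<sigma> e)) = \<sigma> e" by simp
    have sa: "\<sigma> (arev e) = inverse (\<sigma> e)" using weight eX by (simp add: weight_function_def)
    show "cnj (\<sigma> (arev e)) * f (head Y (arev e)) = \<sigma> e * f (tail X e)"
      unfolding sa ci Y(2) using eX by simp
  next
    fix e assume e: "e \<in> Ep \<inter> out_arcs Y v"
    then have eX: "e \<in> arcs X" using Y by auto
    show "arev (arev e) = e" by simp
    have "arev e \<notin> Ep" using ori[OF eX] e by blast
    moreover have "arev e \<in> ?S" using e eX Y(4)[of e] by (simp add: Y(1))
    ultimately show "arev e \<in> ?S - Ep" by blast
  qed
  finally show ?thesis by (simp add: dml_def)
qed

lemma admissible_X: "admissible (verts X) (in_degree X) (arcs X)"
  using in_arcs_bound(2) by (auto simp: admissible_def in_degree_def)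

definition full_kernel :: "'v \<Rightarrow> 'v \<Rightarrow> complex" where
  "full_kernel = graph_kernel (verts X) (in_degree X) (arcs X)"

lemma kernel_op_X:
  assumes "orientation X arev Ep" "f \<in> funs_on (verts X)"
  shows "dml X Ep \<sigma> f = kernel_op full_kernel f"
proof
  fix v
  have "(\<Sum>e | e \<in> arcs X \<and> head X e = v. \<sigma> e * f (tail X e)) = 0" if "v \<notin> verts X"
    by (rule sum.neutral) (use that in auto)
  then show "dml X Ep \<sigma> f v = kernel_op full_kernel f v"
    by (subst dml_eq[OF assms(1)]) (auto simp: full_kernel_def graph_kernel_op[OF admissible_X])
qed

text \<open>The action carries the edges between two vertices bijectively to those between their
  images, and weak invariance multiplies all their weights by the same product of phases; on the
  diagonal the phases cancel.\<close>

lemma graph_kernel_covariant: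
  assumes g: "\<gamma> \<in> carrier \<Gamma>"
  defines "a \<equiv> full_kernel"
  shows "\<exists>s. (\<forall>v\<in>verts X. cmod (s v) = 1) \<and>
    (\<forall>v\<in>verts X. \<forall>w\<in>verts X. a (\<phi> \<gamma> v) (\<phi> \<gamma> w) = s v * cnj (s w) * a v w)"
proof -
  interpret G: group \<Gamma> by (rule group_Gamma)
  obtain s :: "'v \<Rightarrow> complex" where s: "\<And>v. v \<in> verts X \<Longrightarrow> cmod (s v) = 1"
    "\<And>e. e \<in> arcs X \<Longrightarrow> \<sigma> (\<psi> \<gamma> e) = \<sigma> e * s (head X e) * cnj (s (tail X e))"
    using winv g unfolding weakly_invariant_def by blast
  have inj: "\<phi> \<gamma> v = \<phi> \<gamma> w \<longleftrightarrow> v = w" if "v \<in> verts X" "w \<in> verts X" for v w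
    using that V.inj_prop[OF g] by (auto simp: inj_on_def)
  have ac: "\<psi> \<gamma> e \<in> arcs X" if "e \<in> arcs X" for e using E.element_image[OF g that] by simp
  have vc: "\<phi> \<gamma> v \<in> verts X" if "v \<in> verts X" for v using V.element_image[OF g that] by simp
  have pre: "\<exists>e0\<in>arcs X. e = \<psi> \<gamma> e0" if "e \<in> arcs X" for e using E.surj_prop[OF g] that by blast
  have bij: "bij_betw (\<psi> \<gamma>) {e. e \<in> arcs X \<and> head X e = v \<and> tail X e \<in> T}
      {e. e \<in> arcs X \<and> head X e = \<phi> \<gamma> v \<and> tail X e \<in> \<phi> \<gamma> ` T}"
    if v: "v \<in> verts X" and T: "T \<subseteq> verts X" for v T
    unfolding bij_betw_def
  proof
    show "inj_on (\<psi> \<gamma>) {e. e \<in> arcs X \<and> head X e = v \<and> tail X e \<in> T}"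
      by (rule inj_on_subset[OF E.inj_prop[OF g]]) auto
    show "\<psi> \<gamma> ` {e. e \<in> arcs X \<and> head X e = v \<and> tail X e \<in> T}
        = {e. e \<in> arcs X \<and> head X e = \<phi> \<gamma> v \<and> tail X e \<in> \<phi> \<gamma> ` T}"
    proof (intro equalityI subsetI)
      fix e assume e: "e \<in> {e. e \<in> arcs X \<and> head X e = \<phi> \<gamma> v \<and> tail X e \<in> \<phi> \<gamma> ` T}"
      then obtain e0 where e0: "e0 \<in> arcs X" "e = \<psi> \<gamma> e0" using pre by auto
      then have "\<phi> \<gamma> (head X e0) = \<phi> \<gamma> v" "\<phi> \<gamma> (tail X e0) \<in> \<phi> \<gamma> ` T"
        using e head_act[OF g] tail_act[OF g] by auto
      then have "head X e0 = v" "tail X e0 \<in> T"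
        using inj v T e0(1) by (auto simp: subset_iff)
      then show "e \<in> \<psi> \<gamma> ` {e. e \<in> arcs X \<and> head X e = v \<and> tail X e \<in> T}" using e0 by auto
    qed (use ac head_act[OF g] tail_act[OF g] in auto)
  qed
  have deg: "in_degree X (\<phi> \<gamma> v) = in_degree X v" if v: "v \<in> verts X" for v
  proof -
    have "{e. e \<in> arcs X \<and> head X e = v \<and> tail X e \<in> verts X} = in_arcs X v" by auto
    moreover have "{e. e \<in> arcs X \<and> head X e = \<phi> \<gamma> v \<and> tail X e \<in> \<phi> \<gamma> ` verts X} = in_arcs X (\<phi> \<gamma> v)"
      unfolding V.surj_prop[OF g] by auto
    ultimately show ?thesis
      using bij_betw_same_card[OF bij[OF v subset_refl]] by (simp add: in_degree_def)
  qed
  have "a (\<phi> \<gamma> v) (\<phi> \<gamma> w) = s v * cnj (s w) * a v w" if v: "v \<in> verts X" and w: "w \<in> verts X" for v w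
  proof -
    have "(\<Sum>e | e \<in> arcs X \<and> head X e = \<phi> \<gamma> v \<and> tail X e = \<phi> \<gamma> w. \<sigma> e)
        = (\<Sum>e | e \<in> arcs X \<and> head X e = v \<and> tail X e = w. \<sigma> (\<psi> \<gamma> e))"
      using sum.reindex_bij_betw[OF bij[OF v, of "{w}"], of \<sigma>] w by simp
    also have "\<dots> = s v * cnj (s w) * (\<Sum>e | e \<in> arcs X \<and> head X e = v \<and> tail X e = w. \<sigma> e)"
      unfolding sum_distrib_left by (intro sum.cong) (auto simp: s(2))
    finally have "(\<Sum>e | e \<in> arcs X \<and> head X e = \<phi> \<gamma> v \<and> tail X e = \<phi> \<gamma> w. \<sigma> e)
        = s v * cnj (s w) * (\<Sum>e | e \<in> arcs X \<and> head X e = v \<and> tail X e = w. \<sigma> e)" .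
    moreover have "s v * cnj (s v) = 1" using s(1)[OF v] complex_norm_square[of "s v"] by simp
    ultimately show ?thesis
      unfolding a_def full_kernel_def graph_kernel_def using inj[OF v w] v vc deg[OF v] by (auto simp: right_diff_distrib)
  qed
  then show ?thesis using s(1) by blast
qed

end

section \<open>Dirichlet and Neumann restrictions\<close>

context weighted_action
begin

text \<open>Compression by a projection keeps every edge of \<open>X\<close> with both ends in the
  vertex set, even one that lies in no translate of the fundamental domain by \<open>A\<close>; the
  Neumann operator sees only the edges of the subgraph.\<close>

definition restricted_arcs :: "boundary_condition \<Rightarrow> 'g set \<Rightarrow> 'e set" where
  "restricted_arcs bc A = (let Y = exhausting_subgraph X \<phi> \<psi> FV FE A in
     case bc of Dirichlet \<Rightarrow> {e \<in> arcs X. head X e \<in> verts Y \<and> tail X e \<in> verts Y} | Neumann \<Rightarrow> arcs Y)"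

definition restricted_degree :: "boundary_condition \<Rightarrow> 'g set \<Rightarrow> 'v \<Rightarrow> nat" where
  "restricted_degree bc A = (case bc of Dirichlet \<Rightarrow> in_degree X
     | Neumann \<Rightarrow> in_degree (exhausting_subgraph X \<phi> \<psi> FV FE A))"

definition union_verts :: "'g set \<Rightarrow> 'v set" where
  "union_verts A = (\<Union>\<gamma>\<in>A. \<phi> \<gamma> ` FV)"

definition restricted_kernel :: "boundary_condition \<Rightarrow> 'g set \<Rightarrow> 'v \<Rightarrow> 'v \<Rightarrow> complex" where
  "restricted_kernel bc A = graph_kernel (union_verts A) (restricted_degree bc A) (restricted_arcs bc A)"

lemma exhausting_simps [simp]:
  "verts (exhausting_subgraph X \<phi> \<psi> FV FE A) = union_verts A"
  "tail (exhausting_subgraph X \<phi> \<psi> FV FE A) = tail X"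
  "head (exhausting_subgraph X \<phi> \<psi> FV FE A) = head X"
  by (simp_all add: exhausting_subgraph_def Let_def union_verts_def)

lemma arcs_exhausting: "arcs (exhausting_subgraph X \<phi> \<psi> FV FE A)
    = {e \<in> (\<Union>\<gamma>\<in>A. \<psi> \<gamma> ` \<Union>FE). tail X e \<in> union_verts A \<and> head X e \<in> union_verts A}"
  by (simp add: exhausting_subgraph_def Let_def union_verts_def)

lemma arcs_exhausting_subset:
  "A \<subseteq> carrier \<Gamma> \<Longrightarrow> arcs (exhausting_subgraph X \<phi> \<psi> FV FE A) \<subseteq> arcs X"
  using exhausting_subgraph_largest(1)[OF dom] by (auto simp: subgraph_def)

lemma in_degree_exhausting_le:
  assumes "A \<subseteq> carrier \<Gamma>"
  shows "in_degree (exhausting_subgraph X \<phi> \<psi> FV FE A) v \<le> N"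
proof -
  have "in_arcs (exhausting_subgraph X \<phi> \<psi> FV FE A) v \<subseteq> in_arcs X v"
    using arcs_exhausting_subset[OF assms] by auto
  from card_mono[OF in_arcs_bound(1) this] show ?thesis
    using in_arcs_bound(2)[of v] by (simp add: in_degree_def)
qed

lemma admissible_restricted:
  assumes A: "A \<subseteq> carrier \<Gamma>"
  shows "admissible (union_verts A) (restricted_degree bc A) (restricted_arcs bc A)"
proof (cases bc)
  case Dirichlet
  then show ?thesis
    using in_arcs_bound(2)
    by (auto simp: admissible_def restricted_degree_def restricted_arcs_def in_degree_def)
next
  case Neumann
  have "arev e \<in> arcs (exhausting_subgraph X \<phi> \<psi> FV FE A)"
    if "e \<in> arcs (exhausting_subgraph X \<phi> \<psi> FV FE A)" for e
    by (rule exhausting_subgraph_largest(2)[OF dom A that])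
  then show ?thesis
    using Neumann arcs_exhausting_subset[OF A] in_degree_exhausting_le[OF A]
    by (auto simp: admissible_def restricted_degree_def restricted_arcs_def arcs_exhausting)
qed

text \<open>In the Dirichlet case the edges missing from the kernel start at vertices where
  \<open>f\<close> vanishes, while the degree is that of the whole graph; in the Neumann case both
  data come from the subgraph.\<close>

lemma restricted_dml_eq_kernel_op:
  assumes Ep: "orientation X arev Ep" and A: "A \<subseteq> carrier \<Gamma>" and f: "f \<in> funs_on (union_verts A)"
  shows "restricted_dml bc X (exhausting_subgraph X \<phi> \<psi> FV FE A) Ep \<sigma> f = kernel_op (restricted_kernel bc A) f"
proof
  let ?Y = "exhausting_subgraph X \<phi> \<psi> FV FE A"
  let ?W = "union_verts A"
  fix v
  note K = graph_kernel_op[OF admissible_restricted[OF A], of bc f v, folded restricted_kernel_def]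
  have WV: "?W \<subseteq> verts X" using A FV V.element_image by (fastforce simp: union_verts_def)
  have out: "(\<Sum>e | e \<in> restricted_arcs bc A \<and> head X e = v. \<sigma> e * f (tail X e)) = 0" if "v \<notin> ?W"
    using admissible_restricted[OF A, of bc] that
    by (intro sum.neutral) (auto simp: admissible_def)
  show "restricted_dml bc X ?Y Ep \<sigma> f v = kernel_op (restricted_kernel bc A) f v"
  proof (cases bc)
    case Dirichlet
    have rf: "restrict_fun ?W f = f" using f by (auto simp: restrict_fun_def funs_on_def)
    have "(\<Sum>e | e \<in> arcs X \<and> head X e = v. \<sigma> e * f (tail X e))
        = (\<Sum>e | e \<in> restricted_arcs bc A \<and> head X e = v. \<sigma> e * f (tail X e))" if "v \<in> ?W"
    proof (rule sum.mono_neutral_right)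
      show "finite {e. e \<in> arcs X \<and> head X e = v}" using in_Y(1)[OF admissible_X, of v] by simp
    qed (use that f Dirichlet in \<open>auto simp: restricted_arcs_def funs_on_def\<close>)
    moreover have "restricted_dml bc X ?Y Ep \<sigma> f = restrict_fun ?W (dml X Ep \<sigma> f)"
      using Dirichlet by (simp add: rf)
    ultimately show ?thesis
      using WV out Dirichlet unfolding K
      by (auto simp: restrict_fun_def dml_eq[OF Ep] restricted_degree_def)
  next
    case Neumann
    have "dml ?Y Ep \<sigma> f v = (if v \<in> ?W then of_nat (in_degree ?Y v) * f v
           - (\<Sum>e | e \<in> arcs ?Y \<and> head X e = v. \<sigma> e * f (tail X e)) else 0)"
      using dml_eq[OF Ep, of ?Y f v] arcs_exhausting_subset[OF A] exhausting_subgraph_largest(2)[OF dom A]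
      by simp
    then show ?thesis
      using out Neumann unfolding K by (auto simp: restricted_degree_def restricted_arcs_def)
  qed
qed

text \<open>\<open>H0\<close> collects the group elements needed to reach, from a vertex of the fundamental domain,
  its incident edges and its neighbours.\<close>

lemma restricted_kernel_agree:
  obtains H0 where "finite H0" "H0 \<subseteq> carrier \<Gamma>"
    "\<And>A \<gamma> x w bc. A \<subseteq> carrier \<Gamma> \<Longrightarrow> \<gamma> \<in> A \<Longrightarrow> (\<And>\<eta>. \<eta> \<in> H0 \<Longrightarrow> \<gamma> \<otimes> \<eta> \<in> A) \<Longrightarrow> x \<in> FV \<Longrightarrow>
       restricted_kernel bc A (\<phi> \<gamma> x) w = full_kernel (\<phi> \<gamma> x) w"
proof -
  interpret group \<Gamma> by (rule group_Gamma)
  \<comment> \<open>Edges ending in the fundamental domain; every edge ending at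
    \<open>\<phi> \<gamma> x\<close> is the translate of one of them. \<open>h1\<close> locates the
    edge itself, for the Neumann edge set, and \<open>h2\<close> its origin.\<close>
  define B0 where "B0 = (\<Union>x\<in>FV. in_arcs X x)"
  have B0: "finite B0" "B0 \<subseteq> arcs X" using FV in_arcs_bound(1) by (auto simp: B0_def)
  have "\<forall>e\<in>B0. \<exists>\<eta>. \<eta> \<in> carrier \<Gamma> \<and> (\<exists>e0\<in>\<Union>FE. e = \<psi> \<eta> e0)" using arc_cover B0(2) by blast
  then obtain h1 where h1: "\<And>e. e \<in> B0 \<Longrightarrow> h1 e \<in> carrier \<Gamma> \<and> (\<exists>e0\<in>\<Union>FE. e = \<psi> (h1 e) e0)" by metis
  have "\<forall>e\<in>B0. \<exists>\<eta>. \<eta> \<in> carrier \<Gamma> \<and> (\<exists>y\<in>FV. tail X e = \<phi> \<eta> y)"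
    using vert_cover B0(2) tail_in_verts by blast
  then obtain h2 where h2: "\<And>e. e \<in> B0 \<Longrightarrow> h2 e \<in> carrier \<Gamma> \<and> (\<exists>y\<in>FV. tail X e = \<phi> (h2 e) y)" by metis
  define H0 where "H0 = h1 ` B0 \<union> h2 ` B0"
  have agree: "restricted_kernel bc A (\<phi> \<gamma> x) w = full_kernel (\<phi> \<gamma> x) w"
    if A: "A \<subseteq> carrier \<Gamma>" and \<gamma>: "\<gamma> \<in> A" and H: "\<And>\<eta>. \<eta> \<in> H0 \<Longrightarrow> \<gamma> \<otimes> \<eta> \<in> A" and x: "x \<in> FV"
    for A \<gamma> x w bc
  proof -
    let ?Y = "exhausting_subgraph X \<phi> \<psi> FV FE A"
    let ?v = "\<phi> \<gamma> x"
    have \<gamma>c: "\<gamma> \<in> carrier \<Gamma>" using A \<gamma> by blast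
    have xV: "x \<in> verts X" using x FV by blast
    have vW: "?v \<in> union_verts A" using \<gamma> x by (auto simp: union_verts_def)
    have vV: "?v \<in> verts X" using V.element_image[OF \<gamma>c xV] by simp
    have inY: "e \<in> arcs ?Y" if e: "e \<in> arcs X" "head X e = ?v" for e
    proof -
      define e' where "e' = \<psi> (inv \<gamma>) e"
      have ig: "inv \<gamma> \<in> carrier \<Gamma>" using \<gamma>c by simp
      have e'X: "e' \<in> arcs X" unfolding e'_def using E.element_image[OF ig e(1)] by simp
      have "head X e' = \<phi> (inv \<gamma>) ?v" unfolding e'_def using head_act[OF ig e(1)] e(2) by simp
      also have "\<dots> = x" using V.orbit_sym_aux[OF \<gamma>c xV refl] .
      finally have e'B: "e' \<in> B0" using x e'X by (auto simp: B0_def)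
      have ee: "e = \<psi> \<gamma> e'" using E.orbit_sym_aux[OF ig e(1) e'_def[symmetric]] \<gamma>c by simp
      obtain e0 where e0: "e0 \<in> \<Union>FE" "e' = \<psi> (h1 e') e0" using h1[OF e'B] by blast
      have "\<psi> (\<gamma> \<otimes> h1 e') e0 = \<psi> \<gamma> (\<psi> (h1 e') e0)"
        using E.composition_rule[of e0 \<gamma> "h1 e'"] e0(1) FE_arcs \<gamma>c h1[OF e'B] by blast
      then have "e = \<psi> (\<gamma> \<otimes> h1 e') e0" using ee e0(2) by simp
      moreover have "\<gamma> \<otimes> h1 e' \<in> A" using H e'B by (simp add: H0_def)
      ultimately have 1: "e \<in> (\<Union>\<gamma>\<in>A. \<psi> \<gamma> ` \<Union>FE)" using e0(1) by blast
      obtain y where y: "y \<in> FV" "tail X e' = \<phi> (h2 e') y" using h2[OF e'B] by blast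
      have "tail X e = \<phi> \<gamma> (tail X e')" using tail_act[OF \<gamma>c e'X] ee by simp
      also have "\<dots> = \<phi> (\<gamma> \<otimes> h2 e') y"
        using V.composition_rule[of y \<gamma> "h2 e'"] y FV \<gamma>c h2[OF e'B] by auto
      finally have "tail X e = \<phi> (\<gamma> \<otimes> h2 e') y" .
      moreover have "\<gamma> \<otimes> h2 e' \<in> A" using H e'B by (simp add: H0_def)
      ultimately have "tail X e \<in> union_verts A" using y(1) by (auto simp: union_verts_def)
      then show ?thesis using 1 vW e(2) by (simp add: arcs_exhausting)
    qed
    have YX: "arcs ?Y \<subseteq> arcs X" by (rule arcs_exhausting_subset[OF A])
    have arcs_eq: "{e. e \<in> restricted_arcs bc A \<and> head X e = ?v \<and> tail X e = w}
        = {e. e \<in> arcs X \<and> head X e = ?v \<and> tail X e = w}"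
    proof (cases bc)
      case Dirichlet
      then show ?thesis using inY vW by (auto simp: restricted_arcs_def arcs_exhausting)
    next
      case Neumann
      then show ?thesis using inY YX by (auto simp: restricted_arcs_def)
    qed
    have "in_arcs ?Y ?v = in_arcs X ?v" using inY YX by auto
    then have "restricted_degree bc A ?v = in_degree X ?v"
      by (cases bc) (simp_all add: restricted_degree_def in_degree_def)
    then show ?thesis
      unfolding restricted_kernel_def full_kernel_def graph_kernel_def arcs_eq using vW vV by auto
  qed
  have "finite H0" "H0 \<subseteq> carrier \<Gamma>" using B0(1) h1 h2 by (auto simp: H0_def)
  then show ?thesis by (rule that) (rule agree)
qed

lemma exhausted_kernel_restricted:
  assumes S: "finite S" "S \<subseteq> carrier \<Gamma>" "generate \<Gamma> S = carrier \<Gamma>" and reg: "regular_exhaustion \<Gamma> S \<Lambda>"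
  obtains H0 U D where
    "exhausted_kernel \<Gamma> (verts X) \<phi> FV full_kernel (real (2 * N)) \<Lambda>
       (\<lambda>m. restricted_kernel bc (\<Lambda> m)) H0 U D n
       (\<lambda>m. graph_coeff (union_verts (\<Lambda> m)) (restricted_degree bc (\<Lambda> m)) (restricted_arcs bc (\<Lambda> m)))"
proof -
  have L: "finite (\<Lambda> m)" "\<Lambda> m \<noteq> {}" "\<Lambda> m \<subseteq> carrier \<Gamma>" for m
    using reg by (auto simp: regular_exhaustion_def)
  have adm: "admissible (union_verts (\<Lambda> m)) (restricted_degree bc (\<Lambda> m)) (restricted_arcs bc (\<Lambda> m))" for m
    by (rule admissible_restricted[OF L(3)])
  have herm: "hermitian_kernel (union_verts (\<Lambda> m)) (real (2 * N)) (restricted_kernel bc (\<Lambda> m))" for m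
    unfolding restricted_kernel_def by (rule graph_kernel_hermitian[OF adm])
  have fin: "finite (union_verts (\<Lambda> m))" for m using L(1)[of m] FV by (auto simp: union_verts_def)
  have "\<forall>m. \<exists>ud. spectral_basis (union_verts (\<Lambda> m)) (restricted_kernel bc (\<Lambda> m)) (fst ud) (snd ud)"
  proof
    fix m
    obtain u d where "spectral_basis (union_verts (\<Lambda> m)) (restricted_kernel bc (\<Lambda> m)) u d"
      by (rule hermitian_spectral_theorem[OF herm fin])
    then show "\<exists>ud. spectral_basis (union_verts (\<Lambda> m)) (restricted_kernel bc (\<Lambda> m)) (fst ud) (snd ud)"
      by (intro exI[of _ "(u, d)"]) simp
  qed
  from choice[OF this] obtain UD where UD:
    "\<And>m. spectral_basis (union_verts (\<Lambda> m)) (restricted_kernel bc (\<Lambda> m)) (fst (UD m)) (snd (UD m))" by blast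
  obtain H0 where H0: "finite H0" "H0 \<subseteq> carrier \<Gamma>"
    "\<And>A \<gamma> x w bc. A \<subseteq> carrier \<Gamma> \<Longrightarrow> \<gamma> \<in> A \<Longrightarrow> (\<And>\<eta>. \<eta> \<in> H0 \<Longrightarrow> \<gamma> \<otimes> \<eta> \<in> A) \<Longrightarrow> x \<in> FV \<Longrightarrow>
       restricted_kernel bc A (\<phi> \<gamma> x) w = full_kernel (\<phi> \<gamma> x) w"
    by (rule restricted_kernel_agree) blast
  have "exhausted_kernel \<Gamma> (verts X) \<phi> FV full_kernel (real (2 * N)) \<Lambda>
       (\<lambda>m. restricted_kernel bc (\<Lambda> m)) H0 (\<lambda>m. fst (UD m)) (\<lambda>m. snd (UD m)) n
       (\<lambda>m. graph_coeff (union_verts (\<Lambda> m)) (restricted_degree bc (\<Lambda> m)) (restricted_arcs bc (\<Lambda> m)))"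
  proof (unfold_locales, unfold union_verts_def[symmetric])
    show "hermitian_kernel (verts X) (real (2 * N)) full_kernel"
      unfolding full_kernel_def by (rule graph_kernel_hermitian[OF admissible_X])
    show "\<gamma> = \<one>" if "\<gamma> \<in> carrier \<Gamma>" "v \<in> verts X" "\<phi> \<gamma> v = v" for \<gamma> v using free_verts that by blast
    show "finite FV" "FV \<subseteq> verts X" by (rule FV)+
    show "\<exists>\<gamma>\<in>carrier \<Gamma>. \<exists>x\<in>FV. v = \<phi> \<gamma> x" if "v \<in> verts X" for v by (rule vert_cover[OF that])
    show "x = y" if "\<gamma> \<in> carrier \<Gamma>" "x \<in> FV" "y \<in> FV" "\<phi> \<gamma> x = y" for \<gamma> x y by (rule FV_unique[OF that])
    show "\<exists>s. (\<forall>v\<in>verts X. cmod (s v) = 1) \<and> (\<forall>v\<in>verts X. \<forall>w\<in>verts X.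
        full_kernel (\<phi> \<gamma> v) (\<phi> \<gamma> w)
          = s v * cnj (s w) * full_kernel v w)" if "\<gamma> \<in> carrier \<Gamma>" for \<gamma>
      by (rule graph_kernel_covariant[OF that])
    show "finite (\<Lambda> m)" "\<Lambda> m \<noteq> {}" "\<Lambda> m \<subseteq> carrier \<Gamma>" for m by (rule L)+
    show "(\<lambda>m. real (card {\<gamma>\<in>\<Lambda> m. \<exists>\<eta>\<in>H. \<gamma> \<otimes> \<eta> \<notin> \<Lambda> m}) / real (card (\<Lambda> m))) \<longlonglongrightarrow> 0"
      if "finite H" "H \<subseteq> carrier \<Gamma>" for H
      by (rule regular_exhaustion_folner[OF group_Gamma S reg that])
    show "hermitian_kernel (union_verts (\<Lambda> m)) (real (2 * N)) (restricted_kernel bc (\<Lambda> m))" for m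
      by (rule herm)
    show "finite H0" "H0 \<subseteq> carrier \<Gamma>" by (rule H0)+
    show "restricted_kernel bc (\<Lambda> m) (\<phi> \<gamma> x) w = full_kernel (\<phi> \<gamma> x) w"
      if "\<gamma> \<in> \<Lambda> m" "\<And>\<eta>. \<eta> \<in> H0 \<Longrightarrow> \<gamma> \<otimes> \<eta> \<in> \<Lambda> m" "x \<in> FV" for m \<gamma> x w
      by (rule H0(3)[OF L(3) that])
    show "spectral_basis (union_verts (\<Lambda> m)) (restricted_kernel bc (\<Lambda> m)) (fst (UD m)) (snd (UD m))" for m
      by (rule UD)
    show "0 < n" by (rule n)
    show "restricted_kernel bc (\<Lambda> m) v w = (\<Sum>z | z ^ n = 1. of_int (graph_coeff (union_verts (\<Lambda> m))
        (restricted_degree bc (\<Lambda> m)) (restricted_arcs bc (\<Lambda> m)) v w z) * z)" for m v w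
      unfolding restricted_kernel_def by (rule graph_kernel_coeff[OF adm])
    show "graph_coeff (union_verts (\<Lambda> m)) (restricted_degree bc (\<Lambda> m)) (restricted_arcs bc (\<Lambda> m)) w v (inverse z)
        = graph_coeff (union_verts (\<Lambda> m)) (restricted_degree bc (\<Lambda> m)) (restricted_arcs bc (\<Lambda> m)) v w z"
      if "z ^ n = 1" for m v w z by (rule graph_coeff_sym[OF adm that])
    show "(\<Sum>w\<in>union_verts (\<Lambda> m). \<Sum>z | z ^ n = 1. \<bar>real_of_int (graph_coeff (union_verts (\<Lambda> m))
        (restricted_degree bc (\<Lambda> m)) (restricted_arcs bc (\<Lambda> m)) v w z)\<bar>) \<le> real (2 * N)" for m v
      by (rule graph_coeff_le[OF adm fin])
  qed
  then show ?thesis by (rule that)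
qed

end

theorem corollary4p2:
  fixes \<Gamma> :: "('g, 'a) monoid_scheme" and S :: "'g set"
    and X :: "('v, 'e) pre_digraph" and arev :: "'e \<Rightarrow> 'e"
    and \<phi> :: "'g \<Rightarrow> 'v \<Rightarrow> 'v" and \<psi> :: "'g \<Rightarrow> 'e \<Rightarrow> 'e"
    and FV :: "'v set" and FE :: "'e set set"
    and Ep :: "'e set" and \<sigma> :: "'e \<Rightarrow> complex"
    and \<Lambda> :: "nat \<Rightarrow> 'g set" and bc :: boundary_condition
    and lam1 lam2 :: real
  assumes "group \<Gamma>" and "finite S" and "S \<subseteq> carrier \<Gamma>" and "generate \<Gamma> S = carrier \<Gamma>"
    and "amenable \<Gamma>"
    and "free_graph_action \<Gamma> X arev \<phi> \<psi>"
    and "fundamental_domain \<Gamma> X arev \<phi> \<psi> FV FE"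
    and "orientation X arev Ep"
    and "weight_function X arev \<sigma>"
    and "weakly_invariant \<Gamma> X \<psi> \<sigma>"
    and "rational_weight X \<sigma>"
    and "regular_exhaustion \<Gamma> S \<Lambda>"
    and "lam1 < lam2"
  defines "F \<equiv> \<lambda>m. normalized_count bc X \<phi> \<psi> FV FE Ep \<sigma> (\<Lambda> m)"
  shows "(\<not> is_eigenvalue (verts X) (dml X Ep \<sigma>) (complex_of_real lam2) \<longrightarrow>
            (in_spectral_gap (verts X) (dml X Ep \<sigma>) lam1 lam2 \<longleftrightarrow>
             (\<lambda>m. F m lam2 - F m lam1) \<longlonglongrightarrow> 0)) \<and>
         ((\<lambda>m. F m lam2 - F m lam1) \<longlonglongrightarrow> 0 \<longrightarrow>
            in_spectral_gap (verts X) (dml X Ep \<sigma>) lam1 lam2)"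
proof -
  obtain n :: nat where n: "0 < n" "\<And>e. e \<in> arcs X \<Longrightarrow> \<sigma> e ^ n = 1"
    using assms(11) by (auto simp: rational_weight_def)
  interpret weighted_action \<Gamma> X arev \<phi> \<psi> FV FE \<sigma> n
    by (intro weighted_action.intro weighted_action_axioms.intro assms n)
  obtain H0 U D where EK: "exhausted_kernel \<Gamma> (verts X) \<phi> FV full_kernel
       (real (2 * N)) \<Lambda> (\<lambda>m. restricted_kernel bc (\<Lambda> m)) H0 U D n
       (\<lambda>m. graph_coeff (union_verts (\<Lambda> m)) (restricted_degree bc (\<Lambda> m)) (restricted_arcs bc (\<Lambda> m)))"
    by (rule exhausted_kernel_restricted[OF assms(2-4,12)])
  interpret K: exhausted_kernel \<Gamma> "verts X" \<phi> FV full_kernel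
    "real (2 * N)" \<Lambda> "\<lambda>m. restricted_kernel bc (\<Lambda> m)" H0 U D n
    "\<lambda>m. graph_coeff (union_verts (\<Lambda> m)) (restricted_degree bc (\<Lambda> m)) (restricted_arcs bc (\<Lambda> m))"
    by (rule EK)
  have W: "K.W m = union_verts (\<Lambda> m)" for m by (simp add: K.W_def union_verts_def)
  \<comment> \<open>Eigenfunctions are supported in \<open>K.W m\<close>, where the restricted
    operator is the kernel operator, so the count in the statement is the index count of the
    eigenbasis.\<close>
  have "eigenvalue_count (K.W m) (restricted_dml bc X (exhausting_subgraph X \<phi> \<psi> FV FE (\<Lambda> m)) Ep \<sigma>) r = K.E m r"
    for m r
    unfolding K.E_def
    by (rule eigenvalue_count_eq_card[OF K.kerA' K.W_finite K.basis'])
      (use restricted_dml_eq_kernel_op[OF assms(8) K.Lam(3)] in \<open>simp add: W\<close>)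
  then have "F m r = real (K.E m r) / real (card (\<Lambda> m))" for m r
    by (simp add: F_def normalized_count_def Let_def W)
  then have F: "F m lam2 - F m lam1 = (real (K.E m lam2) - real (K.E m lam1)) / real (card (\<Lambda> m))" for m
    by (simp add: diff_divide_distrib)
  have A: "dml X Ep \<sigma> f = kernel_op full_kernel f"
    if "f \<in> ell2 (verts X)" for f
    by (rule kernel_op_X[OF assms(8) ell2_funs_on[OF that]])
  have gap: "in_spectral_gap (verts X) (dml X Ep \<sigma>) lam1 lam2 \<longleftrightarrow> (\<forall>\<mu>. lam1 < \<mu> \<and> \<mu> < lam2 \<longrightarrow>
      (\<exists>\<epsilon>>0. bounded_below (verts X) (shift_kernel (verts X) full_kernel \<mu>) \<epsilon>))"
    by (rule in_spectral_gap_iff_bounded_below[OF K.ker A])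
  have 1: "in_spectral_gap (verts X) (dml X Ep \<sigma>) lam1 lam2" if "(\<lambda>m. F m lam2 - F m lam1) \<longlonglongrightarrow> 0"
    unfolding gap using K.limit_imp_gap[of lam2 lam1] that unfolding F by blast
  \<comment> \<open>Here the hypothesis at \<open>lam2\<close> enters: it excludes the
    l2-eigenfunction that compactness would produce from a positive density in every window around
    \<open>lam2\<close>.\<close>
  have 2: "(\<lambda>m. F m lam2 - F m lam1) \<longlonglongrightarrow> 0"
    if "\<not> is_eigenvalue (verts X) (dml X Ep \<sigma>) (complex_of_real lam2)"
      "in_spectral_gap (verts X) (dml X Ep \<sigma>) lam1 lam2"
    unfolding F
  proof (rule K.gap_imp_limit[OF assms(13)])
    show "\<exists>\<epsilon>>0. bounded_below (verts X) (shift_kernel (verts X) full_kernel \<mu>) \<epsilon>"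
      if "lam1 < \<mu>" "\<mu> < lam2" for \<mu>
      using \<open>in_spectral_gap (verts X) (dml X Ep \<sigma>) lam1 lam2\<close> that unfolding gap by blast
    show "g = (\<lambda>_. 0)" if "g \<in> ell2 (verts X)"
      "kernel_op full_kernel g = (\<lambda>v. of_real lam2 * g v)" for g
      using \<open>\<not> is_eigenvalue (verts X) (dml X Ep \<sigma>) (complex_of_real lam2)\<close> that A[OF that(1)]
      by (auto simp: is_eigenvalue_def eigenspace_def)
  qed
  show ?thesis using 1 2 by blast
qed

end
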